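(* The following decision problem is $NP$-complete. Instance: an odd graph $G$ with $\Delta(G)=3$. Question: does $G$ have a locally-balanced $2$-partition with a closed neighborhood?
   Context: All graphs are finite, undirected, without loops or multiple edges. $V(G)$ denotes the vertex set of $G$, $N_G(v)$ the set of neighbors of a vertex $v$, $N_G[v]=N_G(v)\cup\{v\}$, and $\Delta(G)$ the maximum degree of $G$. A graph is odd if the degree of every vertex is odd. A $2$-partition of a graph $G$ is a function $f:V(G)\to\{0,1\}$. A $2$-partition $f$ of $G$ is locally-balanced with a closed neighborhood if for every $v\in V(G)$, $\bigl|\,|\{u\in N_G[v]: f(u)=0\}|-|\{u\in N_G[v]: f(u)=1\}|\,\bigr|\le 1$. *)

theory Defs
  imports Main "HOL-Computational_Algebra.Polynomial"
begin

section \<open>Graphs\<close>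

record 'a graph =
  verts :: "'a set"
  edges :: "'a set set"

definition simple_graph :: "'a graph \<Rightarrow> bool" where
  "simple_graph G \<longleftrightarrow>
     finite (verts G) \<and> (\<forall>e \<in> edges G. e \<subseteq> verts G \<and> card e = 2)"

definition neighbors :: "'a graph \<Rightarrow> 'a \<Rightarrow> 'a set" where
  "neighbors G v = {u \<in> verts G. {u, v} \<in> edges G}"

definition closed_neighbors :: "'a graph \<Rightarrow> 'a \<Rightarrow> 'a set" where
  "closed_neighbors G v = insert v (neighbors G v)"

definition vertex_degree :: "'a graph \<Rightarrow> 'a \<Rightarrow> nat" where
  "vertex_degree G v = card (neighbors G v)"

text \<open>The inserted 0 only matters for the graph without vertices, where \<open>Max\<close> would be
  unspecified.\<close>

definition max_degree :: "'a graph \<Rightarrow> nat" where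
  "max_degree G = Max (insert 0 (vertex_degree G ` verts G))"

definition odd_graph :: "'a graph \<Rightarrow> bool" where
  "odd_graph G \<longleftrightarrow> (\<forall>v \<in> verts G. odd (vertex_degree G v))"

definition two_partition :: "'a graph \<Rightarrow> ('a \<Rightarrow> nat) \<Rightarrow> bool" where
  "two_partition G f \<longleftrightarrow> (\<forall>v \<in> verts G. f v \<in> {0, 1})"

definition locally_balanced_closed :: "'a graph \<Rightarrow> ('a \<Rightarrow> nat) \<Rightarrow> bool" where
  "locally_balanced_closed G f \<longleftrightarrow> two_partition G f \<and>
     (\<forall>v \<in> verts G.
        \<bar>int (card {u \<in> closed_neighbors G v. f u = 0})
         - int (card {u \<in> closed_neighbors G v. f u = 1})\<bar> \<le> 1)"

text \<open>Instances are graphs with vertex set \<open>{0, \<dots>, n - 1}\<close>, which every finite graph is up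
  to isomorphism, encoded by the rows of the adjacency matrix written one after the other.
  The length \<open>n\<^sup>2\<close> of the word determines \<open>n\<close>, so no separators are needed.\<close>

definition standard_graph :: "nat graph \<Rightarrow> bool" where
  "standard_graph G \<longleftrightarrow> simple_graph G \<and> (\<exists>n. verts G = {..<n})"

definition encode_graph :: "nat graph \<Rightarrow> bool list" where
  "encode_graph G =
     (let n = card (verts G)
      in concat (map (\<lambda>i. map (\<lambda>j. {i, j} \<in> edges G) [0..<n]) [0..<n]))"


section \<open>Nondeterministic multitape Turing machines\<close>

text \<open>States and tape symbols are natural numbers; since the transition table is finite, only
  finitely many of them occur in it. Symbol 0 is the blank. A tape is
  two-way infinite and is stored together with its head position. A transition
  \<open>(q, rs, q', as)\<close> may be taken in state \<open>q\<close> when the heads read the symbols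
  \<open>rs\<close>; it goes to state \<open>q'\<close>, and on the \<open>i\<close>-th tape writes a
  symbol and moves the head as told by \<open>as ! i\<close>.\<close>

datatype move = MoveLeft | Stay | MoveRight

type_synonym action = "nat \<times> move"
type_synonym transition = "nat \<times> nat list \<times> nat \<times> action list"
type_synonym tape = "(int \<Rightarrow> nat) \<times> int"
type_synonym config = "nat \<times> tape list"

record machine =
  tape_count :: nat
  start_state :: nat
  accept_state :: nat
  transitions :: "transition set"

definition turing_machine :: "machine \<Rightarrow> bool" where
  "turing_machine M \<longleftrightarrow> tape_count M \<ge> 1 \<and> finite (transitions M) \<and>
     (\<forall>(q, rs, q', as) \<in> transitions M.
        length rs = tape_count M \<and> length as = tape_count M)"

definition deterministic :: "machine \<Rightarrow> bool" where
  "deterministic M \<longleftrightarrow>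
     (\<forall>q rs q1 as1 q2 as2.
        (q, rs, q1, as1) \<in> transitions M \<longrightarrow> (q, rs, q2, as2) \<in> transitions M \<longrightarrow>
        q1 = q2 \<and> as1 = as2)"

fun move_head :: "move \<Rightarrow> int \<Rightarrow> int" where
  "move_head MoveLeft p = p - 1"
| "move_head Stay p = p"
| "move_head MoveRight p = p + 1"

fun read_tape :: "tape \<Rightarrow> nat" where
  "read_tape (t, p) = t p"

fun act :: "action \<Rightarrow> tape \<Rightarrow> tape" where
  "act (s, m) (t, p) = (t(p := s), move_head m p)"

definition step :: "machine \<Rightarrow> config \<Rightarrow> config \<Rightarrow> bool" where
  "step M c c' \<longleftrightarrow>
     (\<exists>q ts q' as. c = (q, ts) \<and> (q, map read_tape ts, q', as) \<in> transitions M \<and>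
        c' = (q', map2 act as ts))"

definition halted :: "machine \<Rightarrow> config \<Rightarrow> bool" where
  "halted M c \<longleftrightarrow> (\<nexists>c'. step M c c')"

definition symbol_of_bit :: "bool \<Rightarrow> nat" where
  "symbol_of_bit b = (if b then 2 else 1)"

definition word_tape :: "bool list \<Rightarrow> int \<Rightarrow> nat" where
  "word_tape w i =
     (if 0 \<le> i \<and> i < int (length w) then symbol_of_bit (w ! nat i) else 0)"

text \<open>The input is on the first tape; the output is read off the last one, which
  is the same tape for one-tape machines.\<close>

definition initial_config :: "machine \<Rightarrow> bool list \<Rightarrow> config" where
  "initial_config M w =
     (start_state M, (word_tape w, 0) # replicate (tape_count M - 1) (word_tape [], 0))"

definition accepts :: "machine \<Rightarrow> bool list \<Rightarrow> bool" where
  "accepts M w \<longleftrightarrow>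
     (\<exists>c. (step M)\<^sup>*\<^sup>* (initial_config M w) c \<and> halted M c \<and> fst c = accept_state M)"

text \<open>The bound applies to every computation branch.\<close>

definition polynomial_time :: "machine \<Rightarrow> bool" where
  "polynomial_time M \<longleftrightarrow>
     (\<exists>p :: nat poly. \<forall>w n c.
        (step M ^^ n) (initial_config M w) c \<longrightarrow> n \<le> poly p (length w))"


section \<open>NP-completeness\<close>

definition NP :: "bool list set set" where
  "NP = {L. \<exists>M. turing_machine M \<and> polynomial_time M \<and> L = {w. accepts M w}}"

definition computes :: "machine \<Rightarrow> (bool list \<Rightarrow> bool list) \<Rightarrow> bool" where
  "computes M f \<longleftrightarrow>
     (\<forall>w. \<exists>q ts. (step M)\<^sup>*\<^sup>* (initial_config M w) (q, ts) \<and> halted M (q, ts) \<and>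
        fst (last ts) = word_tape (f w))"

definition polynomial_time_computable :: "(bool list \<Rightarrow> bool list) \<Rightarrow> bool" where
  "polynomial_time_computable f \<longleftrightarrow>
     (\<exists>M. turing_machine M \<and> deterministic M \<and> polynomial_time M \<and> computes M f)"

text \<open>NP-completeness of the decision problem with instances \<open>I\<close>, question \<open>Q\<close>
  and injective encoding \<open>enc\<close> of the instances as words. Membership in NP is that of the
  language of encoded yes-instances, so words that encode no instance have to be rejected;
  a reduction has to produce encodings of instances only.\<close>

definition NP_complete :: "('i \<Rightarrow> bool list) \<Rightarrow> 'i set \<Rightarrow> ('i \<Rightarrow> bool) \<Rightarrow> bool" where
  "NP_complete enc I Q \<longleftrightarrow>
     inj_on enc I \<and>
     enc ` {x \<in> I. Q x} \<in> NP \<and>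
     (\<forall>L \<in> NP. \<exists>f. polynomial_time_computable f \<and>
        (\<forall>w. f w \<in> enc ` I \<and> (w \<in> L \<longleftrightarrow> f w \<in> enc ` {x \<in> I. Q x})))"

end

theory Submission
  imports Defs
begin

text \<open>In an odd graph a 2-partition is locally balanced with a closed neighbourhood iff every vertex
  of degree \<open>2 m + 1\<close> has exactly \<open>m\<close> neighbours of its own colour: a leaf differs from its
  neighbour, and a vertex of degree 3 agrees with exactly one neighbour.

  Turing machines are obtained from arithmetic expressions with bounded sums and access to the input
  symbols: such an expression is evaluated by a program whose registers are unary counters (head
  positions on marked tapes), in polynomial time. Membership in NP then needs only an expression that
  checks a guessed colouring, and a reduction needs only an expression for the entries of the
  adjacency matrix.

  For hardness, the computations of a nondeterministic machine on a word are described by clauses of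
  unbounded width over a tableau; each clause is replaced by a chain of not-all-equal constraints on
  three literals, and these are turned into a graph. There each variable is a long cycle whose hubs
  alternate in colour, and a constraint is a gadget on three hubs that is colourable iff the hubs do
  not all agree. The gadget always gives its port a colour different from that of the hub, just as a
  leaf would, so unused hubs simply end in a leaf.\<close>

section \<open>Structured programs for Turing machines\<close>

text \<open>Swapping the two colours preserves balance, so graphs can only express conditions
  invariant under complement. Hence not-all-equal constraints stand between clauses and graphs, and
  truth means agreement with a distinguished variable 0. Bounded sums and truncated subtraction
  express order, equality and bounded quantifiers. Both the verifier and the adjacency matrix thus
  become bounded arithmetic formulas whose quantifiers range over polynomially many values;
  brute-force evaluation with unary counters is polynomial, and its cost is analysed once, by
  recursion on expressions. This shapes all encodings: every cycle has the same length, every chain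
  of constraints runs through all variables of the formula, and every clause number is a tuple of
  digits, so that adjacency is plain arithmetic on indices. The tableau clauses are implications
  that force the facts of a real computation to hold. They do not demand that a cell has only one
  symbol or a tape only one head; additional facts only make them harder to satisfy.\<close>

type_synonym store = "nat \<Rightarrow> tape"

text \<open>The function in \<open>Act\<close> sees the symbols under all heads at once and chooses
  the action of every tape, so one \<open>Act\<close> is one machine step and control flow can be
  carried by machine states alone.\<close>

datatype com =
    Act "(nat \<Rightarrow> nat) \<Rightarrow> nat \<Rightarrow> action"
  | Seq com com
  | While "(nat \<Rightarrow> nat) \<Rightarrow> bool" com

definition reads :: "nat \<Rightarrow> store \<Rightarrow> nat \<Rightarrow> nat" where
  "reads k s = (\<lambda>i. if i < k then read_tape (s i) else 0)"

text \<open>The working alphabet is the blank 0, the bits 1 and 2, and the mark 3. A compiled table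
  has one transition per vector of read symbols, so the alphabet has to be finite.\<close>

definition good :: "nat \<Rightarrow> store \<Rightarrow> bool" where
  "good k s \<longleftrightarrow> (\<forall>i<k. read_tape (s i) < 4)"

definition effect :: "((nat \<Rightarrow> nat) \<Rightarrow> nat \<Rightarrow> action) \<Rightarrow> nat \<Rightarrow> store \<Rightarrow> store" where
  "effect F k s = (\<lambda>i. if i < k then act (F (reads k s) i) (s i) else s i)"

text \<open>The step count is exact. A test costs one step whether it succeeds or fails, because
  both outcomes are compiled into jumps.\<close>

inductive exec :: "nat \<Rightarrow> com \<Rightarrow> store \<Rightarrow> nat \<Rightarrow> store \<Rightarrow> bool" for k where
  Act: "good k s \<Longrightarrow> exec k (Act F) s 1 (effect F k s)"
| Seq: "exec k c1 s m s' \<Longrightarrow> exec k c2 s' n s'' \<Longrightarrow> exec k (Seq c1 c2) s (m + n) s''"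
| WhileF: "good k s \<Longrightarrow> \<not> P (reads k s) \<Longrightarrow> exec k (While P c) s 1 s"
| WhileT: "good k s \<Longrightarrow> P (reads k s) \<Longrightarrow> exec k c s m s' \<Longrightarrow>
    exec k (While P c) s' n s'' \<Longrightarrow> exec k (While P c) s (1 + m + n) s''"

fun com_size :: "com \<Rightarrow> nat" where
  "com_size (Act F) = 1"
| "com_size (Seq c1 c2) = com_size c1 + com_size c2"
| "com_size (While P c) = 1 + com_size c"

section \<open>Compilation of programs into transition tables\<close>

definition words :: "nat \<Rightarrow> nat list set" where
  "words k = {rs. set rs \<subseteq> {..<4} \<and> length rs = k}"

definition vec :: "nat \<Rightarrow> nat list \<Rightarrow> nat \<Rightarrow> nat" where
  "vec k rs = (\<lambda>i. if i < k then rs ! i else 0)"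

definition idle :: "nat list \<Rightarrow> action list" where
  "idle rs = map (\<lambda>r. (r, Stay)) rs"

definition jumps :: "nat \<Rightarrow> ((nat \<Rightarrow> nat) \<Rightarrow> bool) \<Rightarrow> nat \<Rightarrow> nat \<Rightarrow> transition set" where
  "jumps k P q q' = {(q, rs, q', idle rs) | rs. rs \<in> words k \<and> P (vec k rs)}"

text \<open>The code of \<open>c\<close> owns the states from \<open>q\<close> to
  \<open>q + com_size c - 1\<close> and leaves to \<open>e\<close>. The body of a loop leaves to the
  first state of the loop, where the test is repeated.\<close>

fun compile :: "nat \<Rightarrow> com \<Rightarrow> nat \<Rightarrow> nat \<Rightarrow> transition set" where
  "compile k (Act F) q e = {(q, rs, e, map (F (vec k rs)) [0..<k]) | rs. rs \<in> words k}"
| "compile k (Seq c1 c2) q e =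
     compile k c1 q (q + com_size c1) \<union> compile k c2 (q + com_size c1) e"
| "compile k (While P c) q e =
     jumps k P q (q + 1) \<union> jumps k (\<lambda>v. \<not> P v) q e \<union> compile k c (q + 1) q"

definition tape_list :: "nat \<Rightarrow> store \<Rightarrow> tape list" where
  "tape_list k s = map s [0..<k]"

lemma finite_words: "finite (words k)"
  unfolding words_def by (rule finite_lists_length_eq) simp

lemma finite_jumps: "finite (jumps k P q q')"
  by (rule finite_subset[OF _ finite_imageI[OF finite_words[of k],
          of "\<lambda>rs. (q, rs, q', idle rs)"]]) (auto simp: jumps_def)

lemma com_size_pos: "com_size c > 0"
  by (induction c) auto

lemma finite_compile: "finite (compile k c q e)"
proof (induction c arbitrary: q e)
  case (Act F)
  show ?case
    by (rule finite_subset[OF _ finite_imageI[OF finite_words[of k],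
            of "\<lambda>rs. (q, rs, e, map (F (vec k rs)) [0..<k])"]]) auto
qed (auto simp: finite_jumps)

lemma compile_wellformed:
  "(q1, rs, q2, as) \<in> compile k c q e \<Longrightarrow> length rs = k \<and> length as = k"
  by (induction c arbitrary: q e) (auto simp: jumps_def words_def idle_def)

lemma compile_source:
  "(q1, rs, q2, as) \<in> compile k c q e \<Longrightarrow> q \<le> q1 \<and> q1 < q + com_size c"
proof (induction c arbitrary: q e)
  case (Seq c1 c2)
  from Seq.prems consider "(q1, rs, q2, as) \<in> compile k c1 q (q + com_size c1)"
    | "(q1, rs, q2, as) \<in> compile k c2 (q + com_size c1) e" by auto
  then show ?case by cases (use Seq.IH in force)+
next
  case (While P c)
  from While.prems consider "q1 = q" | "(q1, rs, q2, as) \<in> compile k c (q + 1) q"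
    by (auto simp: jumps_def)
  then show ?case by cases (use While.IH in force)+
qed auto

lemma compile_target:
  "(q1, rs, q2, as) \<in> compile k c q e \<Longrightarrow> q2 = e \<or> q \<le> q2 \<and> q2 < q + com_size c"
proof (induction c arbitrary: q e)
  case (Seq c1 c2)
  from Seq.prems consider "(q1, rs, q2, as) \<in> compile k c1 q (q + com_size c1)"
    | "(q1, rs, q2, as) \<in> compile k c2 (q + com_size c1) e" by auto
  then show ?case
  proof cases
    case 1
    from Seq.IH(1)[OF this] show ?thesis using com_size_pos[of c2] by auto
  next
    case 2
    from Seq.IH(2)[OF this] show ?thesis by auto
  qed
next
  case (While P c)
  from While.prems consider "q2 = q + 1" | "q2 = e" | "(q1, rs, q2, as) \<in> compile k c (q + 1) q"
    by (auto simp: jumps_def)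
  then show ?case
  proof cases
    case 3
    from While.IH[OF this] show ?thesis by auto
  qed (use com_size_pos[of c] in auto)
qed auto

text \<open>By \<open>compile_source\<close> the parts of a program own disjoint intervals of source
  states, so two transitions with a common source stem from the same part. The two jumps of a test
  exclude each other by their conditions.\<close>

lemma compile_deterministic:
  "(q1, rs, q2, as) \<in> compile k c q e \<Longrightarrow> (q1, rs, q3, bs) \<in> compile k c q e \<Longrightarrow>
    q2 = q3 \<and> as = bs"
proof (induction c arbitrary: q e)
  case (Seq c1 c2)
  let ?A = "compile k c1 q (q + com_size c1)" and ?B = "compile k c2 (q + com_size c1) e"
  have disj: "\<not> ((q1, rs, x, xs) \<in> ?A \<and> (q1, rs, y, ys) \<in> ?B)" for x xs y ys
    by (auto dest!: compile_source)
  from Seq.prems disj consider "(q1, rs, q2, as) \<in> ?A" "(q1, rs, q3, bs) \<in> ?A"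
    | "(q1, rs, q2, as) \<in> ?B" "(q1, rs, q3, bs) \<in> ?B" by auto
  then show ?case by cases (use Seq.IH in blast)+
next
  case (While P c)
  let ?A = "jumps k P q (q + 1) \<union> jumps k (\<lambda>v. \<not> P v) q e" and ?B = "compile k c (q + 1) q"
  have disj: "\<not> ((q1, rs, x, xs) \<in> ?A \<and> (q1, rs, y, ys) \<in> ?B)" for x xs y ys
    by (auto simp: jumps_def dest!: compile_source)
  from While.prems disj consider "(q1, rs, q2, as) \<in> ?A" "(q1, rs, q3, bs) \<in> ?A"
    | "(q1, rs, q2, as) \<in> ?B" "(q1, rs, q3, bs) \<in> ?B" by auto
  then show ?case
  proof cases
    case 1
    then show ?thesis by (auto simp: jumps_def)
  next
    case 2
    then show ?thesis using While.IH by blast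
  qed
qed auto

lemma tape_list_length [simp]: "length (tape_list k s) = k"
  by (simp add: tape_list_def)

lemma vec_tape_list: "vec k (map read_tape (tape_list k s)) = reads k s"
  by (auto simp: vec_def reads_def tape_list_def)

lemma words_tape_list: "good k s \<Longrightarrow> map read_tape (tape_list k s) \<in> words k"
  by (auto simp: words_def good_def tape_list_def)

lemma act_idle: "map2 act (idle (map read_tape ts)) ts = ts"
proof -
  have "act (read_tape x, Stay) x = x" for x by (cases x) auto
  then show ?thesis by (induction ts) (auto simp: idle_def)
qed

lemma step_jump:
  assumes "jumps k P q q' \<subseteq> transitions M" "good k s" "P (reads k s)"
  shows "step M (q, tape_list k s) (q', tape_list k s)"
proof -
  let ?ts = "tape_list k s"
  have "(q, map read_tape ?ts, q', idle (map read_tape ?ts)) \<in> transitions M"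
    using assms words_tape_list[OF assms(2)] vec_tape_list[of k s] unfolding jumps_def by force
  then show ?thesis unfolding step_def by (metis act_idle)
qed

lemma effect_tape_list:
  "tape_list k (effect F k s) = map2 act (map (F (reads k s)) [0..<k]) (tape_list k s)"
  by (auto simp: tape_list_def effect_def list_eq_iff_nth_eq)

lemma relpowp_trans: "(R ^^ m) a b \<Longrightarrow> (R ^^ n) b c \<Longrightarrow> (R ^^ (m + n)) a c"
  by (auto simp: relpowp_add)

lemma compile_correct:
  "exec k c s n s' \<Longrightarrow> compile k c q e \<subseteq> transitions M \<Longrightarrow>
    (step M ^^ n) (q, tape_list k s) (e, tape_list k s')"
proof (induction arbitrary: q e rule: exec.induct)
  case (Act s F)
  let ?ts = "tape_list k s"
  have "(q, map read_tape ?ts, e, map (F (vec k (map read_tape ?ts))) [0..<k]) \<in> transitions M"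
    using Act words_tape_list[OF Act(1)] by auto
  then have "step M (q, ?ts) (e, tape_list k (effect F k s))"
    unfolding step_def effect_tape_list vec_tape_list by blast
  then show ?case by (simp add: OO_def)
next
  case (Seq c1 s m s' c2 n s'')
  then have "(step M ^^ m) (q, tape_list k s) (q + com_size c1, tape_list k s')"
    "(step M ^^ n) (q + com_size c1, tape_list k s') (e, tape_list k s'')" by auto
  then show ?case by (rule relpowp_trans)
next
  case (WhileF s P c)
  then have "step M (q, tape_list k s) (e, tape_list k s)"
    by (intro step_jump[of k "\<lambda>v. \<not> P v"]) simp_all
  then show ?case by (simp add: OO_def)
next
  case (WhileT s P c m s' n s'')
  have 1: "step M (q, tape_list k s) (q + 1, tape_list k s)"
    using WhileT by (intro step_jump[of k P]) simp_all
  have 2: "(step M ^^ m) (q + 1, tape_list k s) (q, tape_list k s')"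
    "(step M ^^ n) (q, tape_list k s') (e, tape_list k s'')"
    using WhileT.IH WhileT.prems by auto
  have "(step M ^^ (m + n)) (q + 1, tape_list k s) (e, tape_list k s'')"
    using 2 by (rule relpowp_trans)
  with 1 have "(step M ^^ Suc (m + n)) (q, tape_list k s) (e, tape_list k s'')"
    by (rule relpowp_Suc_I2)
  then show ?case by simp
qed

lemma step_functional:
  assumes "deterministic M" "step M c c1" "step M c c2"
  shows "c1 = c2"
  using assms unfolding deterministic_def step_def by (metis prod.inject)

text \<open>A partial run of a functional relation is a prefix of the run that stops, so the length
  of one halting run bounds all runs. The relation is arbitrary because this is also applied to the
  deterministic phase of a nondeterministic machine.\<close>

lemma deterministic_run:
  assumes "\<And>c c1 c2. R c c1 \<Longrightarrow> R c c2 \<Longrightarrow> c1 = c2"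
    "(R ^^ N) c0 c" "\<nexists>c'. R c c'" "(R ^^ n) c0 d"
  shows "n \<le> N \<and> (R ^^ (N - n)) d c"
  using assms(2,4)
proof (induction n arbitrary: N c0)
  case 0
  then show ?case by auto
next
  case (Suc n)
  from Suc.prems(2) obtain c1 where c1: "R c0 c1" "(R ^^ n) c1 d"
    by (metis relpowp_Suc_D2)
  from c1 assms(3) Suc.prems(1) obtain N' where N: "N = Suc N'"
    by (cases N) auto
  with Suc.prems(1) obtain c2 where "R c0 c2" "(R ^^ N') c2 c"
    by (metis relpowp_Suc_D2)
  then have "(R ^^ N') c1 c" using assms(1) c1(1) by blast
  from Suc.IH[OF this c1(2)] show ?case by (simp add: N)
qed

section \<open>Arithmetic expressions evaluated by register programs\<close>

text \<open>A register is a tape that is blank except for the symbol 3 at cell 0; its value is its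
  head position.\<close>

definition marked :: "int \<Rightarrow> nat" where
  "marked p = (if p = 0 then 3 else 0)"

text \<open>Tape 0 holds the input, tape 1 the guess, the last tape the output, and those in between
  are counters. The bound 2 on the first two tapes lets two threshold tests read a symbol as a
  number.\<close>

definition registers :: "nat \<Rightarrow> (nat \<Rightarrow> int \<Rightarrow> nat) \<Rightarrow> bool" where
  "registers k C \<longleftrightarrow> k \<ge> 3 \<and> (\<forall>i. 2 \<le> i \<longrightarrow> i < k - 1 \<longrightarrow> C i = marked) \<and>
     (\<forall>i<k. \<forall>p. C i p < 4) \<and> (\<forall>i<2. \<forall>p. C i p \<le> 2)"

definition tapes :: "(nat \<Rightarrow> int \<Rightarrow> nat) \<Rightarrow> (nat \<Rightarrow> nat) \<Rightarrow> store" where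
  "tapes C h = (\<lambda>i. (C i, int (h i)))"

definition runs :: "nat \<Rightarrow> com \<Rightarrow> store \<Rightarrow> nat \<Rightarrow> store \<Rightarrow> bool" where
  "runs k c s t s' \<longleftrightarrow> (\<exists>n\<le>t. exec k c s n s')"

lemma runs_mono: "runs k c s t s' \<Longrightarrow> t \<le> t' \<Longrightarrow> runs k c s t' s'"
  unfolding runs_def using le_trans by blast

lemma runs_Seq: "runs k c1 s t1 s' \<Longrightarrow> runs k c2 s' t2 s'' \<Longrightarrow> runs k (Seq c1 c2) s (t1 + t2) s''"
  unfolding runs_def by (meson add_mono exec.Seq)

lemma runs_While:
  assumes "\<And>j. j \<le> N \<Longrightarrow> good k (S j)"
    and "\<And>j. j < N \<Longrightarrow> P (reads k (S j))"
    and "\<And>j. j < N \<Longrightarrow> runs k c (S j) t (S (Suc j))"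
    and "\<not> P (reads k (S N))"
  shows "runs k (While P c) (S 0) (N * (t + 1) + 1) (S N)"
  using assms
proof (induction N arbitrary: S)
  case 0
  then have "exec k (While P c) (S 0) 1 (S 0)" by (intro exec.WhileF) auto
  then show ?case unfolding runs_def by auto
next
  case (Suc N)
  have "runs k (While P c) (S (Suc 0)) (N * (t + 1) + 1) (S (Suc N))"
    using Suc.prems by (intro Suc.IH[of "\<lambda>j. S (Suc j)"]) auto
  then obtain n where n: "n \<le> N * (t + 1) + 1" "exec k (While P c) (S (Suc 0)) n (S (Suc N))"
    unfolding runs_def by blast
  obtain m where m: "m \<le> t" "exec k c (S 0) m (S (Suc 0))"
    using Suc.prems(3)[of 0] unfolding runs_def by auto
  have "exec k (While P c) (S 0) (1 + m + n) (S (Suc N))"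
    using Suc.prems(1)[of 0] Suc.prems(2)[of 0] m(2) n(2) by (intro exec.WhileT) auto
  moreover have "1 + m + n \<le> Suc N * (t + 1) + 1" using n(1) m(1) by simp
  ultimately show ?case unfolding runs_def by blast
qed

lemma good_tapes: "registers k C \<Longrightarrow> good k (tapes C h)"
  by (auto simp: registers_def good_def tapes_def)

lemma reads_tapes: "i < k \<Longrightarrow> reads k (tapes C h) i = C i (int (h i))"
  by (simp add: reads_def tapes_def)

lemma reads_register:
  "registers k C \<Longrightarrow> 2 \<le> r \<Longrightarrow> r < k - 1 \<Longrightarrow> reads k (tapes C h) r = (if h r = 0 then 3 else 0)"
  by (auto simp: reads_def tapes_def registers_def marked_def)

section \<open>Head movements and counting loops\<close>

definition movement :: "((nat \<Rightarrow> nat) \<Rightarrow> nat \<Rightarrow> move) \<Rightarrow> com" where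
  "movement D = Act (\<lambda>v i. (v i, D v i))"

lemma runs_movement:
  assumes "registers k C"
    and "\<And>i. i < k \<Longrightarrow> int (h' i) = move_head (D (reads k (tapes C h)) i) (int (h i))"
    and "\<And>i. i \<ge> k \<Longrightarrow> h' i = h i"
  shows "runs k (movement D) (tapes C h) 1 (tapes C h')"
proof -
  have "effect (\<lambda>v i. (v i, D v i)) k (tapes C h) = tapes C h'"
  proof
    fix i
    show "effect (\<lambda>v i. (v i, D v i)) k (tapes C h) i = tapes C h' i"
      using assms(2,3)[of i] by (cases "i < k") (auto simp: effect_def tapes_def reads_def)
  qed
  moreover have "exec k (movement D) (tapes C h) 1 (effect (\<lambda>v i. (v i, D v i)) k (tapes C h))"
    unfolding movement_def by (rule exec.Act) (rule good_tapes[OF assms(1)])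
  ultimately show ?thesis unfolding runs_def by auto
qed

definition "inc r = movement (\<lambda>v i. if i = r then MoveRight else Stay)"
definition "inc2 r r' = movement (\<lambda>v i. if i = r \<or> i = r' then MoveRight else Stay)"
definition "inc_if r j b = movement (\<lambda>v i. if i = r \<and> v j \<ge> b then MoveRight else Stay)"
text \<open>The head does not leave the mark, so decrementing is truncated at 0.\<close>

definition "dec r = movement (\<lambda>v i. if i = r \<and> v i \<noteq> 3 then MoveLeft else Stay)"
definition "left j = movement (\<lambda>v i. if i = j then MoveLeft else Stay)"
definition "skip = movement (\<lambda>v i. Stay)"
definition "loop r c = While (\<lambda>v. v r \<noteq> 3) (Seq (dec r) c)"

lemma runs_skip: "registers k C \<Longrightarrow> runs k skip (tapes C h) 1 (tapes C h)"
  unfolding skip_def by (rule runs_movement) auto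

lemma runs_inc:
  "registers k C \<Longrightarrow> r < k \<Longrightarrow> runs k (inc r) (tapes C h) 1 (tapes C (h(r := h r + 1)))"
  unfolding inc_def by (rule runs_movement) auto

lemma runs_inc_if:
  "registers k C \<Longrightarrow> r < k \<Longrightarrow> j < k \<Longrightarrow>
    runs k (inc_if r j b) (tapes C h) 1 (tapes C (h(r := h r + of_bool (C j (int (h j)) \<ge> b))))"
  unfolding inc_if_def by (rule runs_movement) (auto simp: reads_tapes)

lemma runs_dec:
  "registers k C \<Longrightarrow> 2 \<le> r \<Longrightarrow> r < k - 1 \<Longrightarrow>
    runs k (dec r) (tapes C h) 1 (tapes C (h(r := h r - 1)))"
  unfolding dec_def by (rule runs_movement) (auto simp: reads_register)

text \<open>\<open>H j\<close> and \<open>C j\<close> describe the tapes after \<open>j\<close>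
  rounds. The body starts after the decrement, hence \<open>N - Suc j\<close>. The contents may vary
  with \<open>j\<close> for the sake of a loop that prints.\<close>

lemma runs_loop_general:
  assumes "2 \<le> r" "r < k - 1"
    and "\<And>j. j \<le> N \<Longrightarrow> registers k (C j)"
    and "\<And>j. j \<le> N \<Longrightarrow> H j r = N - j"
    and "\<And>j. j < N \<Longrightarrow> runs k c (tapes (C j) ((H j)(r := N - Suc j))) t (tapes (C (Suc j)) (H (Suc j)))"
  shows "runs k (loop r c) (tapes (C 0) (H 0)) (N * (t + 2) + 1) (tapes (C N) (H N))"
proof -
  let ?S = "\<lambda>j. tapes (C j) (H j)"
  have "runs k (loop r c) (?S 0) (N * ((1 + t) + 1) + 1) (?S N)"
    unfolding loop_def
  proof (rule runs_While[where S = ?S])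
    show "good k (?S j)" if "j \<le> N" for j using assms(3)[OF that] by (rule good_tapes)
    show "reads k (?S j) r \<noteq> 3" if "j < N" for j
      using that assms(3)[of j] assms(4)[of j] assms(1,2) by (simp add: reads_register)
    show "\<not> reads k (?S N) r \<noteq> 3"
      using assms(3)[of N] assms(4)[of N] assms(1,2) by (simp add: reads_register)
    show "runs k (Seq (dec r) c) (?S j) (1 + t) (?S (Suc j))" if "j < N" for j
    proof (rule runs_Seq[OF _ assms(5)[OF that]])
      have "N - Suc j = H j r - 1" using assms(4)[of j] that by simp
      then show "runs k (dec r) (?S j) 1 (tapes (C j) ((H j)(r := N - Suc j)))"
        using runs_dec[of k "C j" r "H j"] assms(1,2) assms(3)[of j] that by simp
    qed
  qed
  then show ?thesis by simp
qed

lemma runs_loop: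
  assumes "registers k C" "2 \<le> r" "r < k - 1"
    and "\<And>j. j \<le> h r \<Longrightarrow> H j r = h r - j"
    and "\<And>j. j < h r \<Longrightarrow> runs k c (tapes C ((H j)(r := h r - Suc j))) t (tapes C (H (Suc j)))"
    and "H 0 = h" "h' = H (h r)" "h r * (t + 2) + 1 \<le> T"
  shows "runs k (loop r c) (tapes C h) T (tapes C h')"
  using runs_loop_general[where C = "\<lambda>_. C" and H = H and N = "h r" and t = t and c = c, OF assms(2,3)]
    assms runs_mono by auto

section \<open>Expressions, their evaluation and its cost\<close>

datatype exp =
    Const nat
  | Var nat
  | Add exp exp
  | Monus exp exp
  | Sum nat exp exp
  | Sym bool exp

fun eval :: "(bool \<Rightarrow> nat \<Rightarrow> nat) \<Rightarrow> exp \<Rightarrow> (nat \<Rightarrow> nat) \<Rightarrow> nat" where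
  "eval I (Const n) \<sigma> = n"
| "eval I (Var v) \<sigma> = \<sigma> v"
| "eval I (Add a b) \<sigma> = eval I a \<sigma> + eval I b \<sigma>"
| "eval I (Monus a b) \<sigma> = eval I a \<sigma> - eval I b \<sigma>"
| "eval I (Sum v b e) \<sigma> = (\<Sum>x<eval I b \<sigma>. eval I e (\<sigma>(v := x)))"
| "eval I (Sym j e) \<sigma> = I j (eval I e \<sigma>)"

fun incs :: "nat \<Rightarrow> nat \<Rightarrow> com" where
  "incs 0 r = skip"
| "incs (Suc n) r = Seq (inc r) (incs n r)"

definition tape_of :: "bool \<Rightarrow> nat" where
  "tape_of j = (if j then 1 else 0)"

text \<open>Adds the value of the expression to register \<open>r\<close>. Variables are held in the registers
  given by \<open>\<rho>\<close>; registers from \<open>d\<close> on are scratch space, zero before and after.\<close>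

fun evaluate :: "exp \<Rightarrow> (nat \<Rightarrow> nat) \<Rightarrow> nat \<Rightarrow> nat \<Rightarrow> com" where
  "evaluate (Const n) \<rho> r d = incs n r"
| "evaluate (Var v) \<rho> r d = Seq (loop (\<rho> v) (inc d)) (loop d (inc2 (\<rho> v) r))"
| "evaluate (Add a b) \<rho> r d = Seq (evaluate a \<rho> r d) (evaluate b \<rho> r d)"
| "evaluate (Monus a b) \<rho> r d =
     Seq (evaluate a \<rho> d (d + 2)) (Seq (evaluate b \<rho> (d + 1) (d + 2))
       (Seq (loop (d + 1) (dec d)) (loop d (inc r))))"
| "evaluate (Sum v b e) \<rho> r d =
     Seq (evaluate b \<rho> (d + 1) (d + 2))
       (Seq (loop (d + 1) (Seq (evaluate e (\<rho>(v := d)) r (d + 2)) (inc d))) (loop d skip))"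
| "evaluate (Sym j e) \<rho> r d =
     Seq (evaluate e \<rho> d (d + 2)) (Seq (loop d (inc2 (d + 1) (tape_of j)))
       (Seq (Seq (inc_if r (tape_of j) 1) (inc_if r (tape_of j) 2)) (loop (d + 1) (left (tape_of j)))))"

fun depth :: "exp \<Rightarrow> nat" where
  "depth (Const n) = 0"
| "depth (Var v) = 1"
| "depth (Add a b) = max (depth a) (depth b)"
| "depth (Monus a b) = 2 + max (depth a) (depth b)"
| "depth (Sum v b e) = 2 + max (depth b) (depth e)"
| "depth (Sym j e) = 2 + depth e"

text \<open>A single number \<open>m\<close> bounds all variables. A summation variable stays below
  the value of the range expression, hence the argument \<open>m + value_bound b m\<close> for the
  body.\<close>

fun value_bound :: "exp \<Rightarrow> nat \<Rightarrow> nat" where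
  "value_bound (Const n) m = n"
| "value_bound (Var v) m = m"
| "value_bound (Add a b) m = value_bound a m + value_bound b m"
| "value_bound (Monus a b) m = value_bound a m"
| "value_bound (Sum v b e) m = value_bound b m * value_bound e (m + value_bound b m)"
| "value_bound (Sym j e) m = 2"

text \<open>Follows \<open>evaluate\<close> part by part. A loop of \<open>N\<close> rounds with a
  body of one step costs \<open>3 * N + 1\<close>: test, decrement and body in each round, and the
  final test.\<close>

fun time_bound :: "exp \<Rightarrow> nat \<Rightarrow> nat" where
  "time_bound (Const n) m = n + 1"
| "time_bound (Var v) m = 2 * (3 * m + 1)"
| "time_bound (Add a b) m = time_bound a m + time_bound b m"
| "time_bound (Monus a b) m =
     time_bound a m + (time_bound b m + ((value_bound b m * 3 + 1) + (value_bound a m * 3 + 1)))"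
| "time_bound (Sum v b e) m =
     time_bound b m + ((value_bound b m * (time_bound e (m + value_bound b m) + 3) + 1) +
       (value_bound b m * 3 + 1))"
| "time_bound (Sym j e) m = time_bound e m + ((value_bound e m * 3 + 1) + (2 + (value_bound e m * 3 + 1)))"

lemma eval_le_value_bound:
  assumes "\<And>j p. I j p \<le> 2"
  shows "(\<And>v. \<sigma> v \<le> m) \<Longrightarrow> eval I e \<sigma> \<le> value_bound e m"
proof (induction e arbitrary: \<sigma> m)
  case (Sum v b e)
  have b: "eval I b \<sigma> \<le> value_bound b m" using Sum by simp
  have "eval I e (\<sigma>(v := x)) \<le> value_bound e (m + value_bound b m)" if "x < eval I b \<sigma>" for x
    using Sum.prems that b by (intro Sum.IH) (auto intro: trans_le_add1)
  then have "(\<Sum>x<eval I b \<sigma>. eval I e (\<sigma>(v := x)))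
      \<le> eval I b \<sigma> * value_bound e (m + value_bound b m)"
    using sum_bounded_above[of "{..<eval I b \<sigma>}" "\<lambda>x. eval I e (\<sigma>(v := x))"] by simp
  also have "\<dots> \<le> value_bound b m * value_bound e (m + value_bound b m)" using b by simp
  finally show ?case by simp
qed (use assms in \<open>auto intro: add_mono le_trans[OF diff_le_self]\<close>)

lemma runs_incs:
  "registers k C \<Longrightarrow> r < k \<Longrightarrow> runs k (incs n r) (tapes C h) (n + 1) (tapes C (h(r := h r + n)))"
proof (induction n arbitrary: h)
  case 0
  then show ?case using runs_skip[of k C h] by simp
next
  case (Suc n)
  have "(h(r := h r + 1))(r := (h(r := h r + 1)) r + n) = h(r := h r + Suc n)" by auto
  with runs_Seq[OF runs_inc[OF Suc.prems, of h] Suc.IH[OF Suc.prems, of "h(r := h r + 1)"]]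
  show ?case by (simp del: fun_upd_apply)
qed

lemma runs_clear:
  assumes "registers k C" "2 \<le> r" "r < k - 1" "h r \<le> m"
  shows "runs k (loop r skip) (tapes C h) (m * 3 + 1) (tapes C (h(r := 0)))"
proof (rule runs_loop[where H = "\<lambda>j. h(r := h r - j)" and t = 1, OF assms(1-3)])
  show "runs k skip (tapes C ((h(r := h r - j))(r := h r - Suc j))) 1
          (tapes C (h(r := h r - Suc j)))" for j
    using runs_skip[OF assms(1)] by simp
qed (use assms(4) in auto)

lemma runs_add_loop:
  assumes "registers k C" "2 \<le> r" "r < k - 1" "r' < k" "r \<noteq> r'" "h r \<le> m"
  shows "runs k (loop r (inc r')) (tapes C h) (m * 3 + 1) (tapes C (h(r := 0, r' := h r' + h r)))"
proof (rule runs_loop[where H = "\<lambda>j. h(r := h r - j, r' := h r' + j)" and t = 1, OF assms(1-3)])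
  show "runs k (inc r') (tapes C ((h(r := h r - j, r' := h r' + j))(r := h r - Suc j))) 1
          (tapes C (h(r := h r - Suc j, r' := h r' + Suc j)))" for j
    unfolding inc_def by (rule runs_movement[OF assms(1)]) (use assms(4,5) in auto)
qed (use assms(5,6) in auto)

lemma runs_add2_loop:
  assumes "registers k C" "2 \<le> r" "r < k - 1" "a < k" "b < k" "r \<noteq> a" "r \<noteq> b" "a \<noteq> b" "h r \<le> m"
  shows "runs k (loop r (inc2 a b)) (tapes C h) (m * 3 + 1)
    (tapes C (h(r := 0, a := h a + h r, b := h b + h r)))"
proof (rule runs_loop[where H = "\<lambda>j. h(r := h r - j, a := h a + j, b := h b + j)" and t = 1, OF assms(1-3)])
  show "runs k (inc2 a b) (tapes C ((h(r := h r - j, a := h a + j, b := h b + j))(r := h r - Suc j))) 1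
          (tapes C (h(r := h r - Suc j, a := h a + Suc j, b := h b + Suc j)))" for j
    unfolding inc2_def by (rule runs_movement[OF assms(1)]) (use assms(4-8) in auto)
qed (use assms in auto)

lemma runs_sub_loop:
  assumes "registers k C" "2 \<le> r" "r < k - 1" "2 \<le> r'" "r' < k - 1" "r \<noteq> r'" "h r \<le> m"
  shows "runs k (loop r (dec r')) (tapes C h) (m * 3 + 1) (tapes C (h(r := 0, r' := h r' - h r)))"
proof (rule runs_loop[where H = "\<lambda>j. h(r := h r - j, r' := h r' - j)" and t = 1, OF assms(1-3)])
  show "runs k (dec r') (tapes C ((h(r := h r - j, r' := h r' - j))(r := h r - Suc j))) 1
          (tapes C (h(r := h r - Suc j, r' := h r' - Suc j)))" for j
    unfolding dec_def
    by (rule runs_movement[OF assms(1)]) (use assms in \<open>auto simp: reads_register[OF assms(1)]\<close>)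
qed (use assms(6,7) in auto)

lemma runs_left_loop:
  assumes "registers k C" "2 \<le> r" "r < k - 1" "r' < k" "r \<noteq> r'" "h r' = h r" "h r \<le> m"
  shows "runs k (loop r (left r')) (tapes C h) (m * 3 + 1) (tapes C (h(r := 0, r' := 0)))"
proof (rule runs_loop[where H = "\<lambda>j. h(r := h r - j, r' := h r - j)" and t = 1, OF assms(1-3)])
  show "runs k (left r') (tapes C ((h(r := h r - j, r' := h r - j))(r := h r - Suc j))) 1
          (tapes C (h(r := h r - Suc j, r' := h r - Suc j)))" if "j < h r" for j
    unfolding left_def by (rule runs_movement[OF assms(1)]) (use that assms(4,5) in \<open>auto simp: of_nat_diff\<close>)
qed (use assms(5-7) in auto)

text \<open>Since \<open>r\<close> and the scratch registers are disjoint from the registers of the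
  variables, accumulating in \<open>r\<close> does not change the meaning of a subexpression that is
  evaluated later. Induction needs all of \<open>h\<close>, \<open>\<rho>\<close>, \<open>r\<close>,
  \<open>d\<close>, \<open>m\<close> arbitrary: operands go to scratch registers, and a sum assigns
  a scratch register to its variable.\<close>

lemma runs_evaluate:
  assumes "registers k C" "\<And>i. i < 2 \<Longrightarrow> h i = 0" "\<And>i. d \<le> i \<Longrightarrow> i < k - 1 \<Longrightarrow> h i = 0"
    and "\<And>v. 2 \<le> \<rho> v \<and> \<rho> v < d \<and> \<rho> v \<noteq> r \<and> h (\<rho> v) \<le> m" "2 \<le> r" "r < d" "d + depth e \<le> k - 1"
    and "\<And>j p. I j p = C (tape_of j) (int p)"
  shows "runs k (evaluate e \<rho> r d) (tapes C h) (time_bound e m)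
           (tapes C (h(r := h r + eval I e (\<lambda>v. h (\<rho> v)))))"
  using assms(2-7)
proof (induction e arbitrary: h \<rho> r d m)
  case (Const n)
  then have "r < k" by simp
  then show ?case using runs_incs[OF assms(1), of r n h] by (simp del: fun_upd_apply)
next
  case (Var v)
  \<comment> \<open>Reading a counter empties it, so the value is moved to \<open>d\<close> and from
    there to both \<open>\<rho> v\<close> and \<open>r\<close>.\<close>
  let ?h = "h(\<rho> v := 0, d := h d + h (\<rho> v))"
  let ?g = "?h(d := 0, \<rho> v := ?h (\<rho> v) + ?h d, r := ?h r + ?h d)"
  have *: "2 \<le> \<rho> v" "\<rho> v < d" "\<rho> v \<noteq> r" "h (\<rho> v) \<le> m" "d < k - 1" "h d = 0" "k \<ge> 3" "\<rho> v < k"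
    using Var.prems(3)[of v] Var.prems(2)[of d] Var.prems(6) assms(1) by (auto simp: registers_def)
  have "runs k (loop (\<rho> v) (inc d)) (tapes C h) (m * 3 + 1) (tapes C ?h)"
    by (rule runs_add_loop[OF assms(1)]) (use * in auto)
  moreover have "runs k (loop d (inc2 (\<rho> v) r)) (tapes C ?h) (m * 3 + 1) (tapes C ?g)"
    by (rule runs_add2_loop[OF assms(1)]) (use * Var.prems in auto)
  ultimately have "runs k (evaluate (Var v) \<rho> r d) (tapes C h) ((m * 3 + 1) + (m * 3 + 1)) (tapes C ?g)"
    unfolding evaluate.simps by (rule runs_Seq)
  moreover have "?g = h(r := h r + eval I (Var v) (\<lambda>v. h (\<rho> v)))"
    using * Var.prems by auto
  moreover have "(m * 3 + 1) + (m * 3 + 1) = time_bound (Var v) m" by simp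
  ultimately show ?case by metis
next
  case (Add a b)
  let ?\<sigma> = "\<lambda>v. h (\<rho> v)"
  let ?h = "h(r := h r + eval I a ?\<sigma>)"
  have 1: "runs k (evaluate a \<rho> r d) (tapes C h) (time_bound a m) (tapes C ?h)"
    by (rule Add.IH(1)) (use Add.prems in auto)
  have \<rho>: "(\<lambda>v. ?h (\<rho> v)) = ?\<sigma>" using Add.prems(3) by auto
  have "runs k (evaluate b \<rho> r d) (tapes C ?h) (time_bound b m)
      (tapes C (?h(r := ?h r + eval I b (\<lambda>v. ?h (\<rho> v)))))"
    by (rule Add.IH(2)) (use Add.prems in auto)
  moreover have "?h(r := ?h r + eval I b ?\<sigma>) = h(r := h r + eval I (Add a b) ?\<sigma>)" by auto
  ultimately have 2: "runs k (evaluate b \<rho> r d) (tapes C ?h) (time_bound b m)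
      (tapes C (h(r := h r + eval I (Add a b) ?\<sigma>)))" unfolding \<rho> by metis
  from runs_Seq[OF 1 2] show ?case by (simp del: fun_upd_apply)
next
  case (Monus a b)
  let ?\<sigma> = "\<lambda>v. h (\<rho> v)"
  let ?A = "eval I a ?\<sigma>" and ?B = "eval I b ?\<sigma>"
  have R: "2 \<le> \<rho> v" "\<rho> v < d" "\<rho> v < d + 1" "\<rho> v < d + 2" "\<rho> v \<noteq> d" "\<rho> v \<noteq> d + 1" "\<rho> v \<noteq> r"
      "h (\<rho> v) \<le> m" for v using Monus.prems(3)[of v] by auto
  have I: "I j p \<le> 2" for j p using assms(1,8) by (auto simp: registers_def tape_of_def)
  have A: "?A \<le> value_bound a m" and B: "?B \<le> value_bound b m"
    using eval_le_value_bound[OF I] Monus.prems(3) by auto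
  have d: "d + 1 < k - 1" "d < k - 1" "h d = 0" "h (d + 1) = 0"
    using Monus.prems by auto
  let ?h1 = "h(d := h d + ?A)"
  have 1: "runs k (evaluate a \<rho> d (d + 2)) (tapes C h) (time_bound a m) (tapes C ?h1)"
    by (rule Monus.IH(1)) (use Monus.prems(1,2,4-6) R in auto)
  have \<rho>: "(\<lambda>v. ?h1 (\<rho> v)) = ?\<sigma>" using R by auto
  let ?h2 = "?h1(d + 1 := ?h1 (d + 1) + ?B)"
  have "runs k (evaluate b \<rho> (d + 1) (d + 2)) (tapes C ?h1) (time_bound b m)
      (tapes C (?h1(d + 1 := ?h1 (d + 1) + eval I b (\<lambda>v. ?h1 (\<rho> v)))))"
    by (rule Monus.IH(2)) (use Monus.prems(1,2,4-6) R in auto)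
  then have 2: "runs k (evaluate b \<rho> (d + 1) (d + 2)) (tapes C ?h1) (time_bound b m) (tapes C ?h2)"
    unfolding \<rho> .
  let ?h3 = "?h2(d + 1 := 0, d := ?h2 d - ?h2 (d + 1))"
  have 3: "runs k (loop (d + 1) (dec d)) (tapes C ?h2) (value_bound b m * 3 + 1) (tapes C ?h3)"
    by (rule runs_sub_loop[OF assms(1)]) (use Monus.prems d B in auto)
  let ?h4 = "?h3(d := 0, r := ?h3 r + ?h3 d)"
  have 4: "runs k (loop d (inc r)) (tapes C ?h3) (value_bound a m * 3 + 1) (tapes C ?h4)"
    by (rule runs_add_loop[OF assms(1)]) (use Monus.prems d A in auto)
  have "?h4 = h(r := h r + eval I (Monus a b) ?\<sigma>)"
    using d Monus.prems(5) by auto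
  then show ?case
    using runs_Seq[OF 1 runs_Seq[OF 2 runs_Seq[OF 3 4]]] by (metis evaluate.simps(4) time_bound.simps(4))
next
  case (Sum v b e)
  let ?\<sigma> = "\<lambda>v. h (\<rho> v)"
  let ?B = "eval I b ?\<sigma>" and ?m = "m + value_bound b m"
  have R: "2 \<le> \<rho> v" "\<rho> v < d" "\<rho> v < d + 1" "\<rho> v < d + 2" "\<rho> v \<noteq> d" "\<rho> v \<noteq> d + 1" "\<rho> v \<noteq> r"
      "h (\<rho> v) \<le> m" for v using Sum.prems(3)[of v] by auto
  have I: "I j p \<le> 2" for j p using assms(1,8) by (auto simp: registers_def tape_of_def)
  have B: "?B \<le> value_bound b m"
    using eval_le_value_bound[OF I] Sum.prems(3) by auto
  have d: "d + 1 < k - 1" "d < k - 1" "h d = 0" "h (d + 1) = 0" "d + 1 < k" "d < k" "r \<noteq> d" "r \<noteq> d + 1" "d > 1"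
    using Sum.prems by auto
  let ?h1 = "h(d + 1 := h (d + 1) + ?B)"
  have 1: "runs k (evaluate b \<rho> (d + 1) (d + 2)) (tapes C h) (time_bound b m) (tapes C ?h1)"
    by (rule Sum.IH(1)) (use Sum.prems(1,2,4-6) R in auto)
  \<comment> \<open>Register \<open>d + 1\<close> counts the remaining rounds down, while
    \<open>d\<close> counts up and serves as the summation variable.\<close>
  define H where "H = (\<lambda>j. h(d + 1 := ?B - j, d := j, r := h r + (\<Sum>x<j. eval I e (?\<sigma>(v := x)))))"
  have 2: "runs k (loop (d + 1) (Seq (evaluate e (\<rho>(v := d)) r (d + 2)) (inc d))) (tapes C ?h1)
      (value_bound b m * (time_bound e ?m + 3) + 1) (tapes C (H ?B))"
  proof (rule runs_loop[OF assms(1), where H = H and t = "time_bound e ?m + 1"])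
    show "H 0 = ?h1" using d by (auto simp: H_def)
    show "H ?B = H (?h1 (d + 1))" using d by simp
    show "H j (d + 1) = ?h1 (d + 1) - j" for j using d by (simp add: H_def)
    have "?h1 (d + 1) = ?B" "time_bound e ?m + 1 + 2 = time_bound e ?m + 3" using d by simp_all
    then show "?h1 (d + 1) * (time_bound e ?m + 1 + 2) + 1 \<le> value_bound b m * (time_bound e ?m + 3) + 1"
      using mult_le_mono1[OF B, of "time_bound e ?m + 3"] by (simp only: add_le_mono1)
    show "runs k (Seq (evaluate e (\<rho>(v := d)) r (d + 2)) (inc d))
        (tapes C ((H j)(d + 1 := ?h1 (d + 1) - Suc j))) (time_bound e ?m + 1) (tapes C (H (Suc j)))"
      if j: "j < ?h1 (d + 1)" for j
    proof -
      let ?g = "(H j)(d + 1 := ?h1 (d + 1) - Suc j)"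
      have g: "(\<lambda>x. ?g ((\<rho>(v := d)) x)) = ?\<sigma>(v := j)"
        using R d by (auto simp: H_def)
      have "runs k (evaluate e (\<rho>(v := d)) r (d + 2)) (tapes C ?g) (time_bound e ?m)
          (tapes C (?g(r := ?g r + eval I e (\<lambda>x. ?g ((\<rho>(v := d)) x)))))"
      proof (rule Sum.IH(2))
        show "?g i = 0" if "i < 2" for i using that Sum.prems d by (auto simp: H_def)
        show "?g i = 0" if "d + 2 \<le> i" "i < k - 1" for i
          using that Sum.prems d by (auto simp: H_def)
        have "?g ((\<rho>(v := d)) x) \<le> ?m" for x
        proof -
          have "?g ((\<rho>(v := d)) x) = (?\<sigma>(v := j)) x" using fun_cong[OF g, of x] .
          also have "\<dots> \<le> ?m" using Sum.prems(3)[of x] j B d by auto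
          finally show ?thesis .
        qed
        moreover have "2 \<le> (\<rho>(v := d)) x \<and> (\<rho>(v := d)) x < d + 2 \<and> (\<rho>(v := d)) x \<noteq> r" for x
          using Sum.prems(3)[of x] d by auto
        ultimately show "2 \<le> (\<rho>(v := d)) x \<and> (\<rho>(v := d)) x < d + 2 \<and> (\<rho>(v := d)) x \<noteq> r \<and> ?g ((\<rho>(v := d)) x) \<le> ?m" for x
          by blast
      qed (use Sum.prems in auto)
      then have "runs k (evaluate e (\<rho>(v := d)) r (d + 2)) (tapes C ?g) (time_bound e ?m)
          (tapes C (?g(r := ?g r + eval I e (?\<sigma>(v := j)))))" unfolding g .
      from runs_Seq[OF this runs_inc[OF assms(1) d(6)]]
      have "runs k (Seq (evaluate e (\<rho>(v := d)) r (d + 2)) (inc d)) (tapes C ?g) (time_bound e ?m + 1)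
         (tapes C ((?g(r := ?g r + eval I e (?\<sigma>(v := j))))(d := (?g(r := ?g r + eval I e (?\<sigma>(v := j)))) d + 1)))" .
      moreover have "(?g(r := ?g r + eval I e (?\<sigma>(v := j))))(d := (?g(r := ?g r + eval I e (?\<sigma>(v := j)))) d + 1)
          = H (Suc j)" using d by (auto simp: H_def)
      ultimately show ?thesis by simp
    qed
  qed (use d in auto)
  have 3: "runs k (loop d skip) (tapes C (H ?B)) (value_bound b m * 3 + 1) (tapes C ((H ?B)(d := 0)))"
    by (rule runs_clear[OF assms(1)]) (use d B in \<open>auto simp: H_def\<close>)
  have "(H ?B)(d := 0) = h(r := h r + eval I (Sum v b e) ?\<sigma>)"
    using d by (auto simp: H_def)
  then show ?case
    using runs_Seq[OF 1 runs_Seq[OF 2 3]] by (metis evaluate.simps(5) time_bound.simps(5))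
next
  case (Sym j e)
  let ?\<sigma> = "\<lambda>v. h (\<rho> v)" and ?t = "tape_of j"
  let ?E = "eval I e ?\<sigma>"
  have R: "2 \<le> \<rho> v" "\<rho> v < d" "\<rho> v < d + 1" "\<rho> v < d + 2" "\<rho> v \<noteq> d" "\<rho> v \<noteq> d + 1" "\<rho> v \<noteq> r"
      "h (\<rho> v) \<le> m" for v using Sym.prems(3)[of v] by auto
  have I: "I j p \<le> 2" for j p using assms(1,8) by (auto simp: registers_def tape_of_def)
  have E: "?E \<le> value_bound e m"
    using eval_le_value_bound[OF I] Sym.prems(3) by auto
  have d: "d + 1 < k - 1" "d < k - 1" "h d = 0" "h (d + 1) = 0" "r \<noteq> d" "r \<noteq> d + 1" "d > 1"
    "?t < 2" "?t \<noteq> d" "?t \<noteq> d + 1" "?t \<noteq> r" "r < k" "?t < k" "h ?t = 0"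
    using Sym.prems by (auto simp: tape_of_def)
  let ?h1 = "h(d := h d + ?E)"
  have 1: "runs k (evaluate e \<rho> d (d + 2)) (tapes C h) (time_bound e m) (tapes C ?h1)"
    by (rule Sym.IH) (use Sym.prems(1,2,4-6) R in auto)
  let ?h2 = "?h1(d := 0, d + 1 := ?h1 (d + 1) + ?h1 d, ?t := ?h1 ?t + ?h1 d)"
  have 2: "runs k (loop d (inc2 (d + 1) ?t)) (tapes C ?h1) (value_bound e m * 3 + 1) (tapes C ?h2)"
    by (rule runs_add2_loop[OF assms(1)]) (use d E in auto)
  have t2: "?h2 ?t = ?E" using d by auto
  let ?h3 = "?h2(r := ?h2 r + of_bool (C ?t (int (?h2 ?t)) \<ge> 1))"
  have 3: "runs k (inc_if r ?t 1) (tapes C ?h2) 1 (tapes C ?h3)"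
    by (rule runs_inc_if[OF assms(1)]) (use d in auto)
  let ?h4 = "?h3(r := ?h3 r + of_bool (C ?t (int (?h3 ?t)) \<ge> 2))"
  have 4: "runs k (inc_if r ?t 2) (tapes C ?h3) 1 (tapes C ?h4)"
    by (rule runs_inc_if[OF assms(1)]) (use d in auto)
  have t3: "?h3 ?t = ?E" using d by auto
  \<comment> \<open>The tests for at least 1 and at least 2 together add the symbol itself, as it is
    at most 2.\<close>
  have h4: "?h4 = ?h2(r := h r + I j ?E)"
    unfolding t2 t3 using d I[of j ?E] assms(8)[of j ?E] by (auto simp: of_bool_def)
  let ?h5 = "?h4(d + 1 := 0, ?t := 0)"
  have 5: "runs k (loop (d + 1) (left ?t)) (tapes C ?h4) (value_bound e m * 3 + 1) (tapes C ?h5)"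
    unfolding h4 by (rule runs_left_loop[OF assms(1)]) (use d E in auto)
  have "?h5 = h(r := h r + eval I (Sym j e) ?\<sigma>)"
    unfolding h4 using d by auto
  then show ?case
    using runs_Seq[OF 1 runs_Seq[OF 2 runs_Seq[OF runs_Seq[OF 3 4] 5]]]
    by (metis evaluate.simps(6) time_bound.simps(6) one_add_one)
qed

section \<open>Polynomial bounds\<close>

definition poly_bounded :: "(nat \<Rightarrow> nat) \<Rightarrow> bool" where
  "poly_bounded f \<longleftrightarrow> (\<exists>p :: nat poly. \<forall>n. f n \<le> poly p n)"

lemma poly_nat_mono: "x \<le> y \<Longrightarrow> poly p x \<le> poly p (y :: nat)"
  by (induction p) (auto intro: add_mono mult_mono)

lemma poly_bounded_const: "poly_bounded (\<lambda>n. c)"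
  unfolding poly_bounded_def by (rule exI[of _ "[:c:]"]) simp

lemma poly_bounded_id: "poly_bounded (\<lambda>n. n)"
  unfolding poly_bounded_def by (rule exI[of _ "[:0, 1:]"]) simp

lemma poly_bounded_add: "poly_bounded f \<Longrightarrow> poly_bounded g \<Longrightarrow> poly_bounded (\<lambda>n. f n + g n)"
  unfolding poly_bounded_def by (metis add_mono poly_add)

lemma poly_bounded_mult: "poly_bounded f \<Longrightarrow> poly_bounded g \<Longrightarrow> poly_bounded (\<lambda>n. f n * g n)"
  unfolding poly_bounded_def by (metis mult_le_mono poly_mult)

text \<open>Polynomials with natural coefficients are monotone, so the bound of \<open>g\<close> may
  be inserted into the bound of \<open>f\<close>.\<close>

lemma poly_bounded_comp:
  assumes "poly_bounded f" "poly_bounded g"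
  shows "poly_bounded (\<lambda>n. f (g n))"
proof -
  from assms obtain p q where p: "\<And>n. f n \<le> poly p n" and q: "\<And>n. g n \<le> poly q n"
    unfolding poly_bounded_def by auto
  have "f (g n) \<le> poly (p \<circ>\<^sub>p q) n" for n
    using p[of "g n"] poly_nat_mono[OF q, of p n] by (simp add: poly_pcompose)
  then show ?thesis unfolding poly_bounded_def by blast
qed

lemmas poly_bounded_intros =
  poly_bounded_const poly_bounded_id poly_bounded_add poly_bounded_mult

lemma poly_bounded_value_bound: "poly_bounded (value_bound e)"
  by (induction e)
    (auto simp: value_bound.simps[abs_def] intro!: poly_bounded_intros intro: poly_bounded_comp)

lemma poly_bounded_time_bound: "poly_bounded (time_bound e)"
proof (induction e)
  case (Sum v b e)
  then show ?case
    unfolding time_bound.simps[abs_def]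
    by (intro poly_bounded_intros poly_bounded_value_bound
        poly_bounded_comp[of "time_bound e" "\<lambda>m. m + value_bound b m"])
qed (unfold time_bound.simps[abs_def], (intro poly_bounded_intros poly_bounded_value_bound; assumption)+)

section \<open>Machines for expressions\<close>

definition input :: "bool list \<Rightarrow> bool list \<Rightarrow> bool \<Rightarrow> nat \<Rightarrow> nat" where
  "input w b j p = word_tape (if j then b else w) (int p)"

definition env :: "nat \<Rightarrow> nat \<Rightarrow> nat \<Rightarrow> nat" where
  "env n m = (\<lambda>v. if v = 0 then n else if v = 1 then m else 0)"

definition contents ::
  "nat \<Rightarrow> bool list \<Rightarrow> bool list \<Rightarrow> bool list \<Rightarrow> nat \<Rightarrow> int \<Rightarrow> nat" where
  "contents k w b out i = word_tape (if i = 0 then w else if i = 1 then b else if i = k - 1 then out else [])"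

definition prepared ::
  "nat \<Rightarrow> bool list \<Rightarrow> bool list \<Rightarrow> bool list \<Rightarrow> nat \<Rightarrow> int \<Rightarrow> nat" where
  "prepared k w b out i = (if 2 \<le> i \<and> i < k - 1 then marked else contents k w b out i)"

definition mark :: "nat \<Rightarrow> com" where
  "mark k = Act (\<lambda>v i. (if 2 \<le> i \<and> i < k - 1 then 3 else v i, Stay))"

lemma word_tape_le: "word_tape w p \<le> 2"
  by (auto simp: word_tape_def symbol_of_bit_def)

lemma word_tape_less: "word_tape w p < 4"
  using word_tape_le[of w p] by linarith

lemma word_tape_Nil: "word_tape [] = (\<lambda>p. 0)"
  by (auto simp: word_tape_def)

lemma word_tape_append:
  "word_tape (w @ [x]) = (word_tape w)(int (length w) := symbol_of_bit x)"
  by (rule ext) (auto simp: word_tape_def nth_append)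

lemma word_tape_end: "word_tape w (int (length w)) = 0"
  by (simp add: word_tape_def)

lemma word_tape_inside: "j < length w \<Longrightarrow> word_tape w (int j) \<noteq> 0"
  by (simp add: word_tape_def symbol_of_bit_def)

lemma registers_prepared: "k \<ge> 3 \<Longrightarrow> registers k (prepared k w b out)"
  using word_tape_le word_tape_less
  by (auto simp: registers_def prepared_def contents_def marked_def)

lemma input_prepared: "k \<ge> 3 \<Longrightarrow> input w b j p = prepared k w b out (tape_of j) (int p)"
  by (simp add: input_def prepared_def contents_def tape_of_def)

lemma initial_config_store:
  "initial_config M w = (start_state M, tape_list (tape_count M) (tapes (contents (tape_count M) w [] []) (\<lambda>_. 0)))"
  if "tape_count M \<ge> 1"
  using that
  by (auto simp: initial_config_def tape_list_def tapes_def contents_def list_eq_iff_nth_eq nth_Cons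
      split: nat.splits)

lemma runs_mark:
  assumes "k \<ge> 3"
  shows "runs k (mark k) (tapes (contents k w [] []) (\<lambda>_. 0)) 1 (tapes (prepared k w [] []) (\<lambda>_. 0))"
proof -
  let ?s = "tapes (contents k w [] []) (\<lambda>_. 0)"
  let ?F = "\<lambda>v i. (if 2 \<le> i \<and> i < k - 1 then 3 else v i, Stay)"
  have "good k ?s" using word_tape_less by (auto simp: good_def tapes_def contents_def)
  then have "exec k (mark k) ?s 1 (effect ?F k ?s)" unfolding mark_def by (rule exec.Act)
  moreover have "effect ?F k ?s = tapes (prepared k w [] []) (\<lambda>_. 0)"
    using assms by (auto simp: fun_eq_iff effect_def tapes_def prepared_def contents_def reads_def
        marked_def word_tape_Nil)
  ultimately show ?thesis unfolding runs_def by auto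
qed

text \<open>Registers 2 and 3 both count the input symbols; 3 is then spent on bringing the input
  head back, and 2 keeps the length.\<close>

definition scan :: com where
  "scan = Seq (While (\<lambda>v. v 0 \<noteq> 0) (movement (\<lambda>v i. if i \<in> {0, 2, 3} then MoveRight else Stay)))
     (loop 3 (left 0))"

lemma runs_scan:
  assumes "k \<ge> 5" "n = length w"
  shows "runs k scan (tapes (prepared k w [] []) (\<lambda>_. 0)) (5 * n + 2)
    (tapes (prepared k w [] []) ((\<lambda>_. 0)(2 := n)))"
proof -
  let ?C = "prepared k w [] []"
  have reg: "registers k ?C" using assms(1) by (intro registers_prepared) simp
  define H where "H = (\<lambda>(j :: nat) i :: nat. if i \<in> {0, 2, 3} then j else 0)"
  let ?S = "\<lambda>j. tapes ?C (H j)"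
  let ?mv = "movement (\<lambda>v i. if i \<in> {0, 2, 3 :: nat} then MoveRight else Stay)"
  have r: "reads k (?S j) 0 = word_tape w (int j)" for j
    using assms(1) by (simp add: reads_tapes H_def prepared_def contents_def)
  have 1: "runs k (While (\<lambda>v. v 0 \<noteq> 0) ?mv) (?S 0) (n * (1 + 1) + 1) (?S n)"
  proof (rule runs_While[where S = ?S])
    show "good k (?S j)" for j by (rule good_tapes[OF reg])
    show "reads k (?S j) 0 \<noteq> 0" if "j < n" for j
      using that assms(2) unfolding r by (simp add: word_tape_inside)
    show "\<not> reads k (?S n) 0 \<noteq> 0" unfolding r assms(2) by (simp add: word_tape_end)
    show "runs k ?mv (?S j) 1 (?S (Suc j))" for j
      by (rule runs_movement[OF reg]) (use assms(1) in \<open>auto simp: H_def\<close>)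
  qed
  have 2: "runs k (loop 3 (left 0)) (?S n) (n * 3 + 1) (tapes ?C ((H n)(3 := 0, 0 := 0)))"
    by (rule runs_left_loop[OF reg]) (use assms(1) in \<open>auto simp: H_def\<close>)
  have "(H n)(3 := 0, 0 := 0) = (\<lambda>_. 0)(2 := n)" "H 0 = (\<lambda>_. 0)" by (auto simp: H_def)
  with runs_Seq[OF 1 2] have "runs k scan (tapes ?C (\<lambda>_. 0)) (n * (1 + 1) + 1 + (n * 3 + 1))
      (tapes ?C ((\<lambda>_. 0)(2 := n)))" unfolding scan_def by metis
  then show ?thesis by (rule runs_mono) simp
qed

section \<open>Deterministic machines that print a word\<close>

definition machine_of :: "nat \<Rightarrow> com \<Rightarrow> machine" where
  "machine_of k c = \<lparr>tape_count = k, start_state = 0, accept_state = 0,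
     transitions = compile k c 0 (com_size c)\<rparr>"

text \<open>The exit state \<open>com_size c\<close> is the source of no transition, so the compiled
  run halts there; by determinism its length bounds every other run.\<close>

lemma program_computes:
  assumes "k \<ge> 1" "poly_bounded T"
    and run: "\<And>w. runs k c (tapes (contents k w [] []) (\<lambda>_. 0)) (T (length w)) (S w)"
    and out: "\<And>w. fst (S w (k - 1)) = word_tape (f w)"
  shows "polynomial_time_computable f"
proof -
  let ?M = "machine_of k c"
  have tc: "tape_count ?M \<ge> 1" using assms(1) by (simp add: machine_of_def)
  have tm: "turing_machine ?M"
    using assms(1) finite_compile compile_wellformed by (auto simp: turing_machine_def machine_of_def)
  have det: "deterministic ?M"
    using compile_deterministic by (auto simp: deterministic_def machine_of_def)
  have init: "initial_config ?M w = (0, tape_list k (tapes (contents k w [] []) (\<lambda>_. 0)))" for w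
    using initial_config_store[OF tc, of w] by (simp add: machine_of_def)
  have halt: "\<nexists>d. step ?M (com_size c, ts) d" for ts
    by (auto simp: step_def machine_of_def dest!: compile_source)
  have sub: "compile k c 0 (com_size c) \<subseteq> transitions ?M" by (simp add: machine_of_def)
  have run': "\<exists>n\<le>T (length w). (step ?M ^^ n) (initial_config ?M w) (com_size c, tape_list k (S w))" for w
    using run[of w] compile_correct[OF _ sub] unfolding runs_def init by blast
  have "n \<le> T (length w)" if "(step ?M ^^ n) (initial_config ?M w) d" for w n d
  proof -
    obtain N where N: "N \<le> T (length w)"
      "(step ?M ^^ N) (initial_config ?M w) (com_size c, tape_list k (S w))" using run' by blast
    have "n \<le> N \<and> (step ?M ^^ (N - n)) d (com_size c, tape_list k (S w))"
      by (rule deterministic_run[OF _ N(2) halt that]) (rule step_functional[OF det])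
    then show ?thesis using N(1) by simp
  qed
  moreover obtain p where "\<And>n. T n \<le> poly p n" using assms(2) unfolding poly_bounded_def by auto
  ultimately have pt: "polynomial_time ?M"
    unfolding polynomial_time_def by (meson le_trans)
  have "last (tape_list k (S w)) = S w (k - 1)" for w
    using assms(1) by (simp add: tape_list_def last_map)
  moreover have "(step ?M)\<^sup>*\<^sup>* (initial_config ?M w) (com_size c, tape_list k (S w))" for w
    using run'[of w] by (auto intro: relpowp_imp_rtranclp)
  ultimately have "computes ?M f"
    unfolding computes_def halted_def using halt out by metis
  with tm det pt show ?thesis unfolding polynomial_time_computable_def by blast
qed

text \<open>Register 2 holds the length of the input and register 5 the index of the next output symbol;
  register 3 stays zero.\<close>

definition varmap :: "nat \<Rightarrow> nat" where
  "varmap v = (if v = 0 then 2 else if v = 1 then 5 else 3)"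

text \<open>Register 6 shows the mark exactly when its value is 0, so the symbol written is that of
  the bit "value nonzero".\<close>

definition emit :: "nat \<Rightarrow> com" where
  "emit k = Act (\<lambda>v i. if i = k - 1 then (if v 6 = 3 then 1 else 2, MoveRight) else (v i, Stay))"

lemma runs_emit:
  assumes "k \<ge> 8" "h (k - 1) = length out"
  shows "runs k (emit k) (tapes (prepared k w b out) h) 1
    (tapes (prepared k w b (out @ [h 6 \<noteq> 0])) (h(k - 1 := h (k - 1) + 1)))"
proof -
  let ?s = "tapes (prepared k w b out) h"
  let ?F = "\<lambda>v i. if i = k - 1 then (if v 6 = 3 then 1 else 2, MoveRight) else (v i, Stay)"
  have reg: "registers k (prepared k w b out)" using assms by (intro registers_prepared) simp
  have "exec k (emit k) ?s 1 (effect ?F k ?s)"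
    unfolding emit_def by (rule exec.Act[OF good_tapes[OF reg]])
  moreover have "effect ?F k ?s = tapes (prepared k w b (out @ [h 6 \<noteq> 0])) (h(k - 1 := h (k - 1) + 1))"
    (is "_ = ?s'")
  proof
    fix i
    show "effect ?F k ?s i = ?s' i"
    proof (cases "i = k - 1")
      case True
      have "reads k ?s 6 = (if h 6 = 0 then 3 else 0)"
        using assms(1) by (intro reads_register[OF reg]) auto
      then show ?thesis
        using True assms
        by (auto simp: effect_def tapes_def prepared_def contents_def word_tape_append symbol_of_bit_def)
    next
      case False
      then have "prepared k w b (out @ [h 6 \<noteq> 0]) i = prepared k w b out i"
        using assms by (auto simp: prepared_def contents_def)
      then show ?thesis using False assms by (auto simp: effect_def tapes_def reads_def)
    qed
  qed
  ultimately show ?thesis unfolding runs_def by auto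
qed

text \<open>Register 4 counts the symbols still to be printed and register 6 receives the value of
  \<open>e\<close>; scratch space starts at 7. Register 6 has to be cleared in every round because
  \<open>evaluate\<close> adds to its target.\<close>

definition printer :: "nat \<Rightarrow> exp \<Rightarrow> exp \<Rightarrow> com" where
  "printer k L e = Seq (Seq (mark k) scan) (Seq (evaluate L varmap 4 7)
     (loop 4 (Seq (evaluate e varmap 6 7) (Seq (emit k) (Seq (loop 6 skip) (inc 5))))))"

theorem expression_computable:
  "polynomial_time_computable (\<lambda>w. map (\<lambda>j. eval (input w []) e (env (length w) j) \<noteq> 0)
     [0..<eval (input w []) L (env (length w) 0)])"
proof -
  define k where "k = 8 + max (depth L) (depth e)"
  define B where "B = value_bound L"
  define t where "t = (\<lambda>n. time_bound e (n + B n) + (1 + ((value_bound e (n + B n) * 3 + 1) + 1)))"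
  define T where "T = (\<lambda>n. (1 + (5 * n + 2)) + (time_bound L n + (B n * (t n + 2) + 1)))"
  have k: "k \<ge> 8" "7 + depth L \<le> k - 1" "7 + depth e \<le> k - 1" by (auto simp: k_def)
  let ?f = "\<lambda>w j. eval (input w []) e (env (length w) j)"
  let ?L = "\<lambda>w. eval (input w []) L (env (length w) 0)"
  define out where "out = (\<lambda>w j. map (\<lambda>j. ?f w j \<noteq> 0) [0..<j])"
  have run: "runs k (printer k L e) (tapes (contents k w [] []) (\<lambda>_. 0)) (T (length w))
      (tapes (prepared k w [] (out w (?L w))) ((\<lambda>_. 0)(2 := length w, 5 := ?L w, k - 1 := ?L w)))" for w
  proof -
    let ?n = "length w"
    let ?C = "\<lambda>j. prepared k w [] (out w j)"
    have reg: "registers k (?C j)" for j using k by (intro registers_prepared) simp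
    have I: "input w [] j p = ?C i (tape_of j) (int p)" for i j p
      using k by (intro input_prepared) simp
    have I2: "input w [] j p \<le> 2" for j p by (simp add: input_def word_tape_le)
    let ?h0 = "(\<lambda>_. 0)(2 := ?n)"
    have 1: "runs k (Seq (mark k) scan) (tapes (contents k w [] []) (\<lambda>_. 0)) (1 + (5 * ?n + 2)) (tapes (?C 0) ?h0)"
      using runs_Seq[OF runs_mark runs_scan[of k ?n w]] k by (simp add: out_def)
    have "(\<lambda>v. ?h0 (varmap v)) = env ?n 0" by (auto simp: varmap_def env_def)
    then have 2: "runs k (evaluate L varmap 4 7) (tapes (?C 0) ?h0) (time_bound L ?n)
        (tapes (?C 0) (?h0(4 := ?L w)))"
      using runs_evaluate[OF reg, of ?h0 7 varmap 4 ?n L "input w []" 0] k I[of _ _ 0]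
      by (simp add: varmap_def del: fun_upd_apply) (simp add: fun_upd_def)
    have LB: "?L w \<le> B ?n" unfolding B_def by (rule eval_le_value_bound[OF I2]) (simp add: env_def)
    define H where "H = (\<lambda>j. (\<lambda>_. 0)(2 := ?n, 4 := ?L w - j, 5 := j, k - 1 := j))"
    have 3: "runs k (loop 4 (Seq (evaluate e varmap 6 7) (Seq (emit k) (Seq (loop 6 skip) (inc 5)))))
        (tapes (?C 0) (H 0)) (?L w * (t ?n + 2) + 1) (tapes (?C (?L w)) (H (?L w)))"
    proof (rule runs_loop_general[where H = H and C = ?C])
      show "H j 4 = ?L w - j" for j using k by (simp add: H_def)
      fix j assume j: "j < ?L w"
      let ?g = "(H j)(4 := ?L w - Suc j)"
      have g: "(\<lambda>v. ?g (varmap v)) = env ?n j" using k by (auto simp: varmap_def env_def H_def)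
      have "runs k (evaluate e varmap 6 7) (tapes (?C j) ?g) (time_bound e (?n + B ?n))
          (tapes (?C j) (?g(6 := ?g 6 + eval (input w []) e (\<lambda>v. ?g (varmap v)))))"
      proof (rule runs_evaluate[OF reg])
        show "2 \<le> varmap v \<and> varmap v < 7 \<and> varmap v \<noteq> 6 \<and> ?g (varmap v) \<le> ?n + B ?n" for v
          using fun_cong[OF g, of v] j LB by (auto simp: varmap_def env_def)
        show "input w [] j' p = ?C j (tape_of j') (int p)" for j' p by (rule I)
      qed (use k in \<open>auto simp: H_def\<close>)
      moreover have "?g 6 = 0" using k by (simp add: H_def)
      ultimately have a: "runs k (evaluate e varmap 6 7) (tapes (?C j) ?g) (time_bound e (?n + B ?n))
          (tapes (?C j) (?g(6 := ?f w j)))" unfolding g by simp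
      let ?g1 = "?g(6 := ?f w j)"
      have "?g1 (k - 1) = length (out w j)" using k by (simp add: H_def out_def)
      from runs_emit[where h = ?g1 and out = "out w j" and w = w and b = "[]", OF k(1) this]
      have b: "runs k (emit k) (tapes (?C j) ?g1) 1 (tapes (?C (Suc j)) (?g1(k - 1 := ?g1 (k - 1) + 1)))"
        by (simp add: out_def)
      let ?g2 = "?g1(k - 1 := ?g1 (k - 1) + 1)"
      have "?f w j \<le> value_bound e (?n + B ?n)"
        by (rule eval_le_value_bound[OF I2]) (use j LB in \<open>simp add: env_def\<close>)
      then have c: "runs k (loop 6 skip) (tapes (?C (Suc j)) ?g2) (value_bound e (?n + B ?n) * 3 + 1)
          (tapes (?C (Suc j)) (?g2(6 := 0)))"
        using k by (intro runs_clear[OF reg]) auto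
      have d: "runs k (inc 5) (tapes (?C (Suc j)) (?g2(6 := 0))) 1
          (tapes (?C (Suc j)) ((?g2(6 := 0))(5 := (?g2(6 := 0)) 5 + 1)))"
        using k by (intro runs_inc[OF reg]) auto
      have "(?g2(6 := 0))(5 := (?g2(6 := 0)) 5 + 1) = H (Suc j)"
        using k by (auto simp: H_def)
      with runs_Seq[OF a runs_Seq[OF b runs_Seq[OF c d]]]
      show "runs k (Seq (evaluate e varmap 6 7) (Seq (emit k) (Seq (loop 6 skip) (inc 5))))
          (tapes (?C j) ?g) (t ?n) (tapes (?C (Suc j)) (H (Suc j)))"
        unfolding t_def by metis
    qed (use k reg in auto)
    have "?h0(4 := ?L w) = H 0" using k by (auto simp: H_def)
    with 2 have 2: "runs k (evaluate L varmap 4 7) (tapes (?C 0) ?h0) (time_bound L ?n) (tapes (?C 0) (H 0))"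
      by metis
    have "H (?L w) = (\<lambda>_. 0)(2 := ?n, 5 := ?L w, k - 1 := ?L w)" using k by (auto simp: H_def)
    with runs_Seq[OF 1 runs_Seq[OF 2 3]]
    have "runs k (printer k L e) (tapes (contents k w [] []) (\<lambda>_. 0))
      ((1 + (5 * ?n + 2)) + (time_bound L ?n + (?L w * (t ?n + 2) + 1)))
      (tapes (?C (?L w)) ((\<lambda>_. 0)(2 := ?n, 5 := ?L w, k - 1 := ?L w)))"
      unfolding printer_def by metis
    then show ?thesis
      by (rule runs_mono) (use mult_le_mono1[OF LB, of "t ?n + 2"] in \<open>simp add: T_def\<close>)
  qed
  have T: "poly_bounded T"
    unfolding T_def t_def B_def
    by (intro poly_bounded_intros poly_bounded_value_bound poly_bounded_time_bound
        poly_bounded_comp[of "time_bound e" "\<lambda>n. n + value_bound L n"]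
        poly_bounded_comp[of "value_bound e" "\<lambda>n. n + value_bound L n"])
  have "polynomial_time_computable (\<lambda>w. out w (?L w))"
    by (rule program_computes[OF _ T run]) (use k in \<open>auto simp: tapes_def prepared_def contents_def\<close>)
  then show ?thesis by (simp add: out_def)
qed

section \<open>Nondeterministic machines that guess a word and check it\<close>

definition guess_action :: "bool \<Rightarrow> (nat \<Rightarrow> nat) \<Rightarrow> nat \<Rightarrow> action" where
  "guess_action b = (\<lambda>v i. (if i = 1 then symbol_of_bit b else v i, if i < 4 then MoveRight else Stay))"

text \<open>The only source of nondeterminism: both values of \<open>b\<close> are available for the
  same read vector. Guessing goes on as long as the input head sees a symbol, so the guess gets the
  length of the input.\<close>

definition guesses :: "nat \<Rightarrow> transition set" where
  "guesses k = {(1, rs, 1, map (guess_action b (vec k rs)) [0..<k]) | rs b. rs \<in> words k \<and> vec k rs 0 \<noteq> 0}"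

text \<open>Guessing has advanced the heads 0 to 3 together. Register 3 is spent on rewinding the
  heads of input and guess; register 2 keeps the length.\<close>

definition checker :: "exp \<Rightarrow> com" where
  "checker e = Seq (loop 3 (movement (\<lambda>v i. if i < 2 then MoveLeft else Stay))) (evaluate e varmap 4 7)"

text \<open>State 0 writes the marks, state 1 guesses, and checking starts at state 2. The last jump
  needs a nonzero result in register 4; otherwise the machine halts one state short of the accepting
  one.\<close>

definition guesser :: "nat \<Rightarrow> exp \<Rightarrow> machine" where
  "guesser k e = \<lparr>tape_count = k, start_state = 0, accept_state = com_size (checker e) + 3,
     transitions = compile k (mark k) 0 1 \<union> guesses k \<union> jumps k (\<lambda>v. v 0 = 0) 1 2 \<union>
       compile k (checker e) 2 (com_size (checker e) + 2) \<union>
       jumps k (\<lambda>v. v 4 \<noteq> 3) (com_size (checker e) + 2) (com_size (checker e) + 3)\<rparr>"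

definition guessed :: "nat \<Rightarrow> bool list \<Rightarrow> bool list \<Rightarrow> store" where
  "guessed k w b = tapes (prepared k w b []) (\<lambda>i. if i < 4 then length b else 0)"

lemma runs_checker:
  assumes "k = 8 + depth e" "length b = length w"
  shows "runs k (checker e) (guessed k w b) ((length w * 3 + 1) + time_bound e (length w))
    (tapes (prepared k w b []) ((\<lambda>_. 0)(2 := length w, 4 := eval (input w b) e (env (length w) 0))))"
proof -
  let ?C = "prepared k w b []" and ?n = "length w"
  have reg: "registers k ?C" using assms by (intro registers_prepared) simp
  define H where "H = (\<lambda>(j :: nat) i :: nat. if i \<in> {0, 1, 3} then ?n - j else if i = 2 then ?n else 0)"
  let ?mv = "movement (\<lambda>v i. if i < 2 then MoveLeft else Stay)"
  have h: "(\<lambda>i. if i < 4 then length b else 0) = H 0"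
    using assms(2) by (auto simp: H_def fun_eq_iff)
  have "runs k (loop 3 ?mv) (tapes ?C (H 0)) (?n * (1 + 2) + 1) (tapes ?C (H ?n))"
  proof (rule runs_loop_general[where C = "\<lambda>_. ?C"])
    show "runs k ?mv (tapes ?C ((H j)(3 := ?n - Suc j))) 1 (tapes ?C (H (Suc j)))" if "j < ?n" for j
      by (rule runs_movement[OF reg]) (use that assms in \<open>auto simp: H_def of_nat_diff\<close>)
  qed (use assms reg in \<open>auto simp: H_def\<close>)
  then have 1: "runs k (loop 3 ?mv) (guessed k w b) (?n * 3 + 1) (tapes ?C (H ?n))"
    unfolding guessed_def h by (rule runs_mono) simp
  have g: "(\<lambda>v. H ?n (varmap v)) = env ?n 0" by (auto simp: varmap_def env_def H_def)
  have "runs k (evaluate e varmap 4 7) (tapes ?C (H ?n)) (time_bound e ?n)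
      (tapes ?C ((H ?n)(4 := H ?n 4 + eval (input w b) e (\<lambda>v. H ?n (varmap v)))))"
  proof (rule runs_evaluate[OF reg])
    show "input w b j p = ?C (tape_of j) (int p)" for j p
      using assms by (intro input_prepared) simp
    show "2 \<le> varmap v \<and> varmap v < 7 \<and> varmap v \<noteq> 4 \<and> H ?n (varmap v) \<le> ?n" for v
      using fun_cong[OF g, of v] by (auto simp: varmap_def env_def)
  qed (use assms in \<open>auto simp: H_def\<close>)
  moreover have "(H ?n)(4 := H ?n 4 + eval (input w b) e (env ?n 0))
      = (\<lambda>_. 0)(2 := ?n, 4 := eval (input w b) e (env ?n 0))"
    by (auto simp: H_def)
  ultimately have 2: "runs k (evaluate e varmap 4 7) (tapes ?C (H ?n)) (time_bound e ?n)
      (tapes ?C ((\<lambda>_. 0)(2 := ?n, 4 := eval (input w b) e (env ?n 0))))"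
    unfolding g by metis
  show ?thesis unfolding checker_def by (rule runs_Seq[OF 1 2])
qed

lemma guess_step:
  assumes "k \<ge> 8" "length b < length w"
  shows "effect (guess_action x) k (guessed k w b) = guessed k w (b @ [x])"
proof
  fix i
  show "effect (guess_action x) k (guessed k w b) i = guessed k w (b @ [x]) i"
    using assms
    by (auto simp: effect_def guess_action_def guessed_def tapes_def prepared_def contents_def
        word_tape_append reads_def)
qed

lemma guesser_start:
  assumes "k \<ge> 8" "step (guesser k e) (0, tape_list k (tapes (contents k w [] []) (\<lambda>_. 0))) c"
  shows "c = (1, tape_list k (guessed k w []))"
proof -
  let ?s = "tapes (contents k w [] []) (\<lambda>_. 0)"
  let ?F = "\<lambda>v i. (if 2 \<le> i \<and> i < k - 1 then 3 else v i, Stay)"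
  have eq: "effect ?F k ?s = guessed k w []"
    using assms(1) by (auto simp: fun_eq_iff guessed_def effect_def tapes_def prepared_def contents_def
        reads_def marked_def word_tape_Nil)
  have "q' = 1 \<and> as = map (?F (vec k rs)) [0..<k]"
    if "(0, rs, q', as) \<in> transitions (guesser k e)" for rs q' as
    using that by (auto simp: guesser_def mark_def guesses_def jumps_def dest!: compile_source)
  then have "c = (1, map2 act (map (?F (vec k (map read_tape (tape_list k ?s)))) [0..<k]) (tape_list k ?s))"
    using assms(2) unfolding step_def by blast
  then show ?thesis
    unfolding vec_tape_list effect_tape_list[of k ?F ?s, symmetric] eq .
qed

lemma guesser_guess:
  assumes "k \<ge> 8" "length b \<le> length w" "step (guesser k e) (1, tape_list k (guessed k w b)) c"
  shows "length b < length w \<and> (\<exists>x. c = (1, tape_list k (guessed k w (b @ [x])))) \<or>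
    length b = length w \<and> c = (2, tape_list k (guessed k w b))"
proof -
  let ?s = "guessed k w b"
  let ?rs = "map read_tape (tape_list k ?s)"
  have r: "reads k ?s 0 = word_tape w (int (length b))"
    using assms(1) by (simp add: reads_def guessed_def tapes_def prepared_def contents_def)
  have "vec k rs 0 \<noteq> 0 \<and> q' = 1 \<and> (\<exists>x. as = map (guess_action x (vec k rs)) [0..<k]) \<or>
      vec k rs 0 = 0 \<and> q' = 2 \<and> as = idle rs"
    if "(1, rs, q', as) \<in> transitions (guesser k e)" for rs q' as
    using that by (auto simp: guesser_def mark_def guesses_def jumps_def dest!: compile_source)
  then have "vec k ?rs 0 \<noteq> 0 \<and> (\<exists>x. c = (1, map2 act (map (guess_action x (vec k ?rs)) [0..<k]) (tape_list k ?s))) \<or>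
      vec k ?rs 0 = 0 \<and> c = (2, map2 act (idle ?rs) (tape_list k ?s))"
    using assms(3) unfolding step_def by blast
  then have "reads k ?s 0 \<noteq> 0 \<and> (\<exists>x. c = (1, tape_list k (effect (guess_action x) k ?s))) \<or>
      reads k ?s 0 = 0 \<and> c = (2, tape_list k ?s)"
    unfolding vec_tape_list effect_tape_list[symmetric] act_idle .
  moreover have "reads k ?s 0 \<noteq> 0 \<longleftrightarrow> length b < length w"
    unfolding r using assms(2) by (auto simp: word_tape_def symbol_of_bit_def)
  ultimately show ?thesis using guess_step[OF assms(1)] assms(2) by fastforce
qed

text \<open>A run that starts while guessing either is still guessing, with one new bit per step, or
  consists of the remaining guesses, one jump, and \<open>m\<close> steps of checking a complete
  guess.\<close>

lemma guesser_guess_runs: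
  assumes "k \<ge> 8"
  shows "(step (guesser k e) ^^ n) (1, tape_list k (guessed k w b)) c \<Longrightarrow> length b \<le> length w \<Longrightarrow>
    (\<exists>b'. length b' \<le> length w \<and> length b' = length b + n \<and> c = (1, tape_list k (guessed k w b'))) \<or>
    (\<exists>b' m. length b' = length w \<and> n \<le> length w - length b + 1 + m \<and>
       (step (guesser k e) ^^ m) (2, tape_list k (guessed k w b')) c)"
proof (induction n arbitrary: b)
  case 0
  then show ?case by auto
next
  case (Suc n)
  from Suc.prems(1) obtain c1 where c1: "step (guesser k e) (1, tape_list k (guessed k w b)) c1"
    "(step (guesser k e) ^^ n) c1 c" by (metis relpowp_Suc_D2)
  from guesser_guess[OF assms Suc.prems(2) c1(1)] show ?case
  proof (elim disjE conjE exE)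
    fix x assume x: "length b < length w" "c1 = (1, tape_list k (guessed k w (b @ [x])))"
    then have "length (b @ [x]) \<le> length w" by simp
    from Suc.IH[OF c1(2)[unfolded x(2)] this] show ?thesis
    proof (elim disjE exE conjE)
      fix b' assume "length b' \<le> length w" "length b' = length (b @ [x]) + n"
        "c = (1, tape_list k (guessed k w b'))"
      then show ?thesis by (intro disjI1 exI[of _ b']) simp
    next
      fix b' m assume "length b' = length w" "n \<le> length w - length (b @ [x]) + 1 + m"
        "(step (guesser k e) ^^ m) (2, tape_list k (guessed k w b')) c"
      then show ?thesis using x(1) by (intro disjI2 exI[of _ b'] exI[of _ m]) simp
    qed
  next
    assume "length b = length w" "c1 = (2, tape_list k (guessed k w b))"
    then show ?thesis using c1(2) by (intro disjI2 exI[of _ b] exI[of _ n]) simp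
  qed
qed

lemma guesser_reaches:
  assumes "k \<ge> 8"
  shows "length b = length w \<Longrightarrow>
    (step (guesser k e))\<^sup>*\<^sup>* (initial_config (guesser k e) w) (2, tape_list k (guessed k w b))"
proof -
  let ?M = "guesser k e"
  assume b: "length b = length w"
  have "(step ?M)\<^sup>*\<^sup>* (initial_config ?M w) (1, tape_list k (guessed k w (take j b)))" if "j \<le> length b" for j
    using that
  proof (induction j)
    case 0
    let ?s = "tapes (contents k w [] []) (\<lambda>_. 0)"
    let ?F = "\<lambda>v i. (if 2 \<le> i \<and> i < k - 1 then 3 else v i, Stay)"
    have eq: "effect ?F k ?s = guessed k w []"
      using assms(1) by (auto simp: fun_eq_iff guessed_def effect_def tapes_def prepared_def contents_def
          reads_def marked_def word_tape_Nil)
    have "good k ?s" using word_tape_less by (auto simp: good_def tapes_def contents_def)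
    from exec.Act[OF this, of ?F] have "exec k (mark k) ?s 1 (guessed k w [])"
      unfolding mark_def eq .
    from compile_correct[OF this, of 0 1 ?M]
    have "(step ?M ^^ 1) (0, tape_list k ?s) (1, tape_list k (guessed k w []))"
      by (auto simp: guesser_def)
    then show ?case
      using initial_config_store[of ?M w] assms by (auto simp: guesser_def)
  next
    case (Suc j)
    let ?s = "guessed k w (take j b)"
    have "registers k (prepared k w (take j b) [])" using assms by (intro registers_prepared) simp
    then have good: "good k ?s" unfolding guessed_def by (rule good_tapes)
    have "reads k ?s 0 = word_tape w (int j)"
      using assms Suc.prems by (simp add: reads_def guessed_def tapes_def prepared_def contents_def)
    then have "reads k ?s 0 \<noteq> 0" using Suc.prems b by (simp add: word_tape_inside)
    then have "(1, map read_tape (tape_list k ?s), 1,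
        map (guess_action (b ! j) (vec k (map read_tape (tape_list k ?s)))) [0..<k]) \<in> guesses k"
      using words_tape_list[OF good] unfolding guesses_def vec_tape_list[symmetric] by blast
    then have "(1, map read_tape (tape_list k ?s), 1, map (guess_action (b ! j) (reads k ?s)) [0..<k])
        \<in> transitions ?M"
      unfolding vec_tape_list by (simp add: guesser_def)
    then have "step ?M (1, tape_list k ?s) (1, tape_list k (effect (guess_action (b ! j)) k ?s))"
      unfolding step_def effect_tape_list by blast
    moreover have "effect (guess_action (b ! j)) k ?s = guessed k w (take (Suc j) b)"
      using guess_step[OF assms, of "take j b" w "b ! j"] Suc.prems b by (simp add: take_Suc_conv_app_nth)
    ultimately show ?case using Suc by (metis Suc_leD rtranclp.rtrancl_into_rtrancl)
  qed
  from this[of "length b"]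
  have 1: "(step ?M)\<^sup>*\<^sup>* (initial_config ?M w) (1, tape_list k (guessed k w b))" by simp
  have "registers k (prepared k w b [])" using assms by (intro registers_prepared) simp
  then have good: "good k (guessed k w b)" unfolding guessed_def by (rule good_tapes)
  have "reads k (guessed k w b) 0 = 0"
    using assms b by (simp add: reads_def guessed_def tapes_def prepared_def contents_def word_tape_def)
  then have "step ?M (1, tape_list k (guessed k w b)) (2, tape_list k (guessed k w b))"
    by (intro step_jump[of k "\<lambda>v. v 0 = 0"] good) (auto simp: guesser_def)
  with 1 show ?thesis by simp
qed

lemma guesser_late_transition:
  assumes "(q, rs, q', as) \<in> transitions (guesser k e)" "q \<ge> 2"
  shows "(q, rs, q', as) \<in> compile k (checker e) 2 (com_size (checker e) + 2) \<and> q < com_size (checker e) + 2 \<or>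
    q = com_size (checker e) + 2 \<and> q' = com_size (checker e) + 3 \<and> as = idle rs \<and> vec k rs 4 \<noteq> 3"
proof -
  have "(q, rs, q', as) \<notin> compile k (mark k) 0 1" "(q, rs, q', as) \<notin> guesses k"
    "(q, rs, q', as) \<notin> jumps k (\<lambda>v. v 0 = 0) 1 2"
    using assms(2) by (auto simp: mark_def guesses_def jumps_def)
  then show ?thesis
    using assms(1) compile_source[of q rs q' as k "checker e" 2]
    by (auto simp: guesser_def jumps_def)
qed

lemma guesser_check_functional:
  assumes "step (guesser k e) c c1" "step (guesser k e) c c2" "fst c \<ge> 2"
  shows "c1 = c2"
proof -
  have "q2 = q3 \<and> as = bs"
    if 1: "(q, rs, q2, as) \<in> transitions (guesser k e)" "(q, rs, q3, bs) \<in> transitions (guesser k e)" "q \<ge> 2"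
    for q rs q2 as q3 bs
    using guesser_late_transition[OF 1(1,3)] guesser_late_transition[OF 1(2,3)] compile_deterministic
    by auto
  with assms show ?thesis unfolding step_def by fastforce
qed

lemma guesser_check_state:
  assumes "step (guesser k e) c c1" "fst c \<ge> 2"
  shows "fst c1 \<ge> 2"
proof -
  have "q' \<ge> 2" if 1: "(q, rs, q', as) \<in> transitions (guesser k e)" "q \<ge> 2" for q rs q' as
    using guesser_late_transition[OF 1]
      compile_target[of q rs q' as k "checker e" 2 "com_size (checker e) + 2"] by auto
  with assms show ?thesis unfolding step_def by fastforce
qed

text \<open>Restricted to states from 2 on, the step relation is functional, so
  \<open>deterministic_run\<close> bounds the checking phase and makes its outcome unique.\<close>

definition late :: "machine \<Rightarrow> config \<Rightarrow> config \<Rightarrow> bool" where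
  "late M c c' \<longleftrightarrow> step M c c' \<and> fst c \<ge> 2"

lemma late_runs:
  "(step (guesser k e) ^^ n) c c' \<Longrightarrow> fst c \<ge> 2 \<Longrightarrow> (late (guesser k e) ^^ n) c c' \<and> fst c' \<ge> 2"
proof (induction n arbitrary: c')
  case (Suc n)
  then show ?case by (auto simp: late_def intro: guesser_check_state)
qed auto

lemma guesser_check:
  assumes "k = 8 + depth e" "length b = length w"
  defines "acc \<equiv> eval (input w b) e (env (length w) 0) \<noteq> 0"
  shows "\<exists>N d. N \<le> length w * 3 + 2 + time_bound e (length w) \<and>
    (step (guesser k e) ^^ N) (2, tape_list k (guessed k w b)) d \<and> halted (guesser k e) d \<and>
    (fst d = accept_state (guesser k e) \<longleftrightarrow> acc)"
proof -
  let ?M = "guesser k e" and ?E = "com_size (checker e) + 2" and ?A = "com_size (checker e) + 3"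
  let ?C = "prepared k w b []"
  let ?h = "(\<lambda>_. 0)(2 := length w, 4 := eval (input w b) e (env (length w) 0))"
  let ?s = "tapes ?C ?h"
  have reg: "registers k ?C" using assms(1) by (intro registers_prepared) simp
  obtain n where n: "n \<le> length w * 3 + 1 + time_bound e (length w)"
    "exec k (checker e) (guessed k w b) n ?s"
    using runs_checker[OF assms(1,2)] unfolding runs_def by blast
  have 1: "(step ?M ^^ n) (2, tape_list k (guessed k w b)) (?E, tape_list k ?s)"
    by (rule compile_correct[OF n(2)]) (auto simp: guesser_def)
  have r: "reads k ?s 4 = (if acc then 0 else 3)"
    using assms(1) by (subst reads_register[OF reg]) (auto simp: acc_def)
  show ?thesis
  proof (cases acc)
    case True
    have "step ?M (?E, tape_list k ?s) (?A, tape_list k ?s)"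
    proof (rule step_jump[of k "\<lambda>v. v 4 \<noteq> 3"])
      show "jumps k (\<lambda>v. v 4 \<noteq> 3) ?E ?A \<subseteq> transitions ?M"
        unfolding guesser_def machine.simps by blast
    qed (use good_tapes[OF reg] r True in auto)
    with 1 have "(step ?M ^^ Suc n) (2, tape_list k (guessed k w b)) (?A, tape_list k ?s)"
      by (rule relpowp_Suc_I)
    moreover have "halted ?M (?A, tape_list k ?s)"
      unfolding halted_def step_def by (auto dest!: guesser_late_transition)
    ultimately show ?thesis using n(1) True
      by (intro exI[of _ "Suc n"] exI[of _ "(?A, tape_list k ?s)"]) (auto simp: guesser_def)
  next
    case False
    have "halted ?M (?E, tape_list k ?s)"
      unfolding halted_def step_def using r False
      by (auto simp: vec_tape_list dest!: guesser_late_transition)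
    then show ?thesis using n(1) 1 False
      by (intro exI[of _ n] exI[of _ "(?E, tape_list k ?s)"]) (auto simp: guesser_def)
  qed
qed

lemma guesser_check_runs:
  assumes "k = 8 + depth e" "length b = length w"
    "(step (guesser k e) ^^ m) (2, tape_list k (guessed k w b)) c"
  shows "m \<le> length w * 3 + 2 + time_bound e (length w) \<and>
    (halted (guesser k e) c \<longrightarrow> fst c = accept_state (guesser k e) \<longrightarrow>
      eval (input w b) e (env (length w) 0) \<noteq> 0)"
proof -
  let ?M = "guesser k e"
  obtain N d where d: "N \<le> length w * 3 + 2 + time_bound e (length w)"
    "(step ?M ^^ N) (2, tape_list k (guessed k w b)) d" "halted ?M d"
    "fst d = accept_state ?M \<longleftrightarrow> eval (input w b) e (env (length w) 0) \<noteq> 0"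
    using guesser_check[OF assms(1,2)] by blast
  have "m \<le> N \<and> (late ?M ^^ (N - m)) c d"
  proof (rule deterministic_run)
    show "(late ?M ^^ N) (2, tape_list k (guessed k w b)) d"
      "(late ?M ^^ m) (2, tape_list k (guessed k w b)) c"
      using late_runs[OF d(2)] late_runs[OF assms(3)] by auto
    show "c1 = c2" if "late ?M c c1" "late ?M c c2" for c c1 c2
      using that guesser_check_functional unfolding late_def by blast
    show "\<nexists>c'. late ?M d c'" using d(3) unfolding halted_def late_def by blast
  qed
  moreover have "c = d" if "halted ?M c" "(late ?M ^^ j) c d" for j
  proof (cases j)
    case (Suc i)
    then obtain c' where "late ?M c c'" using \<open>(late ?M ^^ j) c d\<close> relpowp_Suc_D2 by metis
    then show ?thesis using \<open>halted ?M c\<close> unfolding halted_def late_def by blast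
  qed (use that in auto)
  ultimately show ?thesis using d(1,4) by auto
qed

text \<open>Every branch takes one step for the marks, one per guessed bit, one jump, and the time
  of the check, which \<open>time_bound\<close> bounds by a polynomial independent of the
  guess.\<close>

theorem expression_in_NP:
  "{w. \<exists>b. length b = length w \<and> eval (input w b) e (env (length w) 0) \<noteq> 0} \<in> NP"
proof -
  define k where "k = 8 + depth e"
  define T where "T = (\<lambda>n. (n + 2) + (n * 3 + 2 + time_bound e n))"
  let ?M = "guesser k e"
  have k: "k \<ge> 8" by (simp add: k_def)
  have init: "initial_config ?M w = (0, tape_list k (tapes (contents k w [] []) (\<lambda>_. 0)))" for w
    using initial_config_store[of ?M w] k by (simp add: guesser_def)
  have "finite (guesses k)"
    by (rule finite_subset[OF _ finite_imageI[OF finite_cartesian_product[OF finite_words[of k] finite_UNIV],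
            of "\<lambda>(rs, b). (1, rs, 1, map (guess_action b (vec k rs)) [0..<k])"]])
      (auto simp: guesses_def)
  then have "turing_machine ?M"
    using k finite_compile finite_jumps compile_wellformed
    by (auto simp: turing_machine_def guesser_def guesses_def jumps_def words_def idle_def)
  have run: "(n \<le> T (length w)) \<and> (halted ?M c \<longrightarrow> fst c = accept_state ?M \<longrightarrow>
      (\<exists>b. length b = length w \<and> eval (input w b) e (env (length w) 0) \<noteq> 0))"
    if "(step ?M ^^ n) (initial_config ?M w) c" for n w c
  proof (cases n)
    case 0
    have "accept_state ?M \<noteq> 0" by (simp add: guesser_def)
    then show ?thesis using 0 that by (auto simp: init T_def)
  next
    case (Suc n')
    with that obtain c1 where c1: "step ?M (initial_config ?M w) c1" "(step ?M ^^ n') c1 c"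
      by (metis relpowp_Suc_D2)
    have "c1 = (1, tape_list k (guessed k w []))"
      using guesser_start[OF k] c1(1) unfolding init by blast
    from guesser_guess_runs[OF k c1(2)[unfolded this]]
    have "(\<exists>b'. length b' \<le> length w \<and> length b' = n' \<and> c = (1, tape_list k (guessed k w b'))) \<or>
      (\<exists>b' m. length b' = length w \<and> n' \<le> length w + 1 + m \<and>
        (step ?M ^^ m) (2, tape_list k (guessed k w b')) c)" by simp
    then show ?thesis
    proof (elim disjE exE conjE)
      fix b' assume "length b' \<le> length w" "length b' = n'"
        "c = (1, tape_list k (guessed k w b'))"
      then show ?thesis using Suc by (auto simp: T_def guesser_def)
    next
      fix b' m assume *: "length b' = length w" "n' \<le> length w + 1 + m"
        "(step ?M ^^ m) (2, tape_list k (guessed k w b')) c"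
      from guesser_check_runs[OF k_def *(1,3)] *(1,2) Suc show ?thesis by (auto simp: T_def)
    qed
  qed
  have "poly_bounded T"
    unfolding T_def by (intro poly_bounded_intros poly_bounded_time_bound)
  then obtain p where "\<And>n. T n \<le> poly p n" unfolding poly_bounded_def by auto
  then have "polynomial_time ?M"
    unfolding polynomial_time_def using run by (meson le_trans)
  moreover have "accepts ?M w \<longleftrightarrow> (\<exists>b. length b = length w \<and> eval (input w b) e (env (length w) 0) \<noteq> 0)" for w
  proof
    assume "accepts ?M w"
    then obtain c n where "(step ?M ^^ n) (initial_config ?M w) c" "halted ?M c" "fst c = accept_state ?M"
      unfolding accepts_def by (auto simp: rtranclp_is_Sup_relpowp)
    then show "\<exists>b. length b = length w \<and> eval (input w b) e (env (length w) 0) \<noteq> 0"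
      using run by blast
  next
    assume "\<exists>b. length b = length w \<and> eval (input w b) e (env (length w) 0) \<noteq> 0"
    then obtain b where b: "length b = length w" "eval (input w b) e (env (length w) 0) \<noteq> 0" by blast
    obtain N d where d: "(step ?M ^^ N) (2, tape_list k (guessed k w b)) d" "halted ?M d" "fst d = accept_state ?M"
      using guesser_check[OF k_def b(1)] b(2) by blast
    from guesser_reaches[OF k b(1)] relpowp_imp_rtranclp[OF d(1)]
    have "(step ?M)\<^sup>*\<^sup>* (initial_config ?M w) d" by (rule rtranclp_trans)
    then show "accepts ?M w" unfolding accepts_def using d by blast
  qed
  ultimately show ?thesis using \<open>turing_machine ?M\<close> unfolding NP_def by blast
qed

section \<open>Membership in NP\<close>

text \<open>All variables read by the expression lie below this number, so the number itself is a
  fresh variable.\<close>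

fun var_bound :: "exp \<Rightarrow> nat" where
  "var_bound (Const n) = 0"
| "var_bound (Var v) = Suc v"
| "var_bound (Add a b) = max (var_bound a) (var_bound b)"
| "var_bound (Monus a b) = max (var_bound a) (var_bound b)"
| "var_bound (Sum v b e) = max (var_bound b) (var_bound e)"
| "var_bound (Sym j e) = var_bound e"

lemma eval_cong: "(\<And>v. v < var_bound e \<Longrightarrow> \<sigma> v = \<tau> v) \<Longrightarrow> eval I e \<sigma> = eval I e \<tau>"
proof (induction e arbitrary: \<sigma> \<tau>)
  case (Sum v b e)
  have "eval I b \<sigma> = eval I b \<tau>" using Sum.prems by (intro Sum.IH) simp
  moreover have "eval I e (\<sigma>(v := x)) = eval I e (\<tau>(v := x))" for x
    using Sum.prems by (intro Sum.IH) simp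
  ultimately show ?case by simp
next
  case (Add a b)
  have "eval I a \<sigma> = eval I a \<tau>" "eval I b \<sigma> = eval I b \<tau>"
    using Add.prems by (intro Add.IH; simp)+
  then show ?case by simp
next
  case (Monus a b)
  have "eval I a \<sigma> = eval I a \<tau>" "eval I b \<sigma> = eval I b \<tau>"
    using Monus.prems by (intro Monus.IH; simp)+
  then show ?case by simp
next
  case (Sym j e)
  have "eval I e \<sigma> = eval I e \<tau>" using Sym.prems by (intro Sym.IH) simp
  then show ?case by simp
qed simp_all

text \<open>The summation variable of a product does not occur in the second factor.\<close>

definition "Mult a b = Sum (var_bound b) a b"
definition "Neg e = Monus (Const 1) e"
definition "Disj a b = Add a b"
definition "Conj a b = Neg (Add (Neg a) (Neg b))"
definition "Impl a b = Add (Neg a) b"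
definition "Exists v b e = Sum v b e"
definition "Forall v b e = Neg (Exists v b (Neg e))"
definition "Less a b = Monus b a"
definition "Equal a b = Neg (Add (Monus a b) (Monus b a))"
definition "Count v b e = Sum v b (Neg (Neg e))"

lemma eval_Mult [simp]: "eval I (Mult a b) \<sigma> = eval I a \<sigma> * eval I b \<sigma>"
proof -
  have "eval I b (\<sigma>(var_bound b := x)) = eval I b \<sigma>" for x by (rule eval_cong) auto
  then show ?thesis by (simp add: Mult_def)
qed

text \<open>With positivity as truth, disjunction is a sum, existence a bounded sum and order a
  truncated difference. \<open>Neg\<close> yields only 0 or 1; applied twice it normalises a truth
  value before \<open>Count\<close> sums it.\<close>

abbreviation holds :: "(bool \<Rightarrow> nat \<Rightarrow> nat) \<Rightarrow> exp \<Rightarrow> (nat \<Rightarrow> nat) \<Rightarrow> bool" where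
  "holds I e \<sigma> \<equiv> eval I e \<sigma> > 0"

lemma holds_simps [simp]:
  "holds I (Neg e) \<sigma> \<longleftrightarrow> \<not> holds I e \<sigma>"
  "holds I (Disj a b) \<sigma> \<longleftrightarrow> holds I a \<sigma> \<or> holds I b \<sigma>"
  "holds I (Conj a b) \<sigma> \<longleftrightarrow> holds I a \<sigma> \<and> holds I b \<sigma>"
  "holds I (Impl a b) \<sigma> \<longleftrightarrow> (holds I a \<sigma> \<longrightarrow> holds I b \<sigma>)"
  "holds I (Exists v b e) \<sigma> \<longleftrightarrow> (\<exists>x<eval I b \<sigma>. holds I e (\<sigma>(v := x)))"
  "holds I (Forall v b e) \<sigma> \<longleftrightarrow> (\<forall>x<eval I b \<sigma>. holds I e (\<sigma>(v := x)))"
  "holds I (Less a b) \<sigma> \<longleftrightarrow> eval I a \<sigma> < eval I b \<sigma>"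
  "holds I (Equal a b) \<sigma> \<longleftrightarrow> eval I a \<sigma> = eval I b \<sigma>"
proof -
  show n: "holds I (Neg e) \<sigma> \<longleftrightarrow> \<not> holds I e \<sigma>" for e \<sigma>
    by (auto simp: Neg_def)
  show x: "holds I (Exists v b e) \<sigma> \<longleftrightarrow> (\<exists>x<eval I b \<sigma>. holds I e (\<sigma>(v := x)))" for e
  proof -
    have "holds I (Exists v b e) \<sigma> \<longleftrightarrow> \<not> (\<forall>x\<in>{..<eval I b \<sigma>}. eval I e (\<sigma>(v := x)) = 0)"
      unfolding Exists_def eval.simps neq0_conv[symmetric] by (subst sum_eq_0_iff) auto
    then show ?thesis by auto
  qed
  show "holds I (Conj a b) \<sigma> \<longleftrightarrow> holds I a \<sigma> \<and> holds I b \<sigma>"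
    unfolding Conj_def n by (auto simp: Neg_def)
  show "holds I (Impl a b) \<sigma> \<longleftrightarrow> (holds I a \<sigma> \<longrightarrow> holds I b \<sigma>)"
    by (auto simp: Impl_def Neg_def)
  show "holds I (Forall v b e) \<sigma> \<longleftrightarrow> (\<forall>x<eval I b \<sigma>. holds I e (\<sigma>(v := x)))"
    unfolding Forall_def n x by auto
  show "holds I (Equal a b) \<sigma> \<longleftrightarrow> eval I a \<sigma> = eval I b \<sigma>"
    unfolding Equal_def n by auto
qed (auto simp: Disj_def Less_def)

lemma eval_Count [simp]: "eval I (Count v b e) \<sigma> = card {x. x < eval I b \<sigma> \<and> holds I e (\<sigma>(v := x))}"
proof -
  have "eval I (Neg (Neg e)) \<tau> = of_bool (holds I e \<tau>)" for \<tau> by (auto simp: Neg_def)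
  then show ?thesis by (auto simp: Count_def sum.If_cases of_bool_def intro!: arg_cong[where f = card])
qed

text \<open>Variable 2 holds the order of the graph, 3 and 4 a row and a column. Symbol 2 is the bit
  \<open>True\<close>.\<close>

definition row_sym :: exp where
  "row_sym = Equal (Sym False (Add (Mult (Var 3) (Var 2)) (Var 4))) (Const 2)"

definition column_sym :: exp where
  "column_sym = Equal (Sym False (Add (Mult (Var 4) (Var 2)) (Var 3))) (Const 2)"

definition degree_is :: "nat \<Rightarrow> exp" where
  "degree_is d = Equal (Count 4 (Var 2) row_sym) (Const d)"

definition same_color :: exp where
  "same_color = Count 4 (Var 2) (Conj row_sym (Equal (Sym True (Var 4)) (Sym True (Var 3))))"

text \<open>The order is found by trying all candidates for the square root of the input length. The
  rest checks that the word is the matrix of an instance and that the guessed bits, read as colours,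
  satisfy the degree condition of \<open>balanced_iff\<close>.\<close>

definition verifier :: exp where
  "verifier = Exists 2 (Add (Var 0) (Const 1)) (Conj (Equal (Mult (Var 2) (Var 2)) (Var 0))
     (Conj (Forall 3 (Var 2) (Forall 4 (Var 2) (Impl row_sym column_sym)))
     (Conj (Forall 3 (Var 2) (Forall 4 (Var 2) (Impl row_sym (Neg (Equal (Var 3) (Var 4))))))
     (Conj (Forall 3 (Var 2) (Disj (degree_is 1) (degree_is 3)))
     (Conj (Exists 3 (Var 2) (degree_is 3))
       (Forall 3 (Var 2) (Equal (Count 4 (Var 2) row_sym) (Add (Add same_color same_color) (Const 1)))))))))"

definition adjacent :: "bool list \<Rightarrow> nat \<Rightarrow> nat \<Rightarrow> nat \<Rightarrow> bool" where
  "adjacent w n i j \<longleftrightarrow> w ! (i * n + j)"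

lemma index_less: "i < n \<Longrightarrow> j < n \<Longrightarrow> i * n + j < n * (n :: nat)"
proof -
  assume "i < n" "j < n"
  then have "i * n + j < Suc i * n" by simp
  also have "\<dots> \<le> n * n" using \<open>i < n\<close> by (intro mult_le_mono1) simp
  finally show ?thesis .
qed

lemma input_bit:
  "p < length w \<Longrightarrow> input w b False p = symbol_of_bit (w ! p)"
  "p < length b \<Longrightarrow> input w b True p = symbol_of_bit (b ! p)"
  by (simp_all add: input_def word_tape_def)

lemma verifier_iff:
  assumes "length b = length w"
  shows "holds (input w b) verifier (env (length w) 0) \<longleftrightarrow> (\<exists>n. n * n = length w \<and>
    (\<forall>i<n. \<forall>j<n. adjacent w n i j \<longrightarrow> adjacent w n j i) \<and>
    (\<forall>i<n. \<forall>j<n. adjacent w n i j \<longrightarrow> i \<noteq> j) \<and>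
    (\<forall>i<n. card {j. j < n \<and> adjacent w n i j} = 1 \<or> card {j. j < n \<and> adjacent w n i j} = 3) \<and>
    (\<exists>i<n. card {j. j < n \<and> adjacent w n i j} = 3) \<and>
    (\<forall>i<n. card {j. j < n \<and> adjacent w n i j} = 2 * card {j. j < n \<and> adjacent w n i j \<and> b ! j = b ! i} + 1))"
proof -
  have bit: "symbol_of_bit x = 2 \<longleftrightarrow> x" "symbol_of_bit x = symbol_of_bit y \<longleftrightarrow> x = y" for x y
    by (auto simp: symbol_of_bit_def)
  have adj: "input w b False (i * n + j) = 2 \<longleftrightarrow> adjacent w n i j"
    if "n * n = length w" "i < n" "j < n" for n i j
    using index_less[OF that(2,3)] that(1) by (simp add: input_bit bit adjacent_def)
  have col: "input w b True i = input w b True j \<longleftrightarrow> b ! i = b ! j"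
    if "n * n = length w" "i < n" "j < n" for n i j
  proof -
    \<comment> \<open>The guess has as many bits as the matrix has entries, which suffices for one
      colour per vertex.\<close>
    have "n \<le> n * n" by (rule le_square)
    with that assms have "i < length b" "j < length b" by linarith+
    then show ?thesis by (simp add: input_bit bit)
  qed
  have le: "n < Suc (length w)" if "n * n = length w" for n
    using le_square[of n] that by simp
  have cong: "n < Suc (length w) \<and> n * n = length w \<and> P \<longleftrightarrow> n * n = length w \<and> Q"
    if "n * n = length w \<Longrightarrow> P \<longleftrightarrow> Q" for n P Q
    using that le by blast
  show ?thesis
    unfolding verifier_def row_sym_def column_sym_def degree_is_def same_color_def
    apply (simp add: env_def)
    apply (intro iff_exI, rule cong)
    subgoal premises n
      by (simp add: adj[OF n] col[OF n] mult_2 cong: conj_cong)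
    done
qed

text \<open>At a vertex of odd degree the closed neighbourhood has even size, so a difference of at
  most 1 must be 0. The vertex itself counts for its own colour: it has one more neighbour of the
  other colour than of its own.\<close>

lemma balanced_iff:
  assumes "simple_graph G" "odd_graph G" "two_partition G f"
  shows "locally_balanced_closed G f \<longleftrightarrow>
    (\<forall>v\<in>verts G. vertex_degree G v = 2 * card {u \<in> neighbors G v. f u = f v} + 1)"
proof -
  have "\<bar>int (card {u \<in> closed_neighbors G v. f u = 0}) - int (card {u \<in> closed_neighbors G v. f u = 1})\<bar> \<le> 1
      \<longleftrightarrow> vertex_degree G v = 2 * card {u \<in> neighbors G v. f u = f v} + 1"
    if v: "v \<in> verts G" for v
  proof -
    let ?N = "neighbors G v" and ?S = "{u \<in> neighbors G v. f u = f v}"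
      and ?D = "{u \<in> neighbors G v. f u \<noteq> f v}"
    have sub: "?N \<subseteq> verts G" by (auto simp: neighbors_def)
    have fin: "finite ?N" using sub assms(1) finite_subset unfolding simple_graph_def by blast
    have "card {v, v} \<noteq> 2" by simp
    then have nv: "v \<notin> ?N" using assms(1) unfolding simple_graph_def neighbors_def by blast
    have f: "f u = 0 \<or> f u = 1" if "u \<in> verts G" for u
      using assms(3) that unfolding two_partition_def by auto
    have "?N = ?S \<union> ?D" by auto
    then have deg: "vertex_degree G v = card ?S + card ?D"
      unfolding vertex_degree_def using fin card_Un_disjoint[of ?S ?D] by fastforce
    have S: "card (insert v ?S) = card ?S + 1" using nv fin by simp
    have odd: "odd (vertex_degree G v)" using assms(2) v unfolding odd_graph_def by blast
    from f[OF v] consider "f v = 0" | "f v = 1" by (rule disjE)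
    then show ?thesis
    proof cases
      case 1
      have "{u \<in> closed_neighbors G v. f u = 0} = insert v ?S" "{u \<in> closed_neighbors G v. f u = 1} = ?D"
        using 1 f sub by (force simp: closed_neighbors_def)+
      then show ?thesis using S deg odd by (simp only:) presburger
    next
      case 2
      have "{u \<in> closed_neighbors G v. f u = 1} = insert v ?S" "{u \<in> closed_neighbors G v. f u = 0} = ?D"
        using 2 f sub by (force simp: closed_neighbors_def)+
      then show ?thesis using S deg odd by (simp only:) presburger
    qed
  qed
  with assms(3) show ?thesis unfolding locally_balanced_closed_def by blast
qed

lemma instance_iff:
  assumes "finite (verts G)"
  shows "odd_graph G \<and> max_degree G = 3 \<longleftrightarrow>
    (\<forall>v\<in>verts G. vertex_degree G v = 1 \<or> vertex_degree G v = 3) \<and> (\<exists>v\<in>verts G. vertex_degree G v = 3)"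
proof
  assume A: "odd_graph G \<and> max_degree G = 3"
  have fin: "finite (insert 0 (vertex_degree G ` verts G))" using assms by simp
  have "vertex_degree G v = 1 \<or> vertex_degree G v = 3" if "v \<in> verts G" for v
  proof -
    have "vertex_degree G v \<le> 3"
      using Max_ge[OF fin, of "vertex_degree G v"] A that unfolding max_degree_def by simp
    moreover have "odd (vertex_degree G v)" using A that unfolding odd_graph_def by blast
    ultimately show ?thesis by presburger
  qed
  moreover have "3 \<in> insert 0 (vertex_degree G ` verts G)"
    using Max_in[OF fin] A unfolding max_degree_def by auto
  then have "\<exists>v\<in>verts G. vertex_degree G v = 3" by auto
  ultimately show "(\<forall>v\<in>verts G. vertex_degree G v = 1 \<or> vertex_degree G v = 3) \<and>
      (\<exists>v\<in>verts G. vertex_degree G v = 3)" by blast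
next
  assume A: "(\<forall>v\<in>verts G. vertex_degree G v = 1 \<or> vertex_degree G v = 3) \<and>
      (\<exists>v\<in>verts G. vertex_degree G v = 3)"
  then have "max_degree G = 3"
    unfolding max_degree_def using assms by (intro Max_eqI) (force simp: image_iff)+
  moreover have "odd_graph G" unfolding odd_graph_def using A by fastforce
  ultimately show "odd_graph G \<and> max_degree G = 3" by blast
qed

section \<open>Words and the graphs they encode\<close>

lemma encode_graph_eq:
  assumes "verts G = {..<n}"
  shows "encode_graph G = map (\<lambda>m. {m div n, m mod n} \<in> edges G) [0..<n * n]"
proof -
  have "concat (map (\<lambda>i. map (\<lambda>j. {i, j} \<in> edges G) [0..<n]) [0..<k])
      = map (\<lambda>m. {m div n, m mod n} \<in> edges G) [0..<k * n]" for k
  proof (induction k)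
    case (Suc k)
    have "[0..<Suc k * n] = [0..<k * n] @ map (\<lambda>j. k * n + j) [0..<n]"
      using upt_add_eq_append[of 0 "k * n" n] map_add_upt[of "k * n" n] by (simp add: add.commute)
    then show ?case by (auto simp: Suc)
  qed simp
  then show ?thesis by (simp add: encode_graph_def assms)
qed

lemma encode_graph_adjacent:
  assumes "verts G = {..<n}"
  shows "length (encode_graph G) = n * n"
    and "i < n \<Longrightarrow> j < n \<Longrightarrow> adjacent (encode_graph G) n i j \<longleftrightarrow> {i, j} \<in> edges G"
  using index_less[of i n j] by (auto simp: encode_graph_eq[OF assms] adjacent_def)

lemma encode_graph_inj: "inj_on encode_graph {G. standard_graph G}"
proof (rule inj_onI)
  fix G H assume A: "G \<in> {G. standard_graph G}" "H \<in> {G. standard_graph G}" "encode_graph G = encode_graph H"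
  then obtain n m where V: "verts G = {..<n}" "verts H = {..<m}" unfolding standard_graph_def by auto
  have "n * n = m * m" using encode_graph_adjacent(1)[OF V(1)] encode_graph_adjacent(1)[OF V(2)] A(3) by simp
  then have nm: "n = m" by (metis power2_eq_imp_eq power2_eq_square zero_le)
  have sub: "e \<in> edges K" if e: "e \<in> edges L" and L: "standard_graph L"
      and V: "verts L = {..<n}" "verts K = {..<n}" and eq: "encode_graph L = encode_graph K" for e K L
  proof -
    from e L have "e \<subseteq> {..<n}" "card e = 2"
      using V unfolding standard_graph_def simple_graph_def by auto
    then obtain i j where ij: "e = {i, j}" "i < n" "j < n" by (auto simp: card_2_iff)
    then show ?thesis
      using e encode_graph_adjacent(2)[OF V(1) ij(2,3)] encode_graph_adjacent(2)[OF V(2) ij(2,3)] eq by simp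
  qed
  have "edges G = edges H"
    using sub[of _ G H] sub[of _ H G] A V nm by auto
  then show "G = H" using V nm by (cases G; cases H) simp
qed

lemma neighbors_adjacent:
  assumes "verts G = {..<n}" "i < n"
  shows "neighbors G i = {j. j < n \<and> adjacent (encode_graph G) n i j}"
  using assms encode_graph_adjacent(2)[OF assms(1)] by (auto simp: neighbors_def insert_commute)

text \<open>The verifier also meets words not known to encode anything; this decodes those that pass
  its tests of symmetry and irreflexivity.\<close>

definition graph_of :: "bool list \<Rightarrow> nat \<Rightarrow> nat graph" where
  "graph_of w n = \<lparr>verts = {..<n}, edges = {{i, j} | i j. i < n \<and> j < n \<and> adjacent w n i j}\<rparr>"

lemma graph_of:
  assumes "n * n = length w" "\<And>i j. i < n \<Longrightarrow> j < n \<Longrightarrow> adjacent w n i j \<Longrightarrow> adjacent w n j i"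
    and "\<And>i j. i < n \<Longrightarrow> j < n \<Longrightarrow> adjacent w n i j \<Longrightarrow> i \<noteq> j"
  shows "standard_graph (graph_of w n)" "encode_graph (graph_of w n) = w"
proof -
  let ?G = "graph_of w n"
  show "standard_graph ?G"
    using assms(3) by (auto simp: standard_graph_def simple_graph_def graph_of_def card_insert_if)
  have e: "{i, j} \<in> edges ?G \<longleftrightarrow> adjacent w n i j" if "i < n" "j < n" for i j
    using assms(2) that by (auto simp: graph_of_def doubleton_eq_iff)
  have V: "verts ?G = {..<n}" by (simp add: graph_of_def)
  show "encode_graph ?G = w"
  proof (rule nth_equalityI)
    show "length (encode_graph ?G) = length w" using encode_graph_adjacent(1)[OF V] assms(1) by simp
    fix m assume "m < length (encode_graph ?G)"
    then have m: "m < n * n" using encode_graph_adjacent(1)[OF V] by simp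
    then have "n > 0" by (cases n) auto
    then have "m div n < n" "m mod n < n" using m by (auto simp: less_mult_imp_div_less)
    then show "encode_graph ?G ! m = w ! m"
      using m e by (simp add: encode_graph_eq[OF V] adjacent_def)
  qed
qed

abbreviation instances :: "nat graph set" where
  "instances \<equiv> {G. standard_graph G \<and> odd_graph G \<and> max_degree G = 3}"

abbreviation yes_instances :: "nat graph set" where
  "yes_instances \<equiv> {G \<in> instances. \<exists>f. locally_balanced_closed G f}"

lemma verifier_encode:
  assumes G: "standard_graph G" and b: "length b = length (encode_graph G)"
  shows "holds (input (encode_graph G) b) verifier (env (length (encode_graph G)) 0) \<longleftrightarrow>
    G \<in> instances \<and> locally_balanced_closed G (\<lambda>i. of_bool (b ! i))"
proof -
  obtain n where V: "verts G = {..<n}" using G unfolding standard_graph_def by blast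
  let ?w = "encode_graph G" and ?f = "\<lambda>i. of_bool (b ! i) :: nat"
  note adj = encode_graph_adjacent[OF V]
  have simple: "simple_graph G" using G unfolding standard_graph_def by blast
  have sym: "adjacent ?w n i j \<longleftrightarrow> adjacent ?w n j i" if "i < n" "j < n" for i j
    using adj(2) that by (simp add: insert_commute)
  have irr: "\<not> adjacent ?w n i i" if "i < n" for i
    using adj(2)[OF that that] simple unfolding simple_graph_def by force
  have deg: "card {j. j < n \<and> adjacent ?w n i j} = vertex_degree G i" if "i < n" for i
    using neighbors_adjacent[OF V that] by (simp add: vertex_degree_def)
  have same: "{j. j < n \<and> adjacent ?w n i j \<and> b ! j = b ! i} = {u \<in> neighbors G i. ?f u = ?f i}"
    if "i < n" for i
    using neighbors_adjacent[OF V that] by auto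
  have sq: "m * m = n * n \<longleftrightarrow> m = n" for m :: nat
    by (metis power2_eq_imp_eq power2_eq_square zero_le)
  have "holds (input ?w b) verifier (env (length ?w) 0) \<longleftrightarrow>
    (\<forall>i<n. vertex_degree G i = 1 \<or> vertex_degree G i = 3) \<and> (\<exists>i<n. vertex_degree G i = 3) \<and>
    (\<forall>i<n. vertex_degree G i = 2 * card {u \<in> neighbors G i. ?f u = ?f i} + 1)"
  proof -
    have "(\<forall>i<n. \<forall>j<n. adjacent ?w n i j \<longrightarrow> adjacent ?w n j i) \<longleftrightarrow> True"
      "(\<forall>i<n. \<forall>j<n. adjacent ?w n i j \<longrightarrow> i \<noteq> j) \<longleftrightarrow> True"
      using sym irr by blast+
    note trivial = this
    show ?thesis
      unfolding verifier_iff[OF b] unfolding adj(1) sq ex_simps simp_thms trivial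
      by (simp add: deg same cong: conj_cong)
  qed
  also have "\<dots> \<longleftrightarrow> G \<in> instances \<and> locally_balanced_closed G ?f"
    using instance_iff[of G] balanced_iff[OF simple, of ?f] G V by (auto simp: two_partition_def)
  finally show ?thesis .
qed

lemma locally_balanced_cong:
  assumes "\<And>v. v \<in> verts G \<Longrightarrow> f v = g v"
  shows "locally_balanced_closed G f \<Longrightarrow> locally_balanced_closed G g"
proof -
  have "{u \<in> closed_neighbors G v. f u = c} = {u \<in> closed_neighbors G v. g u = c}" if "v \<in> verts G" for v c
    using that assms by (auto simp: closed_neighbors_def neighbors_def)
  then show "locally_balanced_closed G f \<Longrightarrow> locally_balanced_closed G g"
    using assms by (auto simp: locally_balanced_closed_def two_partition_def)
qed

theorem balanced_in_NP:
  "encode_graph ` yes_instances \<in> NP"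
proof -
  have "(\<exists>b. length b = length w \<and> holds (input w b) verifier (env (length w) 0)) \<longleftrightarrow>
      w \<in> encode_graph ` yes_instances" for w
  proof
    assume "\<exists>b. length b = length w \<and> holds (input w b) verifier (env (length w) 0)"
    then obtain b where b: "length b = length w" "holds (input w b) verifier (env (length w) 0)" by blast
    from b(2)[unfolded verifier_iff[OF b(1)]] obtain n where n': "n * n = length w"
      "\<forall>i<n. \<forall>j<n. adjacent w n i j \<longrightarrow> adjacent w n j i"
      "\<forall>i<n. \<forall>j<n. adjacent w n i j \<longrightarrow> i \<noteq> j"
      by (elim exE conjE) (rule that)
    then have n: "n * n = length w"
      "\<And>i j. i < n \<Longrightarrow> j < n \<Longrightarrow> adjacent w n i j \<Longrightarrow> adjacent w n j i"
      "\<And>i j. i < n \<Longrightarrow> j < n \<Longrightarrow> adjacent w n i j \<Longrightarrow> i \<noteq> j" by auto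
    note G = graph_of[OF n]
    have "graph_of w n \<in> instances \<and> locally_balanced_closed (graph_of w n) (\<lambda>i. of_bool (b ! i))"
      using verifier_encode[OF G(1), of b] b G(2) by simp
    with G(2) show "w \<in> encode_graph ` yes_instances" by force
  next
    assume "w \<in> encode_graph ` yes_instances"
    then obtain G f where G: "w = encode_graph G" "G \<in> instances" "locally_balanced_closed G f" by blast
    then obtain n where V: "verts G = {..<n}" unfolding standard_graph_def by blast
    \<comment> \<open>The colours are padded to the length of the input; only the first
      \<open>n\<close> bits concern vertices.\<close>
    let ?b = "map (\<lambda>i. f i = 1) [0..<n * n]"
    have len: "length ?b = length w" using encode_graph_adjacent(1)[OF V] G(1) by simp
    have "f v = of_bool (?b ! v)" if "v \<in> verts G" for v
    proof -
      have "f v \<in> {0, 1}" using that G(3) unfolding locally_balanced_closed_def two_partition_def by blast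
      moreover have "v < n * n" using that V le_square[of n] by (simp add: less_le_trans)
      then have "?b ! v \<longleftrightarrow> f v = 1" by simp
      ultimately show ?thesis by fastforce
    qed
    from locally_balanced_cong[OF this G(3)] verifier_encode[of G ?b] G len
    have "holds (input w ?b) verifier (env (length w) 0)" by simp
    with len show "\<exists>b. length b = length w \<and> holds (input w b) verifier (env (length w) 0)" by blast
  qed
  then show ?thesis using expression_in_NP[of verifier] by simp
qed

section \<open>From not-all-equal constraints to graphs\<close>

text \<open>The cycle of a variable alternates between hubs and mids. A mid also has a leaf, which makes its
  two hubs differ, so hubs of even index carry the value of the variable and hubs of odd index its
  negation. The pendant of a hub is a leaf unless it serves as a port of a constraint.

  In the gadget of a constraint the three ports have a common center, and each port is linked to a
  corner of a triangle. The tip of a link makes the port and the corner differ. Of the three corners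
  exactly two agree, and then the center agrees with the port of the third one; it follows that every
  corner has the colour of its hub.\<close>

datatype vertex =
    Hub nat nat | Mid nat nat | Leaf nat nat | Pendant nat nat
  | Center nat | Link nat nat | Tip nat nat | Corner nat nat

locale nae =
  fixes ny nd :: nat and ly ls :: "nat \<Rightarrow> nat \<Rightarrow> nat"
  assumes nd: "nd > 0"
    and ly: "\<And>d k. d < nd \<Longrightarrow> k < 3 \<Longrightarrow> ly d k < ny"
    and ls: "\<And>d k. d < nd \<Longrightarrow> k < 3 \<Longrightarrow> ls d k < 2"
begin

definition satisfies :: "(nat \<Rightarrow> bool) \<Rightarrow> bool" where
  "satisfies \<alpha> \<longleftrightarrow> (\<forall>d<nd. \<exists>k<3. \<exists>k'<3. (\<alpha> (ly d k) \<noteq> (ls d k = 1)) \<noteq> (\<alpha> (ly d k') \<noteq> (ls d k' = 1)))"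

text \<open>Each of the \<open>3 * nd\<close> literal occurrences reserves two consecutive
  positions, one of each parity, on every cycle. All cycles thus have the same even length, whatever
  variables the constraints mention.\<close>

definition M :: nat where "M = 6 * nd"

text \<open>The sign selects the even or the odd hub of the reserved pair, that is, the value of the
  variable or its negation.\<close>

definition slot :: "nat \<Rightarrow> nat \<Rightarrow> nat" where "slot d k = 6 * d + 2 * k + ls d k"

definition next_slot :: "nat \<Rightarrow> nat" where "next_slot m = (if m + 1 = M then 0 else m + 1)"

definition prev_slot :: "nat \<Rightarrow> nat" where "prev_slot m = (if m = 0 then M - 1 else m - 1)"

abbreviation port :: "nat \<Rightarrow> nat \<Rightarrow> vertex" where "port d k \<equiv> Pendant (ly d k) (slot d k)"

text \<open>The orientation is only a way of listing edges and is forgotten in \<open>nb\<close>.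
  Positions reserved for literals of other variables keep a pendant of degree 1.\<close>

definition arc :: "vertex \<Rightarrow> vertex \<Rightarrow> bool" where
  "arc u v \<longleftrightarrow>
    (\<exists>y<ny. \<exists>m<M. u = Mid y m \<and> v = Hub y m \<or> u = Mid y m \<and> v = Hub y (next_slot m) \<or>
       u = Mid y m \<and> v = Leaf y m \<or> u = Hub y m \<and> v = Pendant y m) \<or>
    (\<exists>d<nd. \<exists>k<3. u = port d k \<and> v = Center d \<or> u = port d k \<and> v = Link d k \<or>
       u = Link d k \<and> v = Tip d k \<or> u = Link d k \<and> v = Corner d k \<or>
       (\<exists>k'<3. k' \<noteq> k \<and> u = Corner d k \<and> v = Corner d k'))"

definition vertices :: "vertex set" where
  "vertices = (\<Union>y<ny. \<Union>m<M. {Hub y m, Mid y m, Leaf y m, Pendant y m}) \<union>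
    (\<Union>d<nd. insert (Center d) (\<Union>k<3. {Link d k, Tip d k, Corner d k}))"

definition nb :: "vertex \<Rightarrow> vertex set" where
  "nb v = {u. arc u v \<or> arc v u}"

lemma M_ge: "M \<ge> 6"
  using nd by (simp add: M_def)

lemma slot_less: "d < nd \<Longrightarrow> k < 3 \<Longrightarrow> slot d k < M"
  using ls[of d k] unfolding slot_def M_def by linarith

text \<open>Since \<open>2 * k + ls d k < 6\<close>, division by 6 recovers \<open>d\<close>, and
  halving the remainder recovers \<open>k\<close>. Hence no pendant is the port of two
  occurrences.\<close>

lemma slot_eq:
  assumes "d < nd" "k < 3" "d' < nd" "k' < 3" "slot d k = slot d' k'"
  shows "d = d' \<and> k = k'"
proof -
  have "slot d k div 6 = d \<and> slot d k mod 6 div 2 = k" if "d < nd" "k < 3" for d k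
  proof -
    have r: "2 * k + ls d k < 6" using ls[OF that] that by simp
    then have "slot d k div 6 = d" "slot d k mod 6 = 2 * k + ls d k"
      using div_mult_self2[of 6 "2 * k + ls d k" d] mod_mult_self2[of "2 * k + ls d k" 6 d]
      unfolding slot_def by (simp_all add: add.commute add.left_commute)
    then show ?thesis using ls[OF that] by simp
  qed
  with assms show ?thesis by metis
qed

lemma odd_slot: "d < nd \<Longrightarrow> k < 3 \<Longrightarrow> odd (slot d k) \<longleftrightarrow> ls d k = 1"
  using ls[of d k] unfolding slot_def by (auto simp: less_2_cases_iff)

lemma next_prev:
  "m < M \<Longrightarrow> next_slot m < M" "m < M \<Longrightarrow> prev_slot m < M"
  "m < M \<Longrightarrow> m' < M \<Longrightarrow> next_slot m' = m \<longleftrightarrow> m' = prev_slot m"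
  "m < M \<Longrightarrow> next_slot m \<noteq> m" "m < M \<Longrightarrow> prev_slot m \<noteq> m"
  "m < M \<Longrightarrow> next_slot (prev_slot m) = m"
  using M_ge by (auto simp: next_slot_def prev_slot_def)

section \<open>Neighbourhoods in the constructed graph\<close>

lemma nb_Hub:
  assumes y: "y < ny" and m: "m < M"
  shows "nb (Hub y m) = {Mid y m, Mid y (prev_slot m), Pendant y m}"
proof -
  have "\<exists>y'<ny. \<exists>m'<M. Mid y (prev_slot m) = Mid y' m' \<and> Hub y m = Hub y' (next_slot m')"
    using y next_prev(2,6)[OF m] by metis
  then have "arc (Mid y (prev_slot m)) (Hub y m)" unfolding arc_def by blast
  moreover have "nb (Hub y m) \<subseteq> {Mid y m, Mid y (prev_slot m), Pendant y m}"
    using next_prev(3)[OF m] by (auto simp: nb_def arc_def)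
  moreover have "arc (Mid y m) (Hub y m)" "arc (Hub y m) (Pendant y m)" unfolding arc_def using y m by blast+
  ultimately show ?thesis unfolding nb_def by blast
qed

lemma nb_Mid: "y < ny \<Longrightarrow> m < M \<Longrightarrow> nb (Mid y m) = {Hub y m, Hub y (next_slot m), Leaf y m}"
  by (auto simp: nb_def arc_def)

lemma nb_Leaf: "y < ny \<Longrightarrow> m < M \<Longrightarrow> nb (Leaf y m) = {Mid y m}"
  by (auto simp: nb_def arc_def)

lemma nb_Pendant:
  "y < ny \<Longrightarrow> m < M \<Longrightarrow> \<not> (\<exists>d<nd. \<exists>k<3. ly d k = y \<and> slot d k = m) \<Longrightarrow> nb (Pendant y m) = {Hub y m}"
  by (auto simp: nb_def arc_def)

lemma nb_port: "d < nd \<Longrightarrow> k < 3 \<Longrightarrow> nb (port d k) = {Hub (ly d k) (slot d k), Center d, Link d k}"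
  using ly[of d k] slot_less[of d k] slot_eq[of d k] by (auto simp: nb_def arc_def)

lemma less_three: "k < 3 \<longleftrightarrow> k = 0 \<or> k = 1 \<or> k = (2 :: nat)"
  by auto

lemma nb_Center: "d < nd \<Longrightarrow> nb (Center d) = {port d 0, port d 1, port d 2}"
  by (auto simp: nb_def arc_def less_three)

lemma nb_Link: "d < nd \<Longrightarrow> k < 3 \<Longrightarrow> nb (Link d k) = {port d k, Tip d k, Corner d k}"
  by (auto simp: nb_def arc_def)

lemma nb_Tip: "d < nd \<Longrightarrow> k < 3 \<Longrightarrow> nb (Tip d k) = {Link d k}"
  by (auto simp: nb_def arc_def)

lemma nb_Corner:
  "d < nd \<Longrightarrow> k < 3 \<Longrightarrow> nb (Corner d k) = {Link d k, Corner d ((k + 1) mod 3), Corner d ((k + 2) mod 3)}"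
  by (auto simp: nb_def arc_def less_three)

section \<open>Local balance at each kind of vertex\<close>

definition fair :: "(vertex \<Rightarrow> bool) \<Rightarrow> vertex \<Rightarrow> bool" where
  "fair c v \<longleftrightarrow> card (nb v) = 2 * card {u \<in> nb v. c u = c v} + 1"

definition balanced :: "(vertex \<Rightarrow> bool) \<Rightarrow> bool" where
  "balanced c \<longleftrightarrow> (\<forall>v\<in>vertices. fair c v)"

definition one_same :: "bool \<Rightarrow> bool \<Rightarrow> bool \<Rightarrow> bool \<Rightarrow> bool" where
  "one_same v a b c \<longleftrightarrow> (a = v \<and> b \<noteq> v \<and> c \<noteq> v) \<or> (a \<noteq> v \<and> b = v \<and> c \<noteq> v) \<or> (a \<noteq> v \<and> b \<noteq> v \<and> c = v)"

lemma card_three: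
  assumes "x \<noteq> y" "x \<noteq> z" "y \<noteq> z"
  shows "card {x, y, z} = 2 * card {u \<in> {x, y, z}. c u = v} + 1 \<longleftrightarrow> one_same v (c x) (c y) (c z)"
proof -
  have "{u \<in> {x, y, z}. c u = v} = (if c x = v then {x} else {}) \<union> (if c y = v then {y} else {}) \<union> (if c z = v then {z} else {})"
    by auto
  then show ?thesis using assms by (auto simp: one_same_def)
qed

lemma card_one: "card {x} = 2 * card {u \<in> {x}. c u = v} + 1 \<longleftrightarrow> c x \<noteq> v"
proof -
  have "{u \<in> {x}. c u = v} = (if c x = v then {x} else {})" by auto
  then show ?thesis by auto
qed

lemma vertices_cases [consumes 1]:
  assumes "v \<in> vertices"
  obtains (Hub) y m where "v = Hub y m" "y < ny" "m < M" | (Mid) y m where "v = Mid y m" "y < ny" "m < M"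
    | (Leaf) y m where "v = Leaf y m" "y < ny" "m < M"
    | (leaf) y m where "v = Pendant y m" "y < ny" "m < M" "\<not> (\<exists>d<nd. \<exists>k<3. ly d k = y \<and> slot d k = m)"
    | (port) d k where "v = port d k" "d < nd" "k < 3" | (Center) d where "v = Center d" "d < nd"
    | (Link) d k where "v = Link d k" "d < nd" "k < 3" | (Tip) d k where "v = Tip d k" "d < nd" "k < 3"
    | (Corner) d k where "v = Corner d k" "d < nd" "k < 3"
  using assms unfolding vertices_def by blast

lemma port_in: "d < nd \<Longrightarrow> k < 3 \<Longrightarrow> ly d k < ny \<and> slot d k < M"
  using ly slot_less by blast

lemma distinct_ports: "d < nd \<Longrightarrow> slot d 0 \<noteq> slot d 1 \<and> slot d 0 \<noteq> slot d 2 \<and> slot d 1 \<noteq> slot d 2"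
  using slot_eq[of d 0 d 1] slot_eq[of d 0 d 2] slot_eq[of d 1 d 2] by auto

lemma card_nb:
  assumes "v \<in> vertices"
  shows "card (nb v) = 1 \<or> card (nb v) = 3"
  using assms
proof (cases rule: vertices_cases)
  case (Hub y m)
  then show ?thesis using next_prev(5)[of m] by (simp add: nb_Hub card_insert_if)
next
  case (Mid y m)
  have "Hub y m \<noteq> Hub y (next_slot m)" using Mid next_prev(4)[of m] by auto
  then show ?thesis using Mid by (simp add: nb_Mid card_insert_if)
next
  case (Center d)
  then show ?thesis using distinct_ports[of d] by (simp add: nb_Center card_insert_if)
next
  case (Corner d k)
  then have "(k + 1) mod 3 \<noteq> (k + 2) mod 3" "(k + 1) mod 3 \<noteq> k" "(k + 2) mod 3 \<noteq> k" by presburger+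
  then have "card {Link d k, Corner d ((k + 1) mod 3), Corner d ((k + 2) mod 3)} = 3"
    by (simp add: card_insert_if del: add_2_eq_Suc')
  then show ?thesis using Corner nb_Corner by metis
qed (simp_all add: nb_Leaf nb_Pendant nb_port nb_Link nb_Tip)

lemma fair_Hub: "y < ny \<Longrightarrow> m < M \<Longrightarrow>
    fair c (Hub y m) \<longleftrightarrow> one_same (c (Hub y m)) (c (Mid y m)) (c (Mid y (prev_slot m))) (c (Pendant y m))"
  using next_prev(5)[of m] unfolding fair_def by (simp only: nb_Hub) (rule card_three; auto)

lemma fair_Mid: "y < ny \<Longrightarrow> m < M \<Longrightarrow>
    fair c (Mid y m) \<longleftrightarrow> one_same (c (Mid y m)) (c (Hub y m)) (c (Hub y (next_slot m))) (c (Leaf y m))"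
  using next_prev(4)[of m] unfolding fair_def by (simp only: nb_Mid) (rule card_three; auto)

lemma fair_Leaf: "y < ny \<Longrightarrow> m < M \<Longrightarrow> fair c (Leaf y m) \<longleftrightarrow> c (Mid y m) \<noteq> c (Leaf y m)"
  unfolding fair_def by (simp only: nb_Leaf) (rule card_one)

lemma fair_Pendant:
  assumes "y < ny" "m < M" "\<not> (\<exists>d<nd. \<exists>k<3. ly d k = y \<and> slot d k = m)"
  shows "fair c (Pendant y m) \<longleftrightarrow> c (Hub y m) \<noteq> c (Pendant y m)"
  unfolding fair_def nb_Pendant[OF assms] by (rule card_one)

lemma fair_port: "d < nd \<Longrightarrow> k < 3 \<Longrightarrow>
    fair c (port d k) \<longleftrightarrow> one_same (c (port d k)) (c (Hub (ly d k) (slot d k))) (c (Center d)) (c (Link d k))"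
  unfolding fair_def by (simp only: nb_port) (rule card_three; auto)

lemma fair_Center: "d < nd \<Longrightarrow>
    fair c (Center d) \<longleftrightarrow> one_same (c (Center d)) (c (port d 0)) (c (port d 1)) (c (port d 2))"
  using distinct_ports[of d] unfolding fair_def by (simp only: nb_Center) (rule card_three; auto)

lemma fair_Link: "d < nd \<Longrightarrow> k < 3 \<Longrightarrow>
    fair c (Link d k) \<longleftrightarrow> one_same (c (Link d k)) (c (port d k)) (c (Tip d k)) (c (Corner d k))"
  unfolding fair_def by (simp only: nb_Link) (rule card_three; auto)

lemma fair_Tip: "d < nd \<Longrightarrow> k < 3 \<Longrightarrow> fair c (Tip d k) \<longleftrightarrow> c (Link d k) \<noteq> c (Tip d k)"
  unfolding fair_def by (simp only: nb_Tip) (rule card_one)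

lemma fair_Corner:
  assumes "d < nd" "k < 3"
  shows "fair c (Corner d k) \<longleftrightarrow>
    one_same (c (Corner d k)) (c (Link d k)) (c (Corner d ((k + 1) mod 3))) (c (Corner d ((k + 2) mod 3)))"
proof -
  have "(k + 1) mod 3 \<noteq> (k + 2) mod 3" by presburger
  then show ?thesis unfolding fair_def nb_Corner[OF assms] by (intro card_three) auto
qed

lemma balanced_imp_satisfies:
  assumes "balanced c"
  shows "satisfies (\<lambda>y. c (Hub y 0))"
proof -
  have bal: "fair c v" if "v \<in> vertices" for v
    using assms that unfolding balanced_def by blast
  \<comment> \<open>A mid differs from its leaf, so it agrees with exactly one of its two hubs, and
    consecutive hubs differ.\<close>
  have alt: "c (Hub y m) \<longleftrightarrow> c (Hub y 0) \<noteq> odd m" if "y < ny" "m < M" for y m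
    using that
  proof (induction m)
    case (Suc m)
    then have m: "m < M" "next_slot m = Suc m" by (auto simp: next_slot_def)
    have "Mid y m \<in> vertices" "Leaf y m \<in> vertices" using m Suc.prems(1) by (auto simp: vertices_def)
    from this[THEN bal] have "c (Hub y m) \<noteq> c (Hub y (Suc m))"
      unfolding fair_Mid[OF Suc.prems(1) m(1)] fair_Leaf[OF Suc.prems(1) m(1)] m(2)
      by (auto simp: one_same_def)
    then show ?case using Suc.IH[OF Suc.prems(1) m(1)] by auto
  qed simp
  show ?thesis
    unfolding satisfies_def
  proof (intro allI impI)
    fix d assume d: "d < nd"
    let ?u = "\<lambda>k. c (Hub (ly d k) (slot d k))"
    have lit: "(c (Hub (ly d k) 0) \<noteq> (ls d k = 1)) = ?u k" if "k < 3" for k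
      using alt[of "ly d k" "slot d k"] port_in[OF d that] odd_slot[OF d that] by auto
    have "Center d \<in> vertices" using d by (auto simp: vertices_def)
    from bal[OF this] have center: "one_same (c (Center d)) (c (port d 0)) (c (port d 1)) (c (port d 2))"
      unfolding fair_Center[OF d] .
    have "one_same (c (port d k)) (?u k) (c (Center d)) (c (Link d k)) \<and>
        one_same (c (Link d k)) (c (port d k)) (c (Tip d k)) (c (Corner d k)) \<and> c (Link d k) \<noteq> c (Tip d k) \<and>
        one_same (c (Corner d k)) (c (Link d k)) (c (Corner d ((k + 1) mod 3))) (c (Corner d ((k + 2) mod 3)))"
      if k: "k < 3" for k
    proof -
      have "port d k \<in> vertices" "Link d k \<in> vertices" "Tip d k \<in> vertices" "Corner d k \<in> vertices"
        using d k port_in[OF d k] by (auto simp: vertices_def)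
      from this[THEN bal] show ?thesis
        unfolding fair_port[OF d k] fair_Link[OF d k] fair_Tip[OF d k]
          fair_Corner[OF d k] by blast
    qed
    \<comment> \<open>Let \<open>a\<close> be the colour of two of the corners. Balance at the
      corners gives all three links the opposite colour. Ports differ from their corners, so only
      the port of the third corner has colour \<open>a\<close>, and the center must agree with it.
      Balance at each port then makes its hub differ from it, so the hubs are coloured like the
      corners.\<close>
    from this[of 0] this[of 1] this[of 2] center
    have "?u 0 \<noteq> ?u 1 \<or> ?u 0 \<noteq> ?u 2"
      unfolding one_same_def by (simp add: numeral_2_eq_2) argo
    then show "\<exists>k<3. \<exists>k'<3. (c (Hub (ly d k) 0) \<noteq> (ls d k = 1)) \<noteq> (c (Hub (ly d k') 0) \<noteq> (ls d k' = 1))"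
    proof
      assume "?u 0 \<noteq> ?u 1"
      then show ?thesis using lit[of 0] lit[of 1] by (intro exI[of _ 0] exI[of _ 1] conjI) auto
    next
      assume "?u 0 \<noteq> ?u 2"
      then show ?thesis using lit[of 0] lit[of 2] by (intro exI[of _ 0] exI[of _ 2] conjI) auto
    qed
  qed
qed

definition literal :: "(nat \<Rightarrow> bool) \<Rightarrow> nat \<Rightarrow> nat \<Rightarrow> bool" where
  "literal \<alpha> d k \<longleftrightarrow> \<alpha> (ly d k) \<noteq> (ls d k = 1)"

definition majority :: "(nat \<Rightarrow> bool) \<Rightarrow> nat \<Rightarrow> bool" where
  "majority \<alpha> d \<longleftrightarrow> literal \<alpha> d 0 \<and> literal \<alpha> d 1 \<or> literal \<alpha> d 2 \<and> (literal \<alpha> d 0 \<or> literal \<alpha> d 1)"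

text \<open>Mids alternate independently of \<open>\<alpha>\<close>, so each hub agrees with exactly
  one of its two mids and its pendant must differ. In a constraint the corners copy the literals,
  all links take the minority value, and the center takes the majority value.\<close>

fun coloring :: "(nat \<Rightarrow> bool) \<Rightarrow> vertex \<Rightarrow> bool" where
  "coloring \<alpha> (Hub y m) \<longleftrightarrow> \<alpha> y \<noteq> odd m"
| "coloring \<alpha> (Mid y m) \<longleftrightarrow> odd m"
| "coloring \<alpha> (Leaf y m) \<longleftrightarrow> even m"
| "coloring \<alpha> (Pendant y m) \<longleftrightarrow> \<alpha> y = odd m"
| "coloring \<alpha> (Center d) \<longleftrightarrow> majority \<alpha> d"
| "coloring \<alpha> (Link d k) \<longleftrightarrow> \<not> majority \<alpha> d"
| "coloring \<alpha> (Tip d k) \<longleftrightarrow> majority \<alpha> d"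
| "coloring \<alpha> (Corner d k) \<longleftrightarrow> literal \<alpha> d k"

lemma coloring_port:
  "d < nd \<Longrightarrow> k < 3 \<Longrightarrow> coloring \<alpha> (port d k) \<longleftrightarrow> \<not> literal \<alpha> d k"
  "d < nd \<Longrightarrow> k < 3 \<Longrightarrow> coloring \<alpha> (Hub (ly d k) (slot d k)) \<longleftrightarrow> literal \<alpha> d k"
  using odd_slot[of d k] by (auto simp: literal_def)

text \<open>The cycle length is even, so alternation also survives the step between the last
  position and position 0.\<close>

lemma parity_slot: "m < M \<Longrightarrow> odd (prev_slot m) \<longleftrightarrow> even m" "m < M \<Longrightarrow> odd (next_slot m) \<longleftrightarrow> even m"
proof -
  have "even M" by (simp add: M_def)
  then show "m < M \<Longrightarrow> odd (prev_slot m) \<longleftrightarrow> even m" "m < M \<Longrightarrow> odd (next_slot m) \<longleftrightarrow> even m"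
    using M_ge unfolding prev_slot_def next_slot_def by presburger+
qed

lemma satisfies_imp_balanced:
  assumes "satisfies \<alpha>"
  shows "balanced (coloring \<alpha>)"
  unfolding balanced_def
proof
  have nae: "literal \<alpha> d 0 \<noteq> literal \<alpha> d 1 \<or> literal \<alpha> d 0 \<noteq> literal \<alpha> d 2" if d: "d < nd" for d
  proof -
    obtain k k' where k: "k < 3" "k' < 3" "literal \<alpha> d k \<noteq> literal \<alpha> d k'"
      using assms d unfolding satisfies_def literal_def by blast
    have "k = 0 \<or> k = 1 \<or> k = 2" "k' = 0 \<or> k' = 1 \<or> k' = 2" using k by auto
    with k(3) show ?thesis by auto
  qed
  fix v assume "v \<in> vertices"
  then show "fair (coloring \<alpha>) v"
  proof (cases rule: vertices_cases)
    case (Hub y m)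
    show ?thesis unfolding Hub(1) fair_Hub[OF Hub(2,3)]
      using parity_slot(1)[OF Hub(3)] by (auto simp: one_same_def)
  next
    case (Mid y m)
    show ?thesis unfolding Mid(1) fair_Mid[OF Mid(2,3)]
      using parity_slot(2)[OF Mid(3)] by (auto simp: one_same_def)
  next
    case (Leaf y m)
    show ?thesis unfolding Leaf(1) fair_Leaf[OF Leaf(2,3)] by simp
  next
    case (leaf y m)
    show ?thesis unfolding leaf(1) fair_Pendant[OF leaf(2-4)] by simp
  next
    case (port d k)
    show ?thesis unfolding port(1) fair_port[OF port(2,3)]
      unfolding coloring_port[OF port(2,3)] by (auto simp: one_same_def)
  next
    case (Center d)
    have "(0 :: nat) < 3" "(1 :: nat) < 3" "(2 :: nat) < 3" by simp_all
    note ports = this[THEN coloring_port(1)[OF Center(2)]]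
    show ?thesis unfolding Center(1) fair_Center[OF Center(2)] ports
      using nae[OF Center(2)] by (auto simp: one_same_def majority_def)
  next
    case (Link d k)
    show ?thesis unfolding Link(1) fair_Link[OF Link(2,3)]
      unfolding coloring_port[OF Link(2,3)] by (auto simp: one_same_def)
  next
    case (Tip d k)
    show ?thesis unfolding Tip(1) fair_Tip[OF Tip(2,3)] by simp
  next
    case (Corner d k)
    have "k = 0 \<or> k = 1 \<or> k = 2" using Corner(3) by auto
    then show ?thesis unfolding Corner(1) fair_Corner[OF Corner(2,3)]
      using nae[OF Corner(2)] by (auto simp: one_same_def majority_def numeral_2_eq_2)
  qed
qed

section \<open>Numbering of the vertices\<close>

definition base :: nat where "base = 4 * (ny * M)"

text \<open>Each position of a cycle contributes 4 vertices, and each constraint 10: a center and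
  three each of links, tips and corners. Ports are already counted as pendants.\<close>

fun index :: "vertex \<Rightarrow> nat" where
  "index (Hub y m) = 4 * (y * M + m)"
| "index (Mid y m) = 4 * (y * M + m) + 1"
| "index (Leaf y m) = 4 * (y * M + m) + 2"
| "index (Pendant y m) = 4 * (y * M + m) + 3"
| "index (Center d) = base + 10 * d"
| "index (Link d k) = base + 10 * d + 1 + k"
| "index (Tip d k) = base + 10 * d + 4 + k"
| "index (Corner d k) = base + 10 * d + 7 + k"

definition vertex_at :: "nat \<Rightarrow> vertex" where
  "vertex_at i =
    (if i < base then
       (let y = i div 4 div M; m = i div 4 mod M; r = i mod 4
        in if r = 0 then Hub y m else if r = 1 then Mid y m else if r = 2 then Leaf y m else Pendant y m)
     else
       (let d = (i - base) div 10; r = (i - base) mod 10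
        in if r = 0 then Center d else if r < 4 then Link d (r - 1) else if r < 7 then Tip d (r - 4)
          else Corner d (r - 7)))"

definition size :: nat where "size = base + 10 * nd"

lemma vertex_at_index:
  assumes "v \<in> vertices"
  shows "vertex_at (index v) = v" and "index v < size"
proof -
  have ring: "4 * (y * M + m) + r < base \<and> (4 * (y * M + m) + r) div 4 = y * M + m \<and>
      (4 * (y * M + m) + r) mod 4 = r \<and> (y * M + m) div M = y \<and> (y * M + m) mod M = m"
    if "y < ny" "m < M" "r < 4" for y m r
  proof -
    have "y * M + m < Suc y * M" using that by simp
    also have "\<dots> \<le> ny * M" using that by (intro mult_le_mono1) simp
    finally have "y * M + m < ny * M" .
    moreover have "4 * q + r < 4 * b" if "q < b" for q b using that \<open>r < 4\<close> by linarith
    ultimately have "4 * (y * M + m) + r < base" unfolding base_def by blast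
    moreover have "(4 * q + r) div 4 = q" "(4 * q + r) mod 4 = r" for q using that(3) by simp_all
    moreover have "(y * M + m) div M = y" "(y * M + m) mod M = m" using that(2) by simp_all
    ultimately show ?thesis by blast
  qed
  have ring: "vertex_at (4 * (y * M + m) + r) =
      (if r = 0 then Hub y m else if r = 1 then Mid y m else if r = 2 then Leaf y m else Pendant y m) \<and>
      4 * (y * M + m) + r < size"
    if "y < ny" "m < M" "r < 4" for y m r
    using ring[OF that] unfolding vertex_at_def Let_def size_def by auto
  have clause: "vertex_at (base + 10 * d + r) =
      (if r = 0 then Center d else if r < 4 then Link d (r - 1) else if r < 7 then Tip d (r - 4) else Corner d (r - 7)) \<and>
      base + 10 * d + r < size"
    if "d < nd" "r < 10" for d r
    using that unfolding vertex_at_def Let_def size_def by auto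
  have "vertex_at (index v) = v \<and> index v < size"
    using assms
  proof (cases rule: vertices_cases)
    case (Hub y m)
    then show ?thesis using ring[of y m 0] by simp
  next
    case (Mid y m)
    then show ?thesis using ring[of y m 1] by simp
  next
    case (Leaf y m)
    then show ?thesis using ring[of y m 2] by simp
  next
    case (leaf y m)
    then show ?thesis using ring[of y m 3] by simp
  next
    case (port d k)
    then show ?thesis using ring[of "ly d k" "slot d k" 3] port_in[of d k] by simp
  next
    case (Center d)
    then show ?thesis using clause[of d 0] by simp
  next
    case (Link d k)
    then show ?thesis using clause[of d "1 + k"] by simp
  next
    case (Tip d k)
    then show ?thesis using clause[of d "4 + k"] by (simp add: add.assoc)
  next
    case (Corner d k)
    then show ?thesis using clause[of d "7 + k"] by (simp add: add.assoc)
  qed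
  then show "vertex_at (index v) = v" "index v < size" by auto
qed

lemma index_vertex_at:
  assumes "i < size"
  shows "vertex_at i \<in> vertices" "index (vertex_at i) = i"
proof -
  have "vertex_at i \<in> vertices \<and> index (vertex_at i) = i"
  proof (cases "i < base")
    case True
    define y m r where "y = i div 4 div M" and "m = i div 4 mod M" and "r = i mod 4"
    have "i div 4 < ny * M" using True by (simp add: base_def less_mult_imp_div_less mult.commute)
    then have "y < ny" "m < M" "r < 4" "i = 4 * (y * M + m) + r"
      using M_ge by (auto simp: y_def m_def r_def less_mult_imp_div_less)
    moreover have "vertex_at i = (if r = 0 then Hub y m else if r = 1 then Mid y m else if r = 2 then Leaf y m else Pendant y m)"
      using True by (simp add: vertex_at_def y_def m_def r_def Let_def)
    ultimately show ?thesis by (auto simp: vertices_def)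
  next
    case False
    define d r where "d = (i - base) div 10" and "r = (i - base) mod 10"
    have "i - base < nd * 10" using False assms by (simp add: size_def)
    then have "d < nd" "r < 10" by (auto simp: d_def r_def less_mult_imp_div_less)
    moreover have "i = base + (10 * d + r)" using False by (simp add: d_def r_def)
    moreover have "vertex_at i = (if r = 0 then Center d else if r < 4 then Link d (r - 1)
        else if r < 7 then Tip d (r - 4) else Corner d (r - 7))"
      using False by (simp add: vertex_at_def d_def r_def Let_def)
    ultimately show ?thesis by (auto simp: vertices_def)
  qed
  then show "vertex_at i \<in> vertices" "index (vertex_at i) = i" by auto
qed

lemma arc_vertices: "arc u v \<Longrightarrow> u \<in> vertices \<and> v \<in> vertices \<and> u \<noteq> v"
  unfolding arc_def vertices_def
  using next_prev(1,4) port_in by fastforce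

definition graph :: "nat graph" where
  "graph = \<lparr>verts = {..<size}, edges = {{index u, index v} | u v. arc u v}\<rparr>"

lemma index_eq: "u \<in> vertices \<Longrightarrow> v \<in> vertices \<Longrightarrow> index u = index v \<longleftrightarrow> u = v"
  using vertex_at_index(1) by metis

lemma standard: "standard_graph graph"
  unfolding standard_graph_def simple_graph_def
  using vertex_at_index(2) arc_vertices index_eq by (auto simp: graph_def card_insert_if)

lemma neighbors_index:
  assumes "v \<in> vertices"
  shows "neighbors graph (index v) = index ` nb v"
proof
  show "neighbors graph (index v) \<subseteq> index ` nb v"
  proof
    fix j assume "j \<in> neighbors graph (index v)"
    then obtain u u' where u: "arc u u'" "{j, index v} = {index u, index u'}"
      unfolding neighbors_def graph_def by auto
    from u(2) have "j = index u \<and> index v = index u' \<or> j = index u' \<and> index v = index u"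
      by (auto simp: doubleton_eq_iff)
    with arc_vertices[OF u(1)] assms index_eq have "j = index u \<and> v = u' \<or> j = index u' \<and> v = u" by blast
    then show "j \<in> index ` nb v" using u(1) unfolding nb_def by blast
  qed
  show "index ` nb v \<subseteq> neighbors graph (index v)"
    using vertex_at_index(2) arc_vertices unfolding nb_def neighbors_def graph_def
    by (fastforce simp: insert_commute)
qed

lemma nb_vertices: "nb v \<subseteq> vertices"
  using arc_vertices unfolding nb_def by blast

lemma vertex_degree_index:
  assumes "v \<in> vertices"
  shows "vertex_degree graph (index v) = card (nb v)"
  unfolding vertex_degree_def neighbors_index[OF assms]
  using nb_vertices[of v] index_eq by (intro card_image inj_onI) blast

lemma verts_graph: "verts graph = index ` vertices"
  using index_vertex_at vertex_at_index(2) by (force simp: graph_def image_iff)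

lemma graph_instance: "graph \<in> instances"
proof -
  have "finite (verts graph)" by (simp add: graph_def)
  note iff = instance_iff[OF this]
  have "Center 0 \<in> vertices" using nd by (auto simp: vertices_def)
  moreover have "card (nb (Center 0)) = 3"
    using distinct_ports[OF nd] by (simp add: nb_Center[OF nd] card_insert_if)
  ultimately have "\<exists>v\<in>verts graph. vertex_degree graph v = 3"
    unfolding verts_graph using vertex_degree_index by force
  moreover have "\<forall>v\<in>verts graph. vertex_degree graph v = 1 \<or> vertex_degree graph v = 3"
    unfolding verts_graph using vertex_degree_index card_nb by simp
  ultimately show ?thesis using iff standard by simp
qed

lemma graph_balanced_iff:
  assumes "two_partition graph f"
  shows "locally_balanced_closed graph f \<longleftrightarrow> balanced (\<lambda>v. f (index v) = 1)"
proof -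
  have f: "f (index v) = 0 \<or> f (index v) = 1" if "v \<in> vertices" for v
    using assms that verts_graph unfolding two_partition_def by auto
  have "card {u \<in> neighbors graph (index v). f u = f (index v)}
      = card {u \<in> nb v. (f (index u) = 1) = (f (index v) = 1)}" if v: "v \<in> vertices" for v
  proof -
    have "{u \<in> neighbors graph (index v). f u = f (index v)} = index ` {u \<in> nb v. (f (index u) = 1) = (f (index v) = 1)}"
      unfolding neighbors_index[OF v] using f[OF v] f nb_vertices[of v] by fastforce
    moreover have "inj_on index {u \<in> nb v. (f (index u) = 1) = (f (index v) = 1)}"
      using nb_vertices[of v] index_eq by (intro inj_onI) blast
    ultimately show ?thesis by (simp add: card_image)
  qed
  moreover have "simple_graph graph" "odd_graph graph"
    using standard graph_instance unfolding standard_graph_def by auto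
  ultimately show ?thesis
    unfolding balanced_iff[OF \<open>simple_graph graph\<close> \<open>odd_graph graph\<close> assms] balanced_def fair_def verts_graph
    by (simp add: vertex_degree_index)
qed

theorem graph_correct: "(\<exists>f. locally_balanced_closed graph f) \<longleftrightarrow> (\<exists>\<alpha>. satisfies \<alpha>)"
proof
  assume "\<exists>f. locally_balanced_closed graph f"
  then obtain f where f: "locally_balanced_closed graph f" by blast
  then have "two_partition graph f" unfolding locally_balanced_closed_def by blast
  from graph_balanced_iff[OF this] f balanced_imp_satisfies show "\<exists>\<alpha>. satisfies \<alpha>" by blast
next
  assume "\<exists>\<alpha>. satisfies \<alpha>"
  then obtain \<alpha> where \<alpha>: "satisfies \<alpha>" by blast
  define f where "f i = (if coloring \<alpha> (vertex_at i) then 1 else 0 :: nat)" for i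
  have "two_partition graph f" by (simp add: two_partition_def f_def)
  moreover have "balanced (\<lambda>v. f (index v) = 1)"
    using satisfies_imp_balanced[OF \<alpha>] nb_vertices unfolding balanced_def
  proof -
    assume bal: "\<forall>v\<in>vertices. fair (coloring \<alpha>) v"
    have "{u \<in> nb v. (f (index u) = 1) = (f (index v) = 1)} = {u \<in> nb v. coloring \<alpha> u = coloring \<alpha> v}"
      if "v \<in> vertices" for v
      using nb_vertices[of v] that by (auto simp: f_def vertex_at_index(1))
    with bal show "\<forall>v\<in>vertices. fair (\<lambda>v. f (index v) = 1) v" by (simp add: fair_def)
  qed
  ultimately show "\<exists>f. locally_balanced_closed graph f" using graph_balanced_iff by blast
qed

definition arc_at :: "nat \<Rightarrow> nat \<Rightarrow> bool" where
  "arc_at i j \<longleftrightarrow> (\<exists>u v. arc u v \<and> i = index u \<and> j = index v)"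

lemma edges_graph: "{i, j} \<in> edges graph \<longleftrightarrow> arc_at i j \<or> arc_at j i"
  unfolding graph_def arc_at_def by (auto simp: doubleton_eq_iff)

text \<open>The form to be transcribed into an expression: bounded quantifiers over equations. Only
  the relation \<open>ly d k = y \<and> ls d k = s\<close> will be expressible, not
  \<open>ly\<close> and \<open>ls\<close> as functions, so ports are described with quantified
  \<open>y\<close> and \<open>s\<close>; \<open>next_slot\<close> is likewise unfolded into a
  relation.\<close>

lemma arc_at_iff:
  "arc_at i j \<longleftrightarrow>
    (\<exists>y<ny. \<exists>m<M. i = 4 * (y * M + m) + 1 \<and> j = 4 * (y * M + m) \<or>
       i = 4 * (y * M + m) + 1 \<and> (\<exists>m'<M. (m' = m + 1 \<or> m + 1 = M \<and> m' = 0) \<and> j = 4 * (y * M + m')) \<or>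
       i = 4 * (y * M + m) + 1 \<and> j = 4 * (y * M + m) + 2 \<or>
       i = 4 * (y * M + m) \<and> j = 4 * (y * M + m) + 3) \<or>
    (\<exists>d<nd. \<exists>k<3. (\<exists>y<ny. \<exists>s<2. ly d k = y \<and> ls d k = s \<and> i = 4 * (y * M + (6 * d + 2 * k + s)) + 3 \<and>
         (j = 4 * (ny * M) + 10 * d \<or> j = 4 * (ny * M) + 10 * d + 1 + k)) \<or>
       i = 4 * (ny * M) + 10 * d + 1 + k \<and> (j = 4 * (ny * M) + 10 * d + 4 + k \<or> j = 4 * (ny * M) + 10 * d + 7 + k) \<or>
       (\<exists>k'<3. k' \<noteq> k \<and> i = 4 * (ny * M) + 10 * d + 7 + k \<and> j = 4 * (ny * M) + 10 * d + 7 + k'))"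
  (is "_ \<longleftrightarrow> ?ring \<or> ?clause")
proof -
  have next_iff: "(m' = m + 1 \<or> m + 1 = M \<and> m' = 0) \<and> m' < M \<longleftrightarrow> m' = next_slot m" if "m < M" for m m'
    using that by (auto simp: next_slot_def)
  have ring: "?ring \<longleftrightarrow> (\<exists>u v. (\<exists>y<ny. \<exists>m<M. u = Mid y m \<and> v = Hub y m \<or> u = Mid y m \<and> v = Hub y (next_slot m) \<or>
       u = Mid y m \<and> v = Leaf y m \<or> u = Hub y m \<and> v = Pendant y m) \<and> i = index u \<and> j = index v)" (is "_ \<longleftrightarrow> ?ring'")
  proof -
    have "(\<exists>m'<M. (m' = m + 1 \<or> m + 1 = M \<and> m' = 0) \<and> j = 4 * (y * M + m')) \<longleftrightarrow> j = 4 * (y * M + next_slot m)"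
      if "m < M" for y m
    proof -
      have "(\<exists>m'<M. (m' = m + 1 \<or> m + 1 = M \<and> m' = 0) \<and> j = 4 * (y * M + m')) \<longleftrightarrow>
          (\<exists>m'. ((m' = m + 1 \<or> m + 1 = M \<and> m' = 0) \<and> m' < M) \<and> j = 4 * (y * M + m'))" by blast
      also have "\<dots> \<longleftrightarrow> j = 4 * (y * M + next_slot m)" unfolding next_iff[OF that] by blast
      finally show ?thesis .
    qed
    then have "?ring \<longleftrightarrow> (\<exists>y<ny. \<exists>m<M. i = index (Mid y m) \<and> j = index (Hub y m) \<or>
       i = index (Mid y m) \<and> j = index (Hub y (next_slot m)) \<or>
       i = index (Mid y m) \<and> j = index (Leaf y m) \<or> i = index (Hub y m) \<and> j = index (Pendant y m))"
      by (simp cong: conj_cong)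
    also have "\<dots> \<longleftrightarrow> ?ring'" by blast
    finally show ?thesis .
  qed
  have clause: "?clause \<longleftrightarrow> (\<exists>u v. (\<exists>d<nd. \<exists>k<3. u = port d k \<and> v = Center d \<or> u = port d k \<and> v = Link d k \<or>
       u = Link d k \<and> v = Tip d k \<or> u = Link d k \<and> v = Corner d k \<or>
       (\<exists>k'<3. k' \<noteq> k \<and> u = Corner d k \<and> v = Corner d k')) \<and> i = index u \<and> j = index v)" (is "_ \<longleftrightarrow> ?clause'")
  proof -
    have "(\<exists>y<ny. \<exists>s<2. ly d k = y \<and> ls d k = s \<and> i = 4 * (y * M + (6 * d + 2 * k + s)) + 3 \<and> Q)
        \<longleftrightarrow> i = index (port d k) \<and> Q" if "d < nd" "k < 3" for d k Q
      using ly[OF that] ls[OF that] by (auto simp: slot_def)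
    then have "?clause \<longleftrightarrow> (\<exists>d<nd. \<exists>k<3. i = index (port d k) \<and> (j = index (Center d) \<or> j = index (Link d k)) \<or>
       i = index (Link d k) \<and> (j = index (Tip d k) \<or> j = index (Corner d k)) \<or>
       (\<exists>k'<3. k' \<noteq> k \<and> i = index (Corner d k) \<and> j = index (Corner d k')))"
      by (simp add: base_def cong: conj_cong)
    also have "\<dots> \<longleftrightarrow> ?clause'" by blast
    finally show ?thesis .
  qed
  show ?thesis unfolding arc_at_def arc_def ring clause
    by (simp only: conj_disj_distribR ex_disj_distrib)
qed

end

section \<open>From clauses of unbounded width to not-all-equal constraints\<close>

text \<open>Variable 0 stands for truth.\<close>

definition cnf_satisfiable ::
  "nat \<Rightarrow> nat \<Rightarrow> (nat \<Rightarrow> nat \<Rightarrow> bool) \<Rightarrow> (nat \<Rightarrow> nat \<Rightarrow> bool) \<Rightarrow> bool" where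
  "cnf_satisfiable nv nc pos neg \<longleftrightarrow>
     (\<exists>\<alpha>. \<alpha> 0 \<and> (\<forall>c<nc. \<exists>x<nv. pos c x \<and> \<alpha> x \<or> neg c x \<and> \<not> \<alpha> x))"

locale cnf =
  fixes nv nc :: nat and pos neg :: "nat \<Rightarrow> nat \<Rightarrow> bool"
  assumes nv: "nv > 0" and nc: "nc > 0"
begin

text \<open>The variables \<open>z c 0, \<dots>, z c nv\<close> start out true, end up false,
  and may change only at a true literal of clause \<open>c\<close>.\<close>

definition z :: "nat \<Rightarrow> nat \<Rightarrow> nat" where "z c j = nv + (c * (nv + 1) + j)"

text \<open>Constraint \<open>j < nv\<close> has the literals: not \<open>z c j\<close>, a middle
  one, and \<open>z c (j + 1)\<close>. If the chain drops at \<open>j\<close>, the outer two are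
  both false and the middle one must be true. It is the literal of variable \<open>j\<close> in the
  clause; if there is none it repeats the third, forbidding any change, and if both signs occur it
  negates the third, allowing everything. The constraints \<open>nv\<close> and
  \<open>nv + 1\<close> repeat a literal of variable 0 to fix the two ends of the chain.\<close>

definition lit :: "nat \<Rightarrow> nat \<Rightarrow> nat \<Rightarrow> nat \<times> nat" where
  "lit c j k =
    (if j < nv then
       if k = 0 then (z c j, 1)
       else if k = 1 then
         if pos c j then if neg c j then (z c (j + 1), 1) else (j, 0)
         else if neg c j then (j, 1) else (z c (j + 1), 0)
       else (z c (j + 1), 0)
     else if j = nv then if k = 0 then (z c 0, 0) else (0, 1)
     else if k = 0 then (z c nv, 0) else (0, 0))"

definition ny :: nat where "ny = nv + nc * (nv + 1)"
definition nd :: nat where "nd = nc * (nv + 2)"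
definition ly :: "nat \<Rightarrow> nat \<Rightarrow> nat" where "ly d k = fst (lit (d div (nv + 2)) (d mod (nv + 2)) k)"
definition ls :: "nat \<Rightarrow> nat \<Rightarrow> nat" where "ls d k = snd (lit (d div (nv + 2)) (d mod (nv + 2)) k)"

lemma z_less: "c < nc \<Longrightarrow> j \<le> nv \<Longrightarrow> z c j < ny"
proof -
  assume "c < nc" "j \<le> nv"
  then have "c * (nv + 1) + j < Suc c * (nv + 1)" by simp
  also have "\<dots> \<le> nc * (nv + 1)" using \<open>c < nc\<close> by (intro mult_le_mono1) simp
  finally show ?thesis by (simp add: z_def ny_def)
qed

lemma d_iff: "d < nd \<Longrightarrow> d div (nv + 2) < nc \<and> d mod (nv + 2) < nv + 2"
  by (simp add: nd_def less_mult_imp_div_less)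

lemma d_eq: "c < nc \<Longrightarrow> j < nv + 2 \<Longrightarrow> c * (nv + 2) + j < nd \<and>
    (c * (nv + 2) + j) div (nv + 2) = c \<and> (c * (nv + 2) + j) mod (nv + 2) = j"
proof -
  assume "c < nc" "j < nv + 2"
  then have "c * (nv + 2) + j < Suc c * (nv + 2)" by simp
  also have "\<dots> \<le> nc * (nv + 2)" using \<open>c < nc\<close> by (intro mult_le_mono1) simp
  finally show ?thesis using \<open>j < nv + 2\<close> unfolding nd_def
    by (metis add.commute add_cancel_right_right div_less div_mult_self3 mod_less mod_mult_self3 add_2_eq_Suc' nat.distinct(1))
qed

sublocale nae ny nd ly ls
proof
  show "nd > 0" using nc by (simp add: nd_def)
  fix d k assume d: "d < nd" and "k < (3 :: nat)"
  have *: "fst (lit c j k) < ny \<and> snd (lit c j k) < 2" if "c < nc" "j < nv + 2" for c j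
  proof -
    have "nv \<le> ny" by (simp add: ny_def)
    then show ?thesis
      using z_less[OF that(1), of j] z_less[OF that(1), of "j + 1"] z_less[OF that(1), of 0]
        z_less[OF that(1), of nv] nv
      by (auto simp: lit_def)
  qed
  show "ly d k < ny" "ls d k < 2" unfolding ly_def ls_def using *[of "d div (nv + 2)" "d mod (nv + 2)"] d_iff[OF d] by auto
qed

definition truth :: "(nat \<Rightarrow> bool) \<Rightarrow> nat \<Rightarrow> nat \<Rightarrow> nat \<Rightarrow> bool" where
  "truth \<beta> c j k \<longleftrightarrow> \<beta> (fst (lit c j k)) \<noteq> (snd (lit c j k) = 1)"

lemma satisfies_iff:
  "satisfies \<beta> \<longleftrightarrow> (\<forall>c<nc. \<forall>j<nv + 2. truth \<beta> c j 0 \<noteq> truth \<beta> c j 1 \<or> truth \<beta> c j 0 \<noteq> truth \<beta> c j 2)"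
proof -
  have "(\<exists>k<3. Q k) \<longleftrightarrow> Q 0 \<or> Q 1 \<or> Q (2 :: nat)" for Q by (auto simp: less_three)
  then have ex: "(\<exists>k<3. \<exists>k'<3. f k \<noteq> f k') \<longleftrightarrow> f 0 \<noteq> f 1 \<or> f 0 \<noteq> f (2 :: nat)" for f :: "nat \<Rightarrow> bool"
    by auto
  have "satisfies \<beta> \<longleftrightarrow> (\<forall>d<nd. truth \<beta> (d div (nv + 2)) (d mod (nv + 2)) 0 \<noteq> truth \<beta> (d div (nv + 2)) (d mod (nv + 2)) 1 \<or>
      truth \<beta> (d div (nv + 2)) (d mod (nv + 2)) 0 \<noteq> truth \<beta> (d div (nv + 2)) (d mod (nv + 2)) 2)"
    unfolding satisfies_def ly_def ls_def truth_def[symmetric] ex ..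
  also have "\<dots> \<longleftrightarrow> (\<forall>c<nc. \<forall>j<nv + 2. truth \<beta> c j 0 \<noteq> truth \<beta> c j 1 \<or> truth \<beta> c j 0 \<noteq> truth \<beta> c j 2)"
    using d_iff d_eq by metis
  finally show ?thesis .
qed

text \<open>Not-all-equal constraints do not distinguish \<open>\<beta>\<close> from its complement,
  so values are read relative to \<open>\<beta> 0\<close>.\<close>

lemma satisfiable_imp: 
  assumes "satisfies \<beta>"
  shows "cnf_satisfiable nv nc pos neg"
  unfolding cnf_satisfiable_def
proof (intro exI[of _ "\<lambda>x. \<beta> x = \<beta> 0"] conjI allI impI)
  fix c assume c: "c < nc"
  have sat: "truth \<beta> c j 0 \<noteq> truth \<beta> c j 1 \<or> truth \<beta> c j 0 \<noteq> truth \<beta> c j 2" if "j < nv + 2" for j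
    using assms c that unfolding satisfies_iff by blast
  have start: "\<beta> (z c 0) = \<beta> 0"
    using sat[of nv] by (auto simp: truth_def lit_def)
  have stop: "\<beta> (z c nv) \<noteq> \<beta> 0"
    using sat[of "nv + 1"] by (auto simp: truth_def lit_def)
  have "\<exists>j<nv. \<beta> (z c j) = \<beta> 0 \<and> \<beta> (z c (j + 1)) \<noteq> \<beta> 0"
  proof (rule ccontr)
    assume no: "\<not> ?thesis"
    have "j \<le> nv \<Longrightarrow> \<beta> (z c j) = \<beta> 0" for j
    proof (induction j)
      case (Suc j)
      then show ?case using no by (metis Suc_eq_plus1 Suc_le_eq less_imp_le)
    qed (use start in simp)
    with stop show False by simp
  qed
  then obtain j where j: "j < nv" "\<beta> (z c j) = \<beta> 0" "\<beta> (z c (j + 1)) \<noteq> \<beta> 0" by blast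
  have "pos c j \<and> \<beta> j = \<beta> 0 \<or> neg c j \<and> \<not> \<beta> j = \<beta> 0"
  proof -
    have "truth \<beta> c j 0 \<longleftrightarrow> \<not> \<beta> (z c j)" "truth \<beta> c j 2 \<longleftrightarrow> \<beta> (z c (j + 1))"
      "truth \<beta> c j 1 \<longleftrightarrow> (if pos c j then if neg c j then \<not> \<beta> (z c (j + 1)) else \<beta> j
        else if neg c j then \<not> \<beta> j else \<beta> (z c (j + 1)))"
      using j(1) by (simp_all add: truth_def lit_def)
    moreover have "truth \<beta> c j 0 \<noteq> truth \<beta> c j 1 \<or> truth \<beta> c j 0 \<noteq> truth \<beta> c j 2"
      using sat j(1) by simp
    ultimately show ?thesis using j(2,3) by argo
  qed
  then show "\<exists>x<nv. pos c x \<and> \<beta> x = \<beta> 0 \<or> neg c x \<and> \<not> \<beta> x = \<beta> 0" using j(1) by blast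
qed simp

lemma satisfiable_conv:
  assumes "cnf_satisfiable nv nc pos neg"
  shows "\<exists>\<beta>. satisfies \<beta>"
proof -
  obtain \<alpha> where \<alpha>: "\<alpha> 0" "\<And>c. c < nc \<Longrightarrow> \<exists>x<nv. pos c x \<and> \<alpha> x \<or> neg c x \<and> \<not> \<alpha> x"
    using assms unfolding cnf_satisfiable_def by blast
  then obtain g where g: "\<And>c. c < nc \<Longrightarrow> g c < nv \<and> (pos c (g c) \<and> \<alpha> (g c) \<or> neg c (g c) \<and> \<not> \<alpha> (g c))"
    by metis
  \<comment> \<open>The chain of clause \<open>c\<close> is true up to index \<open>g c\<close>, a
    variable with a true literal, so it drops exactly there.\<close>
  define \<beta> where "\<beta> = (\<lambda>y. if y < nv then \<alpha> y else (y - nv) mod (nv + 1) \<le> g ((y - nv) div (nv + 1)))"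
  have var: "\<beta> x = \<alpha> x" if "x < nv" for x using that by (simp add: \<beta>_def)
  have z: "\<beta> (z c j) \<longleftrightarrow> j \<le> g c" if "j \<le> nv" for c j
  proof -
    have "(c * (nv + 1) + j) mod (nv + 1) = j" "(c * (nv + 1) + j) div (nv + 1) = c"
      using that by (simp_all only: mod_mult_self3 div_mult_self3) simp_all
    then show ?thesis by (simp add: \<beta>_def z_def)
  qed
  have "truth \<beta> c j 0 \<noteq> truth \<beta> c j 1 \<or> truth \<beta> c j 0 \<noteq> truth \<beta> c j 2" if c: "c < nc" and j: "j < nv + 2" for c j
  proof -
    consider "j < nv" "j \<noteq> g c" | "j = g c" "j < nv" | "j = nv" | "j = nv + 1" using j by linarith
    then show ?thesis
    proof cases
      case 1
      then show ?thesis using z[of j c] z[of "j + 1" c] by (auto simp: truth_def lit_def)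
    next
      case 2
      then show ?thesis using z[of j c] z[of "j + 1" c] g[OF c] var[of j]
        by (auto simp: truth_def lit_def split: if_splits)
    next
      case 3
      then show ?thesis using z[of 0 c] var[of 0] nv \<alpha>(1) by (auto simp: truth_def lit_def)
    next
      case 4
      then show ?thesis using z[of nv c] var[of 0] nv \<alpha>(1) g[OF c] by (auto simp: truth_def lit_def)
    qed
  qed
  then show ?thesis unfolding satisfies_iff by blast
qed

text \<open>Replaces \<open>div\<close>, \<open>mod\<close> and the nested conditionals of
  \<open>lit\<close> by a bounded formula, the model for the expression \<open>LIT\<close>.\<close>

lemma literal_iff:
  assumes "d < nd" "k < 3"
  shows "ly d k = y \<and> ls d k = s \<longleftrightarrow> (\<exists>c<nc. \<exists>j<nv + 2. d = c * (nv + 2) + j \<and>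
    (j < nv \<and> (k = 0 \<and> y = nv + (c * (nv + 1) + j) \<and> s = 1 \<or>
       k = 1 \<and> (pos c j \<and> neg c j \<and> y = nv + (c * (nv + 1) + (j + 1)) \<and> s = 1 \<or> pos c j \<and> \<not> neg c j \<and> y = j \<and> s = 0 \<or> \<not> pos c j \<and> neg c j \<and> y = j \<and> s = 1 \<or>
         \<not> pos c j \<and> \<not> neg c j \<and> y = nv + (c * (nv + 1) + (j + 1)) \<and> s = 0) \<or>
       k = 2 \<and> y = nv + (c * (nv + 1) + (j + 1)) \<and> s = 0) \<or>
     j = nv \<and> (k = 0 \<and> y = nv + (c * (nv + 1)) \<and> s = 0 \<or> 0 < k \<and> y = 0 \<and> s = 1) \<or>
     j = nv + 1 \<and> (k = 0 \<and> y = nv + (c * (nv + 1) + nv) \<and> s = 0 \<or> 0 < k \<and> y = 0 \<and> s = 0)))"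
    (is "_ \<longleftrightarrow> (\<exists>c<nc. \<exists>j<nv + 2. d = c * (nv + 2) + j \<and> ?P c j)")
proof -
  have P: "lit c j k = (y, s) \<longleftrightarrow> ?P c j" if "j < nv + 2" for c j
  proof -
    have "k = 0 \<or> k = 1 \<or> k = 2" using assms(2) by auto
    moreover have "j < nv \<or> j = nv \<or> j = nv + 1" using that by linarith
    ultimately show ?thesis by (elim disjE) (auto simp: lit_def z_def)
  qed
  have "ly d k = y \<and> ls d k = s \<longleftrightarrow> lit (d div (nv + 2)) (d mod (nv + 2)) k = (y, s)"
    unfolding ly_def ls_def by (simp add: prod_eq_iff)
  also have "\<dots> \<longleftrightarrow> (\<exists>c<nc. \<exists>j<nv + 2. d = c * (nv + 2) + j \<and> lit c j k = (y, s))"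
    using d_iff[OF assms(1)] d_eq div_mult_mod_eq by metis
  finally show ?thesis using P by (auto cong: conj_cong)
qed

end

section \<open>The adjacency matrix as an expression\<close>

instantiation exp :: "{plus, times}"
begin
definition "a + b = Add a b"
definition "a * b = Mult a b"
instance ..
end

lemma eval_plus_times [simp]:
  "eval I (a + b) \<sigma> = eval I a \<sigma> + eval I b \<sigma>"
  "eval I (a * b) \<sigma> = eval I a \<sigma> * eval I b \<sigma>"
  by (simp_all add: plus_exp_def times_exp_def)

definition "Conjs es = foldr Conj es (Const 1)"
definition "Disjs es = foldr Disj es (Const 0)"

lemma holds_Conjs [simp]: "holds I (Conjs es) \<sigma> \<longleftrightarrow> (\<forall>e\<in>set es. holds I e \<sigma>)"
  by (induction es) (auto simp: Conjs_def)

lemma holds_Disjs [simp]: "holds I (Disjs es) \<sigma> \<longleftrightarrow> (\<exists>e\<in>set es. holds I e \<sigma>)"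
  by (induction es) (auto simp: Disjs_def)

text \<open>The equations are required under every assignment of the input length to variable 0, so
  these expressions may be placed below any of the quantifiers used later.\<close>

locale cnf_expressions =
  fixes NV NC POS NEG :: exp
    and nv nc :: "bool list \<Rightarrow> nat" and pos neg :: "bool list \<Rightarrow> nat \<Rightarrow> nat \<Rightarrow> bool"
  assumes NV: "\<And>w \<sigma>. \<sigma> 0 = length w \<Longrightarrow> eval (input w []) NV \<sigma> = nv w"
    and NC: "\<And>w \<sigma>. \<sigma> 0 = length w \<Longrightarrow> eval (input w []) NC \<sigma> = nc w"
    and POS: "\<And>w \<sigma>. \<sigma> 0 = length w \<Longrightarrow> holds (input w []) POS \<sigma> \<longleftrightarrow> pos w (\<sigma> 10) (\<sigma> 11)"
    and NEG: "\<And>w \<sigma>. \<sigma> 0 = length w \<Longrightarrow> holds (input w []) NEG \<sigma> \<longleftrightarrow> neg w (\<sigma> 10) (\<sigma> 11)"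
    and nv: "\<And>w. nv w > 0" and nc: "\<And>w. nc w > 0"
begin

definition NY :: exp where "NY = NV + NC * (NV + Const 1)"
definition ND :: exp where "ND = NC * (NV + Const 2)"
definition MM :: exp where "MM = Const 6 * ND"
definition BASE :: exp where "BASE = Const 4 * (NY * MM)"
definition SIZE :: exp where "SIZE = BASE + Const 10 * ND"

text \<open>Expression variables: 2 and 3 are vertices; 4 to 9 are the bound variables of
  \<open>arc_at_iff\<close>; 10 is a clause and 11 a variable of the clause set.\<close>

definition LIT :: exp where
  "LIT = Exists 10 NC (Exists 11 (NV + Const 2) (Conj (Equal (Var 7) (Var 10 * (NV + Const 2) + Var 11))
     (Disjs [Conj (Less (Var 11) NV) (Disjs
        [Conjs [Equal (Var 8) (Const 0), Equal (Var 4) (NV + (Var 10 * (NV + Const 1) + Var 11)), Equal (Var 9) (Const 1)],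
         Conj (Equal (Var 8) (Const 1)) (Disjs
           [Conjs [POS, NEG, Equal (Var 4) (NV + (Var 10 * (NV + Const 1) + (Var 11 + Const 1))), Equal (Var 9) (Const 1)],
            Conjs [POS, Neg NEG, Equal (Var 4) (Var 11), Equal (Var 9) (Const 0)],
            Conjs [Neg POS, NEG, Equal (Var 4) (Var 11), Equal (Var 9) (Const 1)],
            Conjs [Neg POS, Neg NEG, Equal (Var 4) (NV + (Var 10 * (NV + Const 1) + (Var 11 + Const 1))), Equal (Var 9) (Const 0)]]),
         Conjs [Equal (Var 8) (Const 2), Equal (Var 4) (NV + (Var 10 * (NV + Const 1) + (Var 11 + Const 1))), Equal (Var 9) (Const 0)]]),
      Conj (Equal (Var 11) NV) (Disjs
        [Conjs [Equal (Var 8) (Const 0), Equal (Var 4) (NV + (Var 10 * (NV + Const 1))), Equal (Var 9) (Const 0)],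
         Conjs [Less (Const 0) (Var 8), Equal (Var 4) (Const 0), Equal (Var 9) (Const 1)]]),
      Conj (Equal (Var 11) (NV + Const 1)) (Disjs
        [Conjs [Equal (Var 8) (Const 0), Equal (Var 4) (NV + (Var 10 * (NV + Const 1) + NV)), Equal (Var 9) (Const 0)],
         Conjs [Less (Const 0) (Var 8), Equal (Var 4) (Const 0), Equal (Var 9) (Const 0)]])])))"

definition ARC :: "nat \<Rightarrow> nat \<Rightarrow> exp" where
  "ARC a b = Disj
     (Exists 4 NY (Exists 5 MM (Disjs
       [Conj (Equal (Var a) (Const 4 * (Var 4 * MM + Var 5) + Const 1)) (Equal (Var b) (Const 4 * (Var 4 * MM + Var 5))),
        Conj (Equal (Var a) (Const 4 * (Var 4 * MM + Var 5) + Const 1))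
          (Exists 6 MM (Conj (Disj (Equal (Var 6) (Var 5 + Const 1)) (Conj (Equal (Var 5 + Const 1) MM) (Equal (Var 6) (Const 0))))
             (Equal (Var b) (Const 4 * (Var 4 * MM + Var 6))))),
        Conj (Equal (Var a) (Const 4 * (Var 4 * MM + Var 5) + Const 1)) (Equal (Var b) (Const 4 * (Var 4 * MM + Var 5) + Const 2)),
        Conj (Equal (Var a) (Const 4 * (Var 4 * MM + Var 5))) (Equal (Var b) (Const 4 * (Var 4 * MM + Var 5) + Const 3))])))
     (Exists 7 ND (Exists 8 (Const 3) (Disjs
       [Exists 4 NY (Exists 9 (Const 2) (Conjs [LIT,
          Equal (Var a) (Const 4 * (Var 4 * MM + (Const 6 * Var 7 + Const 2 * Var 8 + Var 9)) + Const 3),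
          Disj (Equal (Var b) (Const 4 * (NY * MM) + Const 10 * Var 7)) (Equal (Var b) (Const 4 * (NY * MM) + Const 10 * Var 7 + Const 1 + Var 8))])),
        Conj (Equal (Var a) (Const 4 * (NY * MM) + Const 10 * Var 7 + Const 1 + Var 8))
          (Disj (Equal (Var b) (Const 4 * (NY * MM) + Const 10 * Var 7 + Const 4 + Var 8)) (Equal (Var b) (Const 4 * (NY * MM) + Const 10 * Var 7 + Const 7 + Var 8))),
        Exists 6 (Const 3) (Conjs [Neg (Equal (Var 6) (Var 8)),
          Equal (Var a) (Const 4 * (NY * MM) + Const 10 * Var 7 + Const 7 + Var 8),
          Equal (Var b) (Const 4 * (NY * MM) + Const 10 * Var 7 + Const 7 + Var 6)])])))"

text \<open>Variable 1 is the position in the output word; row and column are found by search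
  instead of division.\<close>

definition BIT :: exp where
  "BIT = Exists 2 SIZE (Exists 3 SIZE (Conj (Equal (Var 1) (Var 2 * SIZE + Var 3)) (Disj (ARC 2 3) (ARC 3 2))))"

context
  fixes w :: "bool list"
begin

interpretation cnf "nv w" "nc w" "pos w" "neg w"
  by unfold_locales (rule nv nc)+

lemma eval_sizes:
  assumes "\<sigma> 0 = length w"
  shows "eval (input w []) NY \<sigma> = ny" "eval (input w []) ND \<sigma> = nd" "eval (input w []) MM \<sigma> = M"
    "eval (input w []) SIZE \<sigma> = size"
proof -
  note NV = NV[of \<sigma>, OF assms] and NC = NC[of \<sigma>, OF assms]
  show ny: "eval (input w []) NY \<sigma> = ny"
    by (simp only: NY_def ny_def eval_plus_times eval.simps NV NC)
  show nd: "eval (input w []) ND \<sigma> = nd"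
    by (simp only: ND_def nd_def eval_plus_times eval.simps NV NC)
  show "eval (input w []) MM \<sigma> = M" "eval (input w []) SIZE \<sigma> = size"
    by (simp_all only: MM_def M_def SIZE_def size_def BASE_def base_def eval_plus_times eval.simps ny nd)
qed

lemma holds_LIT:
  assumes "\<sigma> 0 = length w" "\<sigma> 7 < nd" "\<sigma> 8 < 3"
  shows "holds (input w []) LIT \<sigma> \<longleftrightarrow> ly (\<sigma> 7) (\<sigma> 8) = \<sigma> 4 \<and> ls (\<sigma> 7) (\<sigma> 8) = \<sigma> 9"
  unfolding literal_iff[OF assms(2,3)] LIT_def
  using assms(1) by (simp add: NV NC POS NEG)

text \<open>The vertices sit in variables 2 and 3, which none of the quantifiers in
  \<open>ARC\<close> and \<open>LIT\<close> binds.\<close>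

lemma holds_ARC:
  assumes "\<sigma> 0 = length w" "(a, b) = (2, 3) \<or> (a, b) = (3, 2)"
  shows "holds (input w []) (ARC a b) \<sigma> \<longleftrightarrow> arc_at (\<sigma> a) (\<sigma> b)"
  unfolding arc_at_iff ARC_def
  using assms by (elim disjE) (simp_all add: eval_sizes holds_LIT cong: conj_cong)

lemma holds_BIT:
  assumes "j < size * size"
  shows "holds (input w []) BIT (env (length w) j) \<longleftrightarrow> {j div size, j mod size} \<in> edges graph"
proof -
  have "size > 0" using assms by (cases size) auto
  have "holds (input w []) BIT (env (length w) j) \<longleftrightarrow>
      (\<exists>a<size. \<exists>b<size. j = a * size + b \<and> (arc_at a b \<or> arc_at b a))"
    unfolding BIT_def by (simp add: env_def eval_sizes holds_ARC cong: conj_cong)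
  also have "\<dots> \<longleftrightarrow> arc_at (j div size) (j mod size) \<or> arc_at (j mod size) (j div size)"
  proof
    assume "\<exists>a<size. \<exists>b<size. j = a * size + b \<and> (arc_at a b \<or> arc_at b a)"
    then obtain a b where ab: "b < size" "j = a * size + b" "arc_at a b \<or> arc_at b a" by blast
    then have "j div size = a" "j mod size = b" by simp_all
    with ab(3) show "arc_at (j div size) (j mod size) \<or> arc_at (j mod size) (j div size)" by simp
  next
    assume "arc_at (j div size) (j mod size) \<or> arc_at (j mod size) (j div size)"
    moreover have "j div size < size" "j mod size < size"
      using assms \<open>size > 0\<close> by (simp_all add: less_mult_imp_div_less)
    moreover have "j = j div size * size + j mod size" by (rule div_mult_mod_eq[symmetric])
    ultimately show "\<exists>a<size. \<exists>b<size. j = a * size + b \<and> (arc_at a b \<or> arc_at b a)" by blast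
  qed
  finally show ?thesis unfolding edges_graph .
qed

lemma output_correct:
  "map (\<lambda>j. eval (input w []) BIT (env (length w) j) \<noteq> 0) [0..<eval (input w []) (SIZE * SIZE) (env (length w) 0)]
     = encode_graph graph"
proof -
  have "verts graph = {..<size}" by (simp add: graph_def)
  moreover have "eval (input w []) (SIZE * SIZE) (env (length w) 0) = size * size"
    by (simp add: eval_sizes env_def)
  ultimately show ?thesis using holds_BIT by (simp add: encode_graph_eq)
qed

text \<open>A yes-instance with the same encoding must be this very graph, by injectivity of the
  encoding.\<close>

lemma reduction_correct:
  "encode_graph graph \<in> encode_graph ` instances"
  "encode_graph graph \<in> encode_graph ` yes_instances \<longleftrightarrow>
     cnf_satisfiable (nv w) (nc w) (pos w) (neg w)"
proof -
  show "encode_graph graph \<in> encode_graph ` instances" using graph_instance by blast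
  have "encode_graph graph \<in> encode_graph ` yes_instances \<longleftrightarrow>
      (\<exists>f. locally_balanced_closed graph f)"
    using graph_instance inj_onD[OF encode_graph_inj] by blast
  also have "\<dots> \<longleftrightarrow> cnf_satisfiable (nv w) (nc w) (pos w) (neg w)"
    unfolding graph_correct using satisfiable_imp satisfiable_conv by blast
  finally show "encode_graph graph \<in> encode_graph ` yes_instances \<longleftrightarrow>
     cnf_satisfiable (nv w) (nc w) (pos w) (neg w)" .
qed

end

theorem cnf_reduction:
  "\<exists>f. polynomial_time_computable f \<and> (\<forall>w. f w \<in> encode_graph ` instances \<and>
     (f w \<in> encode_graph ` yes_instances \<longleftrightarrow>
       cnf_satisfiable (nv w) (nc w) (pos w) (neg w)))"
  using expression_computable[of BIT "SIZE * SIZE"] reduction_correct unfolding output_correct by blast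

end

section \<open>Indexed families of clauses\<close>

text \<open>A family consists of a condition, the negated and the unnegated variables of a clause, all
  depending on the six parameters held in the expression variables 1 to 6.\<close>

type_synonym family = "exp \<times> exp list \<times> exp list"

text \<open>Intended reading: time \<open>t\<close>, tape \<open>i\<close>, cells \<open>p\<close>
  and \<open>q\<close>, symbol \<open>s\<close>, transition \<open>r\<close>.\<close>

definition params :: "bool list \<Rightarrow> nat \<Rightarrow> nat \<Rightarrow> nat \<Rightarrow> nat \<Rightarrow> nat \<Rightarrow> nat \<Rightarrow> nat \<Rightarrow> nat" where
  "params w t i p q s r = (\<lambda>_. 0)(0 := length w, 1 := t, 2 := i, 3 := p, 4 := q, 5 := s, 6 := r)"

abbreviation eval_at where
  "eval_at w t i p q s r e \<equiv> eval (input w []) e (params w t i p q s r)"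

abbreviation holds_at where
  "holds_at w t i p q s r e \<equiv> holds (input w []) e (params w t i p q s r)"

abbreviation bind where
  "bind \<sigma> t i p q s r k \<equiv> (\<sigma> :: nat \<Rightarrow> nat)(1 := t, 2 := i, 3 := p, 4 := q, 5 := s, 6 := r, 7 := k :: nat)"

lemma mixed_radix_eq:
  "b < B \<Longrightarrow> b' < B \<Longrightarrow> a * B + b = a' * B + b' \<longleftrightarrow> a = a' \<and> b = (b' :: nat)"
  by (metis add.commute add_left_cancel div_mult_self3 mod_mult_self3 div_less mod_less add_0 less_zeroE gr0I mult_0_right)

lemma mixed_radix_less: "a < A \<Longrightarrow> b < B \<Longrightarrow> a * B + b < A * (B :: nat)"
proof -
  assume "a < A" "b < B"
  then have "a * B + b < Suc a * B" by simp
  also have "\<dots> \<le> A * B" using \<open>a < A\<close> by (intro mult_le_mono1) simp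
  finally show ?thesis .
qed

definition code :: "nat \<Rightarrow> nat \<Rightarrow> nat \<Rightarrow> nat \<Rightarrow> nat \<Rightarrow> nat \<Rightarrow> nat" where
  "code B k a b c d = (((k * B + a) * B + b) * B + c) * B + d"

lemma code_eq:
  "a < B \<Longrightarrow> b < B \<Longrightarrow> c < B \<Longrightarrow> d < B \<Longrightarrow> a' < B \<Longrightarrow> b' < B \<Longrightarrow> c' < B \<Longrightarrow> d' < B \<Longrightarrow>
    code B k a b c d = code B k' a' b' c' d' \<longleftrightarrow> k = k' \<and> a = a' \<and> b = b' \<and> c = c' \<and> d = d'"
  by (simp add: code_def mixed_radix_eq)

lemma code_less:
  "k < B \<Longrightarrow> a < B \<Longrightarrow> b < B \<Longrightarrow> c < B \<Longrightarrow> d < B \<Longrightarrow> code B k a b c d < B * B * B * B * B"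
  unfolding code_def by (intro mixed_radix_less)

text \<open>All digits are taken in base \<open>bnd w\<close>. A clause number has seven digits, the
  family and its six parameters, which is why the base exceeds the number of families; a variable
  number has five.\<close>

locale clause_families =
  fixes fams :: "family list" and BB :: exp and bnd :: "bool list \<Rightarrow> nat"
  assumes BB: "\<And>w \<sigma>. \<sigma> 0 = length w \<Longrightarrow> eval (input w []) BB \<sigma> = bnd w"
    and bnd: "\<And>w. bnd w > length fams"
    and vars: "\<And>cond negs poss e. (cond, negs, poss) \<in> set fams \<Longrightarrow> e \<in> {cond} \<union> set negs \<union> set poss \<Longrightarrow>
      var_bound e \<le> 7"
    and lits: "\<And>cond negs poss e w t i p q s r. (cond, negs, poss) \<in> set fams \<Longrightarrow> e \<in> set negs \<union> set poss \<Longrightarrow>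
      t < bnd w \<Longrightarrow> i < bnd w \<Longrightarrow> p < bnd w \<Longrightarrow> q < bnd w \<Longrightarrow> s < bnd w \<Longrightarrow> r < bnd w \<Longrightarrow>
      holds_at w t i p q s r cond \<Longrightarrow>
      eval_at w t i p q s r e < bnd w * bnd w * bnd w * bnd w * bnd w"
begin

definition tuple_code :: exp where
  "tuple_code = (((((Var 7 * BB + Var 1) * BB + Var 2) * BB + Var 3) * BB + Var 4) * BB + Var 5) * BB + Var 6"

text \<open>Some of the variables 1 to 7 are in use in \<open>ARC\<close> and \<open>LIT\<close>;
  rebinding them is harmless because a sum assigns its variable only within its body.\<close>

definition for_tuple :: "exp \<Rightarrow> exp" where
  "for_tuple e = Exists 1 BB (Exists 2 BB (Exists 3 BB (Exists 4 BB (Exists 5 BB (Exists 6 BB (Exists 7 BB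
     (Conj (Equal (Var 10) tuple_code) e)))))))"

definition for_family :: "(family \<Rightarrow> exp) \<Rightarrow> exp" where
  "for_family g = for_tuple (Disjs (map (\<lambda>k. Conj (Equal (Var 7) (Const k)) (Conj (fst (fams ! k)) (g (fams ! k))))
     [0..<length fams]))"

text \<open>Numbers that denote no clause, or one whose condition fails, receive variable 0 as
  positive literal and are thereby satisfied.\<close>

definition POS :: exp where
  "POS = Disj (Conj (Neg (for_family (\<lambda>_. Const 1))) (Equal (Var 11) (Const 0)))
     (for_family (\<lambda>(cond, negs, poss). Disjs (map (Equal (Var 11)) poss)))"

definition NEG :: exp where
  "NEG = for_family (\<lambda>(cond, negs, poss). Disjs (map (Equal (Var 11)) negs))"

definition tuple :: "bool list \<Rightarrow> nat \<Rightarrow> nat \<Rightarrow> nat \<Rightarrow> nat \<Rightarrow> nat \<Rightarrow> nat \<Rightarrow> nat \<Rightarrow> nat" where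
  "tuple w k t i p q s r = (((((k * bnd w + t) * bnd w + i) * bnd w + p) * bnd w + q) * bnd w + s) * bnd w + r"

definition in_family :: "bool list \<Rightarrow> nat \<Rightarrow> ((exp \<Rightarrow> nat) \<Rightarrow> family \<Rightarrow> bool) \<Rightarrow> bool" where
  "in_family w c Q \<longleftrightarrow> (\<exists>t<bnd w. \<exists>i<bnd w. \<exists>p<bnd w. \<exists>q<bnd w. \<exists>s<bnd w. \<exists>r<bnd w. \<exists>k<length fams.
     c = tuple w k t i p q s r \<and> holds_at w t i p q s r (fst (fams ! k)) \<and>
     Q (eval_at w t i p q s r) (fams ! k))"

lemma eval_params:
  assumes "\<sigma> 0 = length w" "var_bound e \<le> 7"
  shows "eval I e (bind \<sigma> t i p q s r k)
    = eval I e (params w t i p q s r)"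
proof (rule eval_cong)
  fix v assume "v < var_bound e"
  then have "v < 7" using assms(2) by simp
  then have "v = 0 \<or> v = 1 \<or> v = 2 \<or> v = 3 \<or> v = 4 \<or> v = 5 \<or> v = 6" by linarith
  then show "(bind \<sigma> t i p q s r k) v = params w t i p q s r v"
    using assms(1) by (auto simp: params_def)
qed

lemma holds_for_family:
  assumes "\<sigma> 0 = length w"
    and g: "\<And>k t i p q s r. k < length fams \<Longrightarrow>
      holds (input w []) (g (fams ! k)) (bind \<sigma> t i p q s r k) \<longleftrightarrow>
      Q (eval_at w t i p q s r) (fams ! k)"
  shows "holds (input w []) (for_family g) \<sigma> \<longleftrightarrow> in_family w (\<sigma> 10) Q"
proof -
  have cond: "holds (input w []) (fst (fams ! k)) (bind \<sigma> t i p q s r k) \<longleftrightarrow>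
      holds_at w t i p q s r (fst (fams ! k))" if "k < length fams" for k t i p q s r
  proof -
    have "(fst (fams ! k), fst (snd (fams ! k)), snd (snd (fams ! k))) \<in> set fams" using that by simp
    from vars[OF this, of "fst (fams ! k)"] have "var_bound (fst (fams ! k)) \<le> 7" by simp
    then show ?thesis using eval_params[of \<sigma>, OF assms(1)] by simp
  qed
  have inner: "(\<exists>k<bnd w. \<sigma> 10 = tuple w k t i p q s r \<and>
      (\<exists>k'\<in>{0..<length fams}. k = k' \<and>
        holds (input w []) (fst (fams ! k')) (bind \<sigma> t i p q s r k) \<and>
        holds (input w []) (g (fams ! k')) (bind \<sigma> t i p q s r k))) \<longleftrightarrow>
      (\<exists>k<length fams. \<sigma> 10 = tuple w k t i p q s r \<and> holds_at w t i p q s r (fst (fams ! k)) \<and>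
     Q (eval_at w t i p q s r) (fams ! k))"
      (is "?l \<longleftrightarrow> ?r")
    for t i p q s r
    proof
      assume ?l
      then obtain k where k: "k < length fams" "\<sigma> 10 = tuple w k t i p q s r"
        "holds (input w []) (fst (fams ! k)) (bind \<sigma> t i p q s r k)"
        "holds (input w []) (g (fams ! k)) (bind \<sigma> t i p q s r k)"
        by auto
      then show ?r using cond[OF k(1)] g[OF k(1)] by blast
    next
      assume ?r
      then obtain k where k: "k < length fams" "\<sigma> 10 = tuple w k t i p q s r"
        "holds_at w t i p q s r (fst (fams ! k))"
        "Q (eval_at w t i p q s r) (fams ! k)" by blast
      moreover have "k < bnd w" using k(1) bnd[of w] by simp
      moreover have "k \<in> {0..<length fams}" using k(1) by simp
      ultimately show ?l using cond[OF k(1)] g[OF k(1)] by blast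
    qed
  have "holds (input w []) (for_family g) \<sigma> \<longleftrightarrow>
    (\<exists>t<bnd w. \<exists>i<bnd w. \<exists>p<bnd w. \<exists>q<bnd w. \<exists>s<bnd w. \<exists>r<bnd w. \<exists>k<bnd w. \<sigma> 10 = tuple w k t i p q s r \<and>
      (\<exists>k'\<in>{0..<length fams}. k = k' \<and>
        holds (input w []) (fst (fams ! k')) (bind \<sigma> t i p q s r k) \<and>
        holds (input w []) (g (fams ! k')) (bind \<sigma> t i p q s r k)))"
    unfolding for_family_def for_tuple_def tuple_code_def tuple_def
    using assms(1) by (simp add: BB)
  also have "\<dots> \<longleftrightarrow> in_family w (\<sigma> 10) Q"
    unfolding in_family_def inner ..
  finally show ?thesis .
qed

definition pos :: "bool list \<Rightarrow> nat \<Rightarrow> nat \<Rightarrow> bool" where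
  "pos w c x \<longleftrightarrow> \<not> in_family w c (\<lambda>_ _. True) \<and> x = 0 \<or>
     in_family w c (\<lambda>ev (cond, negs, poss). \<exists>e\<in>set poss. x = ev e)"

definition neg :: "bool list \<Rightarrow> nat \<Rightarrow> nat \<Rightarrow> bool" where
  "neg w c x \<longleftrightarrow> in_family w c (\<lambda>ev (cond, negs, poss). \<exists>e\<in>set negs. x = ev e)"

lemma holds_literals:
  assumes "\<sigma> 0 = length w" "k < length fams"
  shows "holds (input w []) (case fams ! k of (cond, negs, poss) \<Rightarrow> Disjs (map (Equal (Var 11)) poss))
      (bind \<sigma> t i p q s r k) \<longleftrightarrow>
    (case fams ! k of (cond, negs, poss) \<Rightarrow> \<exists>e\<in>set poss. \<sigma> 11 = eval_at w t i p q s r e)"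
    (is ?pos)
  and "holds (input w []) (case fams ! k of (cond, negs, poss) \<Rightarrow> Disjs (map (Equal (Var 11)) negs))
      (bind \<sigma> t i p q s r k) \<longleftrightarrow>
    (case fams ! k of (cond, negs, poss) \<Rightarrow> \<exists>e\<in>set negs. \<sigma> 11 = eval_at w t i p q s r e)"
    (is ?neg)
proof -
  obtain cond negs poss where f: "fams ! k = (cond, negs, poss)" by (cases "fams ! k") auto
  then have "(cond, negs, poss) \<in> set fams" using assms(2) nth_mem by metis
  then have "var_bound e \<le> 7" if "e \<in> set negs \<union> set poss" for e using vars that by blast
  then have "eval (input w []) e (bind \<sigma> t i p q s r k)
      = eval_at w t i p q s r e" if "e \<in> set negs \<union> set poss" for e
    using eval_params[of \<sigma>, OF assms(1)] that by blast
  then show ?pos ?neg unfolding f by (simp_all cong: bex_cong)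
qed

sublocale cnf_expressions "BB * BB * BB * BB * BB" "BB * BB * BB * BB * BB * BB * BB" POS NEG
  "\<lambda>w. bnd w * bnd w * bnd w * bnd w * bnd w" "\<lambda>w. bnd w * bnd w * bnd w * bnd w * bnd w * bnd w * bnd w" pos neg
proof
  fix w :: "bool list" and \<sigma> :: "nat \<Rightarrow> nat" assume \<sigma>: "\<sigma> 0 = length w"
  show "eval (input w []) (BB * BB * BB * BB * BB) \<sigma> = bnd w * bnd w * bnd w * bnd w * bnd w"
    "eval (input w []) (BB * BB * BB * BB * BB * BB * BB) \<sigma> = bnd w * bnd w * bnd w * bnd w * bnd w * bnd w * bnd w"
    using BB[of \<sigma>, OF \<sigma>] by simp_all
  have 1: "holds (input w []) (for_family (\<lambda>_. Const 1)) \<sigma> \<longleftrightarrow> in_family w (\<sigma> 10) (\<lambda>_ _. True)"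
    by (rule holds_for_family[of \<sigma>, OF \<sigma>]) simp
  have 2: "holds (input w []) (for_family (\<lambda>(cond, negs, poss). Disjs (map (Equal (Var 11)) poss))) \<sigma> \<longleftrightarrow>
      in_family w (\<sigma> 10) (\<lambda>ev (cond, negs, poss). \<exists>e\<in>set poss. \<sigma> 11 = ev e)"
    by (rule holds_for_family[of \<sigma>, OF \<sigma>]) (rule holds_literals(1)[of \<sigma>, OF \<sigma>])
  show "holds (input w []) POS \<sigma> \<longleftrightarrow> pos w (\<sigma> 10) (\<sigma> 11)"
    unfolding POS_def pos_def holds_simps 1 2 eval.simps ..
  show "holds (input w []) NEG \<sigma> \<longleftrightarrow> neg w (\<sigma> 10) (\<sigma> 11)"
    unfolding NEG_def neg_def by (rule holds_for_family[of \<sigma>, OF \<sigma>]) (rule holds_literals(2)[of \<sigma>, OF \<sigma>])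
next
  fix w :: "bool list"
  show "bnd w * bnd w * bnd w * bnd w * bnd w > 0" "bnd w * bnd w * bnd w * bnd w * bnd w * bnd w * bnd w > 0"
    using bnd[of w] by (simp_all add: gr_implies_not0 neq0_conv[symmetric] del: neq0_conv)
qed

definition solves :: "bool list \<Rightarrow> (nat \<Rightarrow> bool) \<Rightarrow> bool" where
  "solves w \<alpha> \<longleftrightarrow> (\<forall>(cond, negs, poss)\<in>set fams.
     \<forall>t<bnd w. \<forall>i<bnd w. \<forall>p<bnd w. \<forall>q<bnd w. \<forall>s<bnd w. \<forall>r<bnd w.
       holds_at w t i p q s r cond \<longrightarrow>
       (\<exists>e\<in>set poss. \<alpha> (eval_at w t i p q s r e)) \<or>
       (\<exists>e\<in>set negs. \<not> \<alpha> (eval_at w t i p q s r e)))"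

lemma tuple_eq:
  assumes "t < bnd w" "i < bnd w" "p < bnd w" "q < bnd w" "s < bnd w" "r < bnd w"
    "t' < bnd w" "i' < bnd w" "p' < bnd w" "q' < bnd w" "s' < bnd w" "r' < bnd w"
  shows "tuple w k t i p q s r = tuple w k' t' i' p' q' s' r' \<longleftrightarrow>
    k = k' \<and> t = t' \<and> i = i' \<and> p = p' \<and> q = q' \<and> s = s' \<and> r = r'"
  using assms by (simp add: tuple_def mixed_radix_eq)

lemma in_family_tuple:
  assumes "t < bnd w" "i < bnd w" "p < bnd w" "q < bnd w" "s < bnd w" "r < bnd w" "k < length fams"
  shows "in_family w (tuple w k t i p q s r) Q \<longleftrightarrow>
     holds_at w t i p q s r (fst (fams ! k)) \<and>
     Q (eval_at w t i p q s r) (fams ! k)"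
  unfolding in_family_def using assms tuple_eq by (metis (no_types, lifting))

lemma satisfiable_iff:
  "cnf_satisfiable (bnd w * bnd w * bnd w * bnd w * bnd w)
     (bnd w * bnd w * bnd w * bnd w * bnd w * bnd w * bnd w) (pos w) (neg w) \<longleftrightarrow>
   (\<exists>\<alpha>. \<alpha> 0 \<and> solves w \<alpha>)"
  (is "cnf_satisfiable ?nv ?nc _ _ \<longleftrightarrow> _")
proof
  assume "cnf_satisfiable ?nv ?nc (pos w) (neg w)"
  then obtain \<alpha> where \<alpha>: "\<alpha> 0" "\<And>c. c < ?nc \<Longrightarrow> \<exists>x<?nv. pos w c x \<and> \<alpha> x \<or> neg w c x \<and> \<not> \<alpha> x"
    unfolding cnf_satisfiable_def by blast
  have "(\<exists>e\<in>set poss. \<alpha> (eval_at w t i p q s r e)) \<or>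
      (\<exists>e\<in>set negs. \<not> \<alpha> (eval_at w t i p q s r e))"
    if f: "(cond, negs, poss) \<in> set fams"
      and le: "t < bnd w" "i < bnd w" "p < bnd w" "q < bnd w" "s < bnd w" "r < bnd w"
      and c: "holds_at w t i p q s r cond"
    for cond negs poss t i p q s r
  proof -
    obtain k where k: "k < length fams" "fams ! k = (cond, negs, poss)" using f by (auto simp: in_set_conv_nth)
    have "k < bnd w" using k(1) bnd[of w] by simp
    then have "tuple w k t i p q s r < ?nc"
      unfolding tuple_def using le by (intro mixed_radix_less)
    from \<alpha>(2)[OF this] obtain x where
      "pos w (tuple w k t i p q s r) x \<and> \<alpha> x \<or> neg w (tuple w k t i p q s r) x \<and> \<not> \<alpha> x" by blast
    then have "(\<exists>e\<in>set poss. x = eval_at w t i p q s r e) \<and> \<alpha> x \<or>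
        (\<exists>e\<in>set negs. x = eval_at w t i p q s r e) \<and> \<not> \<alpha> x"
      unfolding pos_def neg_def in_family_tuple[OF le k(1)] k(2) using c by simp
    then show ?thesis by blast
  qed
  then have "solves w \<alpha>" unfolding solves_def by (intro ballI case_prodI2 allI impI) blast
  then show "\<exists>\<alpha>. \<alpha> 0 \<and> solves w \<alpha>" using \<alpha>(1) by blast
next
  assume "\<exists>\<alpha>. \<alpha> 0 \<and> solves w \<alpha>"
  then obtain \<alpha> where \<alpha>: "\<alpha> 0" "solves w \<alpha>" by blast
  have "\<exists>x<?nv. pos w c x \<and> \<alpha> x \<or> neg w c x \<and> \<not> \<alpha> x" for c
  proof (cases "in_family w c (\<lambda>_ _. True)")
    case False
    then show ?thesis using \<alpha>(1) nv[of w] unfolding pos_def by blast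
  next
    case True
    then obtain t i p q s r k where le: "t < bnd w" "i < bnd w" "p < bnd w" "q < bnd w" "s < bnd w" "r < bnd w"
        "k < length fams" and c: "c = tuple w k t i p q s r"
        and cond: "holds_at w t i p q s r (fst (fams ! k))"
      unfolding in_family_def by blast
    obtain cond negs poss where f: "fams ! k = (cond, negs, poss)" by (cases "fams ! k") auto
    have mem: "(cond, negs, poss) \<in> set fams" using f le(7) nth_mem by metis
    let ?ev = "\<lambda>e. eval_at w t i p q s r e"
    have "(\<exists>e\<in>set poss. \<alpha> (?ev e)) \<or> (\<exists>e\<in>set negs. \<not> \<alpha> (?ev e))"
      using \<alpha>(2)[unfolded solves_def, rule_format, OF mem] le cond f by simp
    then obtain e where e: "e \<in> set poss \<and> \<alpha> (?ev e) \<or> e \<in> set negs \<and> \<not> \<alpha> (?ev e)" by blast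
    then have "?ev e < ?nv" using lits[OF mem] le cond f by auto
    moreover have "pos w c (?ev e) \<and> \<alpha> (?ev e) \<or> neg w c (?ev e) \<and> \<not> \<alpha> (?ev e)"
      unfolding pos_def neg_def c in_family_tuple[OF le] f using e cond f by auto
    ultimately show ?thesis by (intro exI[of _ "?ev e"] conjI)
  qed
  then show "cnf_satisfiable ?nv ?nc (pos w) (neg w)" unfolding cnf_satisfiable_def using \<alpha>(1) by blast
qed

end

section \<open>Accepting computations as tableaux\<close>

fun shift :: "move \<Rightarrow> nat" where
  "shift MoveLeft = 0"
| "shift Stay = 1"
| "shift MoveRight = 2"

lemma move_head_shift: "move_head m p = p + int (shift m) - 1"
  by (cases m) auto

text \<open>The state is treated as the contents of cell 0 of an additional tape 0, whose head never moves.\<close>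

definition tape_at :: "config \<Rightarrow> nat \<Rightarrow> tape" where
  "tape_at c i = (if i = 0 then (\<lambda>p. if p = 0 then fst c else 0, 0) else snd c ! (i - 1))"

locale tableau =
  fixes M :: machine and trs :: "transition list"
  assumes machine: "turing_machine M" and trs: "set trs = transitions M"
begin

definition K :: nat where "K = Suc (tape_count M)"
definition R :: nat where "R = length trs"

definition read_sym :: "nat \<Rightarrow> nat \<Rightarrow> nat" where
  "read_sym r i = (case trs ! r of (q, rs, q', as) \<Rightarrow> (q # rs) ! i)"

definition action_at :: "nat \<Rightarrow> nat \<Rightarrow> action" where
  "action_at r i = (case trs ! r of (q, rs, q', as) \<Rightarrow> ((q', Stay) # as) ! i)"

definition write_sym :: "nat \<Rightarrow> nat \<Rightarrow> nat" where "write_sym r i = fst (action_at r i)"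
definition head_shift :: "nat \<Rightarrow> nat \<Rightarrow> nat" where "head_shift r i = shift (snd (action_at r i))"

definition applicable :: "nat \<Rightarrow> config \<Rightarrow> bool" where
  "applicable r c \<longleftrightarrow> r < R \<and> (\<forall>i<K. read_tape (tape_at c i) = read_sym r i)"

definition result :: "nat \<Rightarrow> config \<Rightarrow> config" where
  "result r c = (case trs ! r of (q, rs, q', as) \<Rightarrow> (q', map2 act as (snd c)))"

definition proper :: "config \<Rightarrow> bool" where
  "proper c \<longleftrightarrow> length (snd c) = tape_count M"

lemma trs_lengths:
  assumes "r < R" "trs ! r = (q, rs, q', as)"
  shows "length rs = tape_count M" "length as = tape_count M"
proof -
  have "(q, rs, q', as) \<in> transitions M"
    using assms nth_mem[of r trs] trs unfolding R_def by metis
  then show "length rs = tape_count M" "length as = tape_count M"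
    using machine unfolding turing_machine_def by auto
qed

lemma all_less_Suc: "(\<forall>i<Suc n. P i) \<longleftrightarrow> P 0 \<and> (\<forall>i<n. P (Suc i))"
  by (auto simp: less_Suc_eq_0_disj)

lemma applicable_iff:
  assumes "proper c" "r < R"
  shows "applicable r c \<longleftrightarrow> (\<exists>q' as. trs ! r = (fst c, map read_tape (snd c), q', as))"
proof -
  obtain q rs q' as where t: "trs ! r = (q, rs, q', as)" by (cases "trs ! r") auto
  have "applicable r c \<longleftrightarrow> fst c = q \<and> (\<forall>i<tape_count M. read_tape (snd c ! i) = rs ! i)"
    using assms(2) unfolding applicable_def K_def all_less_Suc
    by (simp add: tape_at_def read_sym_def t)
  also have "\<dots> \<longleftrightarrow> fst c = q \<and> map read_tape (snd c) = rs"
    using assms(1) trs_lengths[OF assms(2) t] by (auto simp: list_eq_iff_nth_eq proper_def)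
  finally show ?thesis using t by auto
qed

lemma step_iff:
  assumes "proper c"
  shows "step M c c' \<longleftrightarrow> (\<exists>r. applicable r c \<and> c' = result r c)"
proof
  assume "step M c c'"
  then obtain q' as where t: "(fst c, map read_tape (snd c), q', as) \<in> transitions M"
    "c' = (q', map2 act as (snd c))" unfolding step_def by auto
  then obtain r where r: "r < R" "trs ! r = (fst c, map read_tape (snd c), q', as)"
    unfolding trs[symmetric] R_def by (auto simp: in_set_conv_nth)
  then have "applicable r c" using applicable_iff[OF assms r(1)] by blast
  moreover have "c' = result r c" using r(2) t(2) by (simp add: result_def)
  ultimately show "\<exists>r. applicable r c \<and> c' = result r c" by blast
next
  assume "\<exists>r. applicable r c \<and> c' = result r c"
  then obtain r where r: "applicable r c" "c' = result r c" by blast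
  then have "r < R" unfolding applicable_def by blast
  then obtain q' as where t: "trs ! r = (fst c, map read_tape (snd c), q', as)"
    using applicable_iff[OF assms] r(1) by blast
  then have "(fst c, map read_tape (snd c), q', as) \<in> transitions M"
    using \<open>r < R\<close> nth_mem[of r trs] trs unfolding R_def by metis
  moreover have "c' = (q', map2 act as (snd c))" using r(2) t by (simp add: result_def)
  ultimately show "step M c c'" unfolding step_def by (metis prod.collapse)
qed

lemma result_proper: "proper c \<Longrightarrow> r < R \<Longrightarrow> proper (result r c)"
  using trs_lengths[of r] unfolding proper_def result_def by (auto split: prod.split)

lemma tape_at_result:
  assumes "proper c" "r < R" "i < K"
  shows "tape_at (result r c) i = act (write_sym r i, snd (action_at r i)) (tape_at c i)"
proof -
  obtain q rs q' as where t: "trs ! r = (q, rs, q', as)" by (cases "trs ! r") auto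
  show ?thesis
  proof (cases i)
    case 0
    then show ?thesis
      by (auto simp: tape_at_def result_def action_at_def write_sym_def t fun_eq_iff)
  next
    case (Suc j)
    then show ?thesis
      using assms trs_lengths[OF assms(2) t]
      by (simp add: tape_at_def result_def action_at_def write_sym_def t K_def proper_def)
  qed
qed

lemma tape_at_result':
  assumes "proper c" "r < R" "i < K"
  shows "fst (tape_at (result r c) i) = (fst (tape_at c i))(snd (tape_at c i) := write_sym r i)"
    and "snd (tape_at (result r c) i) = snd (tape_at c i) + int (head_shift r i) - 1"
  using tape_at_result[OF assms] by (cases "tape_at c i"; simp add: head_shift_def move_head_shift)+

definition initial_sym :: "bool list \<Rightarrow> nat \<Rightarrow> nat \<Rightarrow> nat \<Rightarrow> nat" where
  "initial_sym w t i p = fst (tape_at (initial_config M w) i) (int p - int t)"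

text \<open>Time is bounded by \<open>t0\<close>, cell \<open>p\<close> of the tableau is cell \<open>p - t0\<close> of the tape, and
  index \<open>R\<close> stands for an idle step, used once the machine has halted.\<close>

definition constraints ::
  "bool list \<Rightarrow> nat \<Rightarrow> nat \<Rightarrow> (nat \<Rightarrow> nat \<Rightarrow> nat \<Rightarrow> nat \<Rightarrow> bool) \<Rightarrow> (nat \<Rightarrow> nat \<Rightarrow> nat \<Rightarrow> bool) \<Rightarrow>
    (nat \<Rightarrow> nat \<Rightarrow> bool) \<Rightarrow> (nat \<Rightarrow> nat \<Rightarrow> bool) \<Rightarrow> bool" where
  "constraints w t0 B cell at_head tr mis \<longleftrightarrow>
    (\<forall>t<t0. \<exists>r\<le>R. tr t r) \<and>
    (\<forall>i<K. \<forall>p\<le>2 * t0. cell 0 i p (initial_sym w t0 i p)) \<and>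
    (\<forall>i<K. at_head 0 i t0) \<and>
    (\<forall>t<t0. \<forall>r<R. \<forall>i<K. \<forall>p\<le>2 * t0. \<forall>s<B. tr t r \<longrightarrow> at_head t i p \<longrightarrow> cell t i p s \<longrightarrow> s = read_sym r i) \<and>
    (\<forall>t<t0. \<forall>r<R. \<forall>i<K. \<forall>p\<le>2 * t0. tr t r \<longrightarrow> at_head t i p \<longrightarrow> cell (t + 1) i p (write_sym r i)) \<and>
    (\<forall>t<t0. \<forall>r<R. \<forall>i<K. \<forall>p\<le>2 * t0. \<forall>q\<le>2 * t0. p + head_shift r i = q + 1 \<longrightarrow> tr t r \<longrightarrow> at_head t i p \<longrightarrow> at_head (t + 1) i q) \<and>
    (\<forall>t<t0. \<forall>i<K. \<forall>p\<le>2 * t0. \<forall>q\<le>2 * t0. \<forall>s<B. p \<noteq> q \<longrightarrow> at_head t i p \<longrightarrow> cell t i q s \<longrightarrow> cell (t + 1) i q s) \<and>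
    (\<forall>t<t0. \<forall>i<K. \<forall>p\<le>2 * t0. \<forall>s<B. tr t R \<longrightarrow> cell t i p s \<longrightarrow> cell (t + 1) i p s) \<and>
    (\<forall>t<t0. \<forall>i<K. \<forall>p\<le>2 * t0. tr t R \<longrightarrow> at_head t i p \<longrightarrow> at_head (t + 1) i p) \<and>
    (\<forall>p\<le>2 * t0. \<forall>s<B. s \<noteq> accept_state M \<longrightarrow> at_head t0 0 p \<longrightarrow> \<not> cell t0 0 p s) \<and>
    (\<forall>r<R. \<exists>i<K. mis r i) \<and>
    (\<forall>r<R. \<forall>i<K. \<forall>p\<le>2 * t0. mis r i \<longrightarrow> at_head t0 i p \<longrightarrow> \<not> cell t0 i p (read_sym r i))"

text \<open>States count as symbols since tape 0 holds the state; 2 is the largest input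
  symbol.\<close>

definition symbols_below :: "nat \<Rightarrow> bool" where
  "symbols_below B \<longleftrightarrow> start_state M < B \<and> 2 < B \<and> (\<forall>r<R. \<forall>i<K. read_sym r i < B \<and> write_sym r i < B)"

lemma initial_proper: "proper (initial_config M w)"
  using machine by (simp add: proper_def initial_config_def turing_machine_def)

lemma initial_tape:
  "i < K \<Longrightarrow> tape_at (initial_config M w) i =
     (if i = 0 then (\<lambda>p. if p = 0 then start_state M else 0, 0) else if i = 1 then (word_tape w, 0) else (\<lambda>p. 0, 0))"
  by (auto simp: tape_at_def initial_config_def K_def nth_Cons word_tape_Nil split: nat.split)

lemma initial_less:
  assumes "symbols_below B" "i < K"
  shows "fst (tape_at (initial_config M w) i) p < B"
  unfolding initial_tape[OF assms(2)]
  using assms(1) word_tape_le[of w p] by (auto simp: symbols_below_def)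

text \<open>Several transitions may be marked for one time, so one is chosen. By induction on time,
  the facts about the configuration so reached are forced to hold, and then the matching condition
  shows that the next chosen transition is applicable. At time \<open>t0\<close> the same facts
  yield the accepting state and, for each transition, a tape on which it does not match.\<close>

lemma constraints_imp_accepts:
  assumes B: "symbols_below B" and C: "constraints w t0 B cell at_head tr mis"
  shows "accepts M w"
proof -
  note C = C[unfolded constraints_def]
  note choice = C[THEN conjunct1, rule_format] and C1 = C[THEN conjunct2]
  note init_sym = C1[THEN conjunct1, rule_format] and C2 = C1[THEN conjunct2]
  note init_hd = C2[THEN conjunct1, rule_format] and C3 = C2[THEN conjunct2]
  note match = C3[THEN conjunct1, rule_format] and C4 = C3[THEN conjunct2]
  note writes = C4[THEN conjunct1, rule_format] and C5 = C4[THEN conjunct2]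
  note moves = C5[THEN conjunct1, rule_format] and C6 = C5[THEN conjunct2]
  note frame = C6[THEN conjunct1, rule_format] and C7 = C6[THEN conjunct2]
  note idle_sym = C7[THEN conjunct1, rule_format] and C8 = C7[THEN conjunct2]
  note idle_hd = C8[THEN conjunct1, rule_format] and C9 = C8[THEN conjunct2]
  note acc = C9[THEN conjunct1, rule_format] and C10 = C9[THEN conjunct2]
  note mis_choice = C10[THEN conjunct1, rule_format] and C11 = C10[THEN conjunct2]
  note mismatch = C11[rule_format]
  obtain g where g: "\<And>t. t < t0 \<Longrightarrow> g t \<le> R \<and> tr t (g t)" using choice by metis
  define cf where "cf = rec_nat (initial_config M w) (\<lambda>t c. if g t < R then result (g t) c else c)"
  have cf: "cf 0 = initial_config M w" "cf (Suc t) = (if g t < R then result (g t) (cf t) else cf t)" for t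
    by (simp_all add: cf_def)
  \<comment> \<open>The bound \<open>t\<close> on head positions keeps every head inside the cells 0
    to \<open>2 * t0\<close> of the tableau, and the bound \<open>B\<close> on symbols makes the
    quantifiers over symbols applicable.\<close>
  define inv where "inv t \<longleftrightarrow> proper (cf t) \<and> (step M)\<^sup>*\<^sup>* (initial_config M w) (cf t) \<and>
     (\<forall>i<K. (\<forall>p. fst (tape_at (cf t) i) p < B) \<and> \<bar>snd (tape_at (cf t) i)\<bar> \<le> int t \<and>
        at_head t i (nat (snd (tape_at (cf t) i) + int t0)) \<and>
        (\<forall>p\<le>2 * t0. cell t i p (fst (tape_at (cf t) i) (int p - int t0))))" for t
  have "inv t" if "t \<le> t0" for t
    using that
  proof (induction t)
    case 0
    have "fst (tape_at (initial_config M w) i) p < B" if "i < K" for i p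
      using initial_less[OF B that] .
    moreover have "snd (tape_at (initial_config M w) i) = 0" if "i < K" for i
      unfolding initial_tape[OF that] by simp
    ultimately show ?case
      unfolding inv_def cf using initial_proper init_hd init_sym[unfolded initial_sym_def] by auto
  next
    case (Suc t)
    then have t: "t < t0" and IH: "inv t" by auto
    then have wf: "proper (cf t)" and reach: "(step M)\<^sup>*\<^sup>* (initial_config M w) (cf t)"
      and below: "\<And>i p. i < K \<Longrightarrow> fst (tape_at (cf t) i) p < B"
      and pos: "\<And>i. i < K \<Longrightarrow> \<bar>snd (tape_at (cf t) i)\<bar> \<le> int t"
      and head: "\<And>i. i < K \<Longrightarrow> at_head t i (nat (snd (tape_at (cf t) i) + int t0))"
      and cells: "\<And>i p. i < K \<Longrightarrow> p \<le> 2 * t0 \<Longrightarrow> cell t i p (fst (tape_at (cf t) i) (int p - int t0))"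
      unfolding inv_def by blast+
    let ?p = "\<lambda>i. nat (snd (tape_at (cf t) i) + int t0)"
    have p: "?p i \<le> 2 * t0" "int (?p i) - int t0 = snd (tape_at (cf t) i)" if "i < K" for i
      using pos[OF that] t by auto
    show ?case
    proof (cases "g t < R")
      case False
      then have "g t = R" using g[OF t] by simp
      then have "tr t R" using g[OF t] by metis
      then show ?thesis
        unfolding inv_def cf using False wf reach below pos idle_hd[OF t _ p(1) _ head] cells
          idle_sym[OF t _ _ below _ cells] by fastforce
    next
      case True
      have tr: "tr t (g t)" using g[OF t] by blast
      have rd: "read_tape (tape_at (cf t) i) = read_sym (g t) i" if i: "i < K" for i
      proof -
        have "read_tape (tape_at (cf t) i) = fst (tape_at (cf t) i) (int (?p i) - int t0)"
          unfolding p(2)[OF i] by (cases "tape_at (cf t) i") simp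
        then show ?thesis
          using match[OF t True i p(1)[OF i] below[OF i] tr head[OF i] cells[OF i p(1)[OF i]]] by simp
      qed
      then have "applicable (g t) (cf t)" using True unfolding applicable_def by blast
      then have "step M (cf t) (result (g t) (cf t))" using step_iff[OF wf] by blast
      with reach have reach': "(step M)\<^sup>*\<^sup>* (initial_config M w) (result (g t) (cf t))" by simp
      note new = tape_at_result'[OF wf True]
      have "fst (tape_at (result (g t) (cf t)) i) x < B" if "i < K" for i x
        unfolding new(1)[OF that] using below[OF that] B True that by (simp add: symbols_below_def)
      moreover have shift: "\<bar>snd (tape_at (result (g t) (cf t)) i)\<bar> \<le> int (Suc t)" if "i < K" for i
      proof -
        have "head_shift (g t) i \<le> 2" unfolding head_shift_def by (cases "snd (action_at (g t) i)") auto
        then show ?thesis unfolding new(2)[OF that] using pos[OF that] by auto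
      qed
      moreover have "at_head (Suc t) i (nat (snd (tape_at (result (g t) (cf t)) i) + int t0))" if i: "i < K" for i
      proof -
        let ?q = "nat (snd (tape_at (result (g t) (cf t)) i) + int t0)"
        have "int ?q = snd (tape_at (result (g t) (cf t)) i) + int t0" "?q \<le> 2 * t0"
          using shift[OF i] t by auto
        moreover have "?p i + head_shift (g t) i = ?q + 1"
          using calculation(1) p(2)[OF i] unfolding new(2)[OF i] by linarith
        ultimately show ?thesis using moves[OF t True i p(1)[OF i] _ _ tr head[OF i]] by simp
      qed
      moreover have "cell (Suc t) i x (fst (tape_at (result (g t) (cf t)) i) (int x - int t0))"
        if i: "i < K" and x: "x \<le> 2 * t0" for i x
      proof (cases "x = ?p i")
        case xp: True
        then have "int x - int t0 = snd (tape_at (cf t) i)" using p(2)[OF i] by simp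
        then show ?thesis
          unfolding new(1)[OF i] using writes[OF t True i p(1)[OF i] tr head[OF i]] xp by simp
      next
        case False
        then have "int x - int t0 \<noteq> snd (tape_at (cf t) i)" using p(2)[OF i] by linarith
        then show ?thesis
          unfolding new(1)[OF i]
          using frame[OF t i p(1)[OF i] x below[OF i] _ head[OF i] cells[OF i x]] False by simp
      qed
      ultimately show ?thesis
        unfolding inv_def cf using True reach' result_proper[OF wf True] by simp
    qed
  qed
  then have inv: "inv t0" by blast
  then have wf: "proper (cf t0)" and reach: "(step M)\<^sup>*\<^sup>* (initial_config M w) (cf t0)"
    and below: "\<And>i p. i < K \<Longrightarrow> fst (tape_at (cf t0) i) p < B"
    and pos: "\<And>i. i < K \<Longrightarrow> \<bar>snd (tape_at (cf t0) i)\<bar> \<le> int t0"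
    and head: "\<And>i. i < K \<Longrightarrow> at_head t0 i (nat (snd (tape_at (cf t0) i) + int t0))"
    and cells: "\<And>i p. i < K \<Longrightarrow> p \<le> 2 * t0 \<Longrightarrow> cell t0 i p (fst (tape_at (cf t0) i) (int p - int t0))"
    unfolding inv_def by blast+
  let ?p = "\<lambda>i. nat (snd (tape_at (cf t0) i) + int t0)"
  have p: "?p i \<le> 2 * t0" "int (?p i) - int t0 = snd (tape_at (cf t0) i)" if "i < K" for i
    using pos[OF that] by auto
  have rd: "cell t0 i (?p i) (read_tape (tape_at (cf t0) i))" "read_tape (tape_at (cf t0) i) < B" if i: "i < K" for i
  proof -
    have "read_tape (tape_at (cf t0) i) = fst (tape_at (cf t0) i) (int (?p i) - int t0)"
      unfolding p(2)[OF i] by (cases "tape_at (cf t0) i") simp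
    then show "cell t0 i (?p i) (read_tape (tape_at (cf t0) i))" "read_tape (tape_at (cf t0) i) < B"
      using cells[OF i p(1)[OF i]] below[OF i] by simp_all
  qed
  have K0: "0 < K" by (simp add: K_def)
  have "read_tape (tape_at (cf t0) 0) = accept_state M"
    using acc[OF p(1)[OF K0] rd(2)[OF K0] _ head[OF K0]] rd(1)[OF K0] by blast
  then have "fst (cf t0) = accept_state M" by (simp add: tape_at_def)
  moreover have "\<not> applicable r (cf t0)" for r
  proof
    assume a: "applicable r (cf t0)"
    then have r: "r < R" unfolding applicable_def by blast
    then obtain i where i: "i < K" "mis r i" using mis_choice by blast
    have "read_tape (tape_at (cf t0) i) = read_sym r i" using a i(1) unfolding applicable_def by blast
    then show False using mismatch[OF r i(1) p(1)[OF i(1)] i(2) head[OF i(1)]] rd(1)[OF i(1)] by simp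
  qed
  then have "halted M (cf t0)" unfolding halted_def using step_iff[OF wf] by blast
  ultimately show ?thesis unfolding accepts_def using reach by blast
qed

text \<open>The four relations are read off the accepting run, which is prolonged to length
  \<open>t0\<close> by idle steps.\<close>

lemma accepts_imp_constraints:
  assumes n: "n \<le> t0" "(step M ^^ n) (initial_config M w) c" "halted M c" "fst c = accept_state M"
  shows "\<exists>cell at_head tr mis. constraints w t0 B cell at_head tr mis"
proof -
  obtain f where f: "f 0 = initial_config M w" "f n = c" "\<And>t. t < n \<Longrightarrow> step M (f t) (f (Suc t))"
    using n(2) unfolding relpowp_fun_conv by blast
  have wf: "proper (f t)" if "t \<le> n" for t
    using that
  proof (induction t)
    case (Suc t)
    then have p: "proper (f t)" and s: "step M (f t) (f (Suc t))" using f(3) by auto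
    from s step_iff[OF p] obtain r where "applicable r (f t)" "f (Suc t) = result r (f t)" by blast
    then show ?case using result_proper[OF p] unfolding applicable_def by simp
  qed (use f(1) initial_proper in simp)
  have "\<exists>r. applicable r (f t) \<and> f (Suc t) = result r (f t)" if "t < n" for t
    using f(3)[OF that] step_iff wf that by auto
  then obtain g where g: "\<And>t. t < n \<Longrightarrow> applicable (g t) (f t) \<and> f (Suc t) = result (g t) (f t)" by metis
  \<comment> \<open>Frozen from time \<open>n\<close> on, so that the last row of the tableau is the
    halting configuration.\<close>
  define cf where "cf t = f (min t n)" for t
  have cf_prop: "proper (cf t)" for t unfolding cf_def by (intro wf) simp
  define h where "h t i = snd (tape_at (cf t) i)" for t i
  define s where "s t i p = fst (tape_at (cf t) i) p" for t i p
  have read: "read_tape (tape_at (cf t) i) = s t i (h t i)" for t i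
    unfolding s_def h_def by (cases "tape_at (cf t) i") simp
  define cell where "cell t i p x \<longleftrightarrow> s t i (int p - int t0) = x" for t i p x
  define at_head where "at_head t i p \<longleftrightarrow> h t i = int p - int t0" for t i p
  define tr where "tr t r \<longleftrightarrow> r = (if t < n then g t else R)" for t r
  define mis where "mis r i \<longleftrightarrow> s t0 i (h t0 i) \<noteq> read_sym r i" for r i
  have active: "g t < R" "\<And>i. i < K \<Longrightarrow> s t i (h t i) = read_sym (g t) i"
    "\<And>i. i < K \<Longrightarrow> s (Suc t) i = (s t i)(h t i := write_sym (g t) i)"
    "\<And>i. i < K \<Longrightarrow> h (Suc t) i = h t i + int (head_shift (g t) i) - 1" if "t < n" for t
  proof -
    have c: "cf t = f t" "cf (Suc t) = result (g t) (cf t)" using that g by (auto simp: cf_def)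
    show r: "g t < R" using g[OF that] unfolding applicable_def by blast
    show "s t i (h t i) = read_sym (g t) i" if "i < K" for i
      using g[OF \<open>t < n\<close>] that unfolding applicable_def read[symmetric] c(1) by blast
    show "s (Suc t) i = (s t i)(h t i := write_sym (g t) i)" if "i < K" for i
      unfolding s_def h_def c(2) using tape_at_result'(1)[OF cf_prop r that] by (simp add: fun_eq_iff)
    show "h (Suc t) i = h t i + int (head_shift (g t) i) - 1" if "i < K" for i
      unfolding h_def c(2) using tape_at_result'(2)[OF cf_prop r that] .
  qed
  have idle: "s (Suc t) = s t" "h (Suc t) = h t" if "\<not> t < n" for t
    using that by (simp_all add: s_def h_def cf_def fun_eq_iff min_def)
  have final: "cf t0 = c" using n(1) f(2) by (simp add: cf_def min_def)
  have init: "cf 0 = initial_config M w" using f(1) by (simp add: cf_def)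
  have "constraints w t0 B cell at_head tr mis"
    unfolding constraints_def
  proof (intro conjI allI impI)
    show "\<exists>r\<le>R. tr t r" for t using active(1)[of t] by (auto simp: tr_def less_imp_le)
    show "cell 0 i p (initial_sym w t0 i p)" for i p
      by (simp add: cell_def s_def init initial_sym_def)
    show "at_head 0 i t0" if "i < K" for i
      using initial_tape[OF that] by (simp add: at_head_def h_def init)
    show "x = read_sym r i" if "r < R" "i < K" "tr t r" "at_head t i p" "cell t i p x" for t r i p x
      using that active(2)[of t i] by (auto simp: tr_def at_head_def cell_def split: if_splits)
    show "cell (t + 1) i p (write_sym r i)" if "r < R" "i < K" "tr t r" "at_head t i p" for t r i p
      using that active(3)[of t i] by (auto simp: tr_def at_head_def cell_def split: if_splits)
    show "at_head (t + 1) i q" if "r < R" "i < K" "p + head_shift r i = q + 1" "tr t r" "at_head t i p" for t r i p q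
      using that active(4)[of t i] by (auto simp: tr_def at_head_def split: if_splits)
    show "cell (t + 1) i q x" if "i < K" "p \<noteq> q" "at_head t i p" "cell t i q x" for t i p q x
      using that active(3)[of t i] idle(1)[of t] by (cases "t < n") (auto simp: at_head_def cell_def)
    show "cell (t + 1) i p x" if "tr t R" "cell t i p x" for t i p x
      using that active(1)[of t] idle(1)[of t] by (auto simp: tr_def cell_def split: if_splits)
    show "at_head (t + 1) i p" if "tr t R" "at_head t i p" for t i p
      using that active(1)[of t] idle(2)[of t] by (auto simp: tr_def at_head_def split: if_splits)
    show "\<not> cell t0 0 p x" if "x \<noteq> accept_state M" "at_head t0 0 p" for p x
      using that n(4) by (auto simp: cell_def at_head_def s_def h_def final tape_at_def)
    have "\<not> applicable r c" for r
      using n(3) step_iff[OF cf_prop[of t0]] unfolding final halted_def by blast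
    then show "\<exists>i<K. mis r i" if "r < R" for r
      using that unfolding mis_def read[symmetric] final applicable_def by blast
    show "\<not> cell t0 i p (read_sym r i)" if "mis r i" "at_head t0 i p" for r i p
      using that by (auto simp: mis_def cell_def at_head_def)
  qed
  then show ?thesis by blast
qed

end

section \<open>Tableaux as clauses\<close>

lemma var_bound_le [simp]:
  "var_bound (Neg a) \<le> m \<longleftrightarrow> var_bound a \<le> m"
  "var_bound (Conj a b) \<le> m \<longleftrightarrow> var_bound a \<le> m \<and> var_bound b \<le> m"
  "var_bound (Disj a b) \<le> m \<longleftrightarrow> var_bound a \<le> m \<and> var_bound b \<le> m"
  "var_bound (Less a b) \<le> m \<longleftrightarrow> var_bound a \<le> m \<and> var_bound b \<le> m"
  "var_bound (Equal a b) \<le> m \<longleftrightarrow> var_bound a \<le> m \<and> var_bound b \<le> m"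
  "var_bound (a + b) \<le> m \<longleftrightarrow> var_bound a \<le> m \<and> var_bound b \<le> m"
  "var_bound (a * b) \<le> m \<longleftrightarrow> var_bound a \<le> m \<and> var_bound b \<le> m"
  by (auto simp: Neg_def Conj_def Disj_def Less_def Equal_def Mult_def plus_exp_def times_exp_def)

lemma var_bound_list_le [simp]:
  "var_bound (Conjs es) \<le> m \<longleftrightarrow> (\<forall>e\<in>set es. var_bound e \<le> m)"
  "var_bound (Disjs es) \<le> m \<longleftrightarrow> (\<forall>e\<in>set es. var_bound e \<le> m)"
  by (induction es) (auto simp: Conjs_def Disjs_def)

text \<open>Horner's scheme in variable 0.\<close>

lemma poly_expression: "\<exists>e. var_bound e \<le> 1 \<and> (\<forall>I \<sigma>. eval I e \<sigma> = poly p (\<sigma> 0))"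
proof (induction p)
  case 0
  show ?case by (rule exI[of _ "Const 0"]) simp
next
  case (pCons a p)
  then obtain e where "var_bound e \<le> 1" "\<And>I \<sigma>. eval I e \<sigma> = poly p (\<sigma> 0)" by blast
  then show ?case by (intro exI[of _ "Const a + Var 0 * e"]) simp
qed

locale tableau_expressions = tableau +
  fixes TT :: exp and t0 :: "nat \<Rightarrow> nat" and G :: nat
  assumes TT_vars: "var_bound TT \<le> 1" and TT: "\<And>I \<sigma>. eval I TT \<sigma> = t0 (\<sigma> 0)"
    and G: "symbols_below G"
begin

text \<open>Large enough to be the base for cells up to \<open>2 * t0\<close>, tapes, transitions
  with the idle index, symbols below \<open>G\<close>, the 12 families and the tags 1 to 4.\<close>

definition BB :: exp where "BB = Const 2 * TT + Const (K + R + G + 20)"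
definition bnd :: "bool list \<Rightarrow> nat" where "bnd w = 2 * t0 (length w) + (K + R + G + 20)"

text \<open>The leading digit \<open>k\<close> is a tag for the kind of variable. Tags start at 1,
  so no code collides with variable 0, which stands for truth.\<close>

definition VAR :: "nat \<Rightarrow> exp \<Rightarrow> exp \<Rightarrow> exp \<Rightarrow> exp \<Rightarrow> exp" where
  "VAR k a b c d = (((Const k * BB + a) * BB + b) * BB + c) * BB + d"

definition CELL :: "exp \<Rightarrow> exp \<Rightarrow> exp" where "CELL t p = VAR 1 t (Var 2) p (Var 5)"
definition HEAD :: "exp \<Rightarrow> exp \<Rightarrow> exp" where "HEAD t p = VAR 2 t (Var 2) p (Const 0)"
definition TRANS :: "exp \<Rightarrow> exp" where "TRANS r = VAR 3 (Var 1) r (Const 0) (Const 0)"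
definition MISMATCH :: "exp \<Rightarrow> exp" where "MISMATCH i = VAR 4 (Var 6) i (Const 0) (Const 0)"

definition NEXT :: exp where "NEXT = Var 1 + Const 1"

text \<open>The transition table is not accessible to expressions, so its entries enter as
  constants, by a finite disjunction over all transitions and tapes.\<close>

definition for_rule :: "(nat \<Rightarrow> nat \<Rightarrow> exp) \<Rightarrow> exp" where
  "for_rule g = Disjs (map (\<lambda>(r, i). Conjs [Equal (Var 6) (Const r), Equal (Var 2) (Const i), g r i])
     (List.product [0..<R] [0..<K]))"

definition INITIAL :: exp where
  "INITIAL = Disjs
     [Conj (Equal (Var 2) (Const 0)) (Disj (Conj (Equal (Var 3) TT) (Equal (Var 5) (Const (start_state M))))
        (Conj (Neg (Equal (Var 3) TT)) (Equal (Var 5) (Const 0)))),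
      Conj (Equal (Var 2) (Const 1)) (Disj (Conj (Less (Var 3) TT) (Equal (Var 5) (Const 0)))
        (Conj (Neg (Less (Var 3) TT)) (Equal (Var 5) (Sym False (Monus (Var 3) TT))))),
      Conj (Less (Const 1) (Var 2)) (Equal (Var 5) (Const 0))]"

definition TIME :: exp where "TIME = Less (Var 1) TT"
definition TAPE :: exp where "TAPE = Less (Var 2) (Const K)"
definition CELLS :: "nat \<Rightarrow> exp" where "CELLS v = Less (Var v) (Const 2 * TT + Const 1)"

text \<open>The families correspond, in order, to the conjuncts of \<open>constraints\<close>.
  Premises about the tableau are the negated variables; premises about indices form the
  condition.\<close>

definition fams :: "family list" where
  "fams =
    [(TIME, [], map (\<lambda>r. TRANS (Const r)) [0..<R + 1]),
     (Conjs [TAPE, CELLS 3, INITIAL], [], [CELL (Const 0) (Var 3)]),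
     (TAPE, [], [HEAD (Const 0) TT]),
     (Conjs [TIME, CELLS 3, for_rule (\<lambda>r i. Neg (Equal (Var 5) (Const (read_sym r i))))],
        [TRANS (Var 6), HEAD (Var 1) (Var 3), CELL (Var 1) (Var 3)], []),
     (Conjs [TIME, CELLS 3, for_rule (\<lambda>r i. Equal (Var 5) (Const (write_sym r i)))],
        [TRANS (Var 6), HEAD (Var 1) (Var 3)], [CELL NEXT (Var 3)]),
     (Conjs [TIME, CELLS 3, CELLS 4, for_rule (\<lambda>r i. Equal (Var 3 + Const (head_shift r i)) (Var 4 + Const 1))],
        [TRANS (Var 6), HEAD (Var 1) (Var 3)], [HEAD NEXT (Var 4)]),
     (Conjs [TIME, TAPE, CELLS 3, CELLS 4, Neg (Equal (Var 3) (Var 4))],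
        [HEAD (Var 1) (Var 3), CELL (Var 1) (Var 4)], [CELL NEXT (Var 4)]),
     (Conjs [TIME, TAPE, CELLS 3], [TRANS (Const R), CELL (Var 1) (Var 3)], [CELL NEXT (Var 3)]),
     (Conjs [TIME, TAPE, CELLS 3], [TRANS (Const R), HEAD (Var 1) (Var 3)], [HEAD NEXT (Var 3)]),
     (Conjs [Equal (Var 2) (Const 0), CELLS 3, Neg (Equal (Var 5) (Const (accept_state M)))],
        [HEAD TT (Var 3), CELL TT (Var 3)], []),
     (Less (Var 6) (Const R), [], map (\<lambda>i. MISMATCH (Const i)) [0..<K]),
     (Conjs [CELLS 3, for_rule (\<lambda>r i. Equal (Var 5) (Const (read_sym r i)))],
        [MISMATCH (Var 2), HEAD TT (Var 3), CELL TT (Var 3)], [])]"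

lemma holds_for_rule [simp]:
  "holds I (for_rule g) \<sigma> \<longleftrightarrow> \<sigma> 6 < R \<and> \<sigma> 2 < K \<and> holds I (g (\<sigma> 6) (\<sigma> 2)) \<sigma>"
  by (auto simp: for_rule_def)

lemma var_bound_for_rule [simp]:
  "var_bound (for_rule g) \<le> 7 \<longleftrightarrow> (\<forall>r<R. \<forall>i<K. var_bound (g r i) \<le> 7)"
  by (auto simp: for_rule_def)

lemma eval_BB [simp]: "eval I BB \<sigma> = 2 * t0 (\<sigma> 0) + (K + R + G + 20)"
  by (simp add: BB_def TT)

lemma eval_VAR: "eval I (VAR k a b c d) \<sigma> =
    code (2 * t0 (\<sigma> 0) + (K + R + G + 20)) k (eval I a \<sigma>) (eval I b \<sigma>) (eval I c \<sigma>) (eval I d \<sigma>)"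
  unfolding VAR_def code_def eval_plus_times eval_BB eval.simps ..

lemma var_bound_VAR [simp]: "var_bound (VAR k a b c d) \<le> 7 \<longleftrightarrow>
    var_bound a \<le> 7 \<and> var_bound b \<le> 7 \<and> var_bound c \<le> 7 \<and> var_bound d \<le> 7"
  using TT_vars by (auto simp: VAR_def BB_def)

lemma holds_INITIAL:
  assumes "i < K"
  shows "holds_at w t i p q s r INITIAL \<longleftrightarrow> s = initial_sym w (t0 (length w)) i p"
proof -
  let ?T = "t0 (length w)"
  have "holds_at w t i p q s r INITIAL \<longleftrightarrow>
      i = 0 \<and> (p = ?T \<and> s = start_state M \<or> p \<noteq> ?T \<and> s = 0) \<or>
      i = 1 \<and> (p < ?T \<and> s = 0 \<or> \<not> p < ?T \<and> s = input w [] False (p - ?T)) \<or> 1 < i \<and> s = 0"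
    by (simp add: INITIAL_def params_def TT)
  also have "\<dots> \<longleftrightarrow> s = initial_sym w ?T i p"
  proof -
    consider "i = 0" | "i = 1" | "i > 1" by linarith
    then show ?thesis
    proof cases
      case 1
      have "int p - int ?T = 0 \<longleftrightarrow> p = ?T" by linarith
      then show ?thesis unfolding initial_sym_def initial_tape[OF assms] using 1 by simp
    next
      case 2
      have "word_tape w (int p - int ?T) = (if p < ?T then 0 else input w [] False (p - ?T))"
        by (simp add: word_tape_def input_def of_nat_diff)
      then show ?thesis unfolding initial_sym_def initial_tape[OF assms] using 2 by simp
    next
      case 3
      then show ?thesis unfolding initial_sym_def initial_tape[OF assms] by simp
    qed
  qed
  finally show ?thesis .
qed

lemma params_simps [simp]:
  "params w t i p q s r 0 = length w" "params w t i p q s r 1 = t" "params w t i p q s r (Suc 0) = t"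
  "params w t i p q s r 2 = i" "params w t i p q s r 3 = p" "params w t i p q s r 4 = q"
  "params w t i p q s r 5 = s" "params w t i p q s r 6 = r"
  by (simp_all add: params_def)

lemma eval_VAR_params: "eval I (VAR k a b c d) (params w t i p q s r) =
    code (bnd w) k (eval I a (params w t i p q s r)) (eval I b (params w t i p q s r))
      (eval I c (params w t i p q s r)) (eval I d (params w t i p q s r))"
  by (simp add: bnd_def eval_VAR)

lemma bnd_gt: "2 * t0 (length w) + 20 < bnd w" "K < bnd w" "R < bnd w" "G \<le> bnd w"
  using K_def by (auto simp: bnd_def)

sublocale clause_families fams BB bnd
proof
  show "eval (input w []) BB \<sigma> = bnd w" if "\<sigma> 0 = length w" for w \<sigma>
    using that by (simp add: bnd_def)
  show "length fams < bnd w" for w by (simp add: fams_def bnd_def)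
  have "\<forall>(cond, negs, poss)\<in>set fams. \<forall>e\<in>{cond} \<union> set negs \<union> set poss. var_bound e \<le> 7"
    using TT_vars unfolding fams_def TIME_def TAPE_def CELLS_def TRANS_def HEAD_def CELL_def MISMATCH_def NEXT_def INITIAL_def
    by auto
  then show "var_bound e \<le> 7" if "(cond, negs, poss) \<in> set fams" "e \<in> {cond} \<union> set negs \<union> set poss"
    for cond negs poss e using that by blast
  fix cond negs poss e w t i p q s r
  assume f: "(cond, negs, poss) \<in> set fams" "e \<in> set negs \<union> set poss"
    and le: "t < bnd w" "i < bnd w" "p < bnd w" "q < bnd w" "s < bnd w" "r < bnd w"
    and c: "holds_at w t i p q s r cond"
  have n: "2 * t0 (length w) + 20 < bnd w" "K < bnd w" "R < bnd w" by (rule bnd_gt)+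
  show "eval_at w t i p q s r e < bnd w * bnd w * bnd w * bnd w * bnd w"
    using f c le n unfolding fams_def TIME_def TAPE_def CELLS_def TRANS_def HEAD_def CELL_def MISMATCH_def NEXT_def
    by (auto simp: eval_VAR_params TT intro!: code_less)
qed

definition cell_var :: "bool list \<Rightarrow> (nat \<Rightarrow> bool) \<Rightarrow> nat \<Rightarrow> nat \<Rightarrow> nat \<Rightarrow> nat \<Rightarrow> bool" where
  "cell_var w \<alpha> t i p s = \<alpha> (code (bnd w) 1 t i p s)"
definition head_var :: "bool list \<Rightarrow> (nat \<Rightarrow> bool) \<Rightarrow> nat \<Rightarrow> nat \<Rightarrow> nat \<Rightarrow> bool" where
  "head_var w \<alpha> t i p = \<alpha> (code (bnd w) 2 t i p 0)"
definition trans_var :: "bool list \<Rightarrow> (nat \<Rightarrow> bool) \<Rightarrow> nat \<Rightarrow> nat \<Rightarrow> bool" where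
  "trans_var w \<alpha> t r = \<alpha> (code (bnd w) 3 t r 0 0)"
definition mismatch_var :: "bool list \<Rightarrow> (nat \<Rightarrow> bool) \<Rightarrow> nat \<Rightarrow> nat \<Rightarrow> bool" where
  "mismatch_var w \<alpha> r i = \<alpha> (code (bnd w) 4 r i 0 0)"

lemma initial_sym_less: "i < K \<Longrightarrow> initial_sym w t i p < bnd w'"
  using initial_less[OF G] bnd_gt(4)[of w'] unfolding initial_sym_def by (meson less_le_trans)

text \<open>Both sides become the same twelve conditions, except that the parameters of a family
  range up to \<open>bnd w\<close>. The narrower ranges of the conjuncts lie below that bound, and
  parameters that a family ignores need only one admissible value.\<close>

lemma solves_iff:
  "solves w \<alpha> \<longleftrightarrow> constraints w (t0 (length w)) (bnd w) (cell_var w \<alpha>) (head_var w \<alpha>) (trans_var w \<alpha>) (mismatch_var w \<alpha>)"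
proof -
  have T: "t < bnd w" if "t < t0 (length w)" for t using that bnd_gt(1)[of w] by simp
  have P: "p < bnd w" if "p \<le> 2 * t0 (length w)" for p using that bnd_gt(1)[of w] by simp
  have RK: "r < bnd w" if "r < R" for r using that bnd_gt(3)[of w] by simp
  have KK: "i < bnd w" if "i < K" for i using that bnd_gt(2)[of w] by simp
  have S: "read_sym r i < bnd w" "write_sym r i < bnd w" if "r < R" "i < K" for r i
    using that G bnd_gt(4)[of w] unfolding symbols_below_def by (meson less_le_trans)+
  have ex: "\<exists>x. x < bnd w" using bnd_gt(3)[of w] by blast
  show ?thesis
    unfolding solves_def
    unfolding fams_def TIME_def TAPE_def CELLS_def TRANS_def HEAD_def CELL_def MISMATCH_def NEXT_def
      constraints_def cell_var_def head_var_def trans_var_def mismatch_var_def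
    apply (simp add: TT holds_INITIAL eval_VAR_params initial_sym_less ex less_Suc_eq_le cong: conj_cong)
    apply (intro arg_cong2[where f = "(\<and>)"])
    subgoal using T by (fastforce simp: le_less)
    subgoal using P KK initial_sym_less by meson
    subgoal using KK by meson
    subgoal using T P RK KK by meson
    subgoal by (smt (verit, ccfv_threshold) T P RK KK S(2))
    subgoal using T P RK KK by meson
    subgoal using T P KK by meson
    subgoal using T P KK by meson
    subgoal using T P KK by meson
    subgoal using P ex by (metis gr_zeroI not_less_zero)
    subgoal using RK by fastforce
    subgoal by (smt (verit, ccfv_threshold) P RK KK S(1))
    done
qed

text \<open>An assignment is obtained by decoding variable numbers, which is unambiguous for digits
  below the base; the constraints speak only of such digits.\<close>

lemma constraints_realized:
  assumes "constraints w (t0 (length w)) (bnd w) cell at_head tr mis"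
  shows "\<exists>\<alpha>. \<alpha> 0 \<and> solves w \<alpha>"
proof -
  let ?b = "bnd w"
  define \<alpha> where "\<alpha> x \<longleftrightarrow> x = 0 \<or>
    (\<exists>t<?b. \<exists>i<?b. \<exists>p<?b. \<exists>s<?b. x = code ?b 1 t i p s \<and> cell t i p s) \<or>
    (\<exists>t<?b. \<exists>i<?b. \<exists>p<?b. x = code ?b 2 t i p 0 \<and> at_head t i p) \<or>
    (\<exists>t<?b. \<exists>r<?b. x = code ?b 3 t r 0 0 \<and> tr t r) \<or>
    (\<exists>r<?b. \<exists>i<?b. x = code ?b 4 r i 0 0 \<and> mis r i)" for x
  have b: "0 < ?b" using bnd_gt(1)[of w] by simp
  have nonzero: "(code ?b k a c d e = 0) = False" if "k > 0" for k a c d e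
    using that b by (simp add: code_def)
  have eqs: "cell_var w \<alpha> t i p s \<longleftrightarrow> cell t i p s" if "t < ?b" "i < ?b" "p < ?b" "s < ?b" for t i p s
    using that b unfolding cell_var_def \<alpha>_def by (auto simp: code_eq nonzero)
  have eqh: "head_var w \<alpha> t i p \<longleftrightarrow> at_head t i p" if "t < ?b" "i < ?b" "p < ?b" for t i p
    using that b unfolding head_var_def \<alpha>_def by (auto simp: code_eq nonzero)
  have eqt: "trans_var w \<alpha> t r \<longleftrightarrow> tr t r" if "t < ?b" "r < ?b" for t r
    using that b unfolding trans_var_def \<alpha>_def by (auto simp: code_eq nonzero)
  have eqm: "mismatch_var w \<alpha> r i \<longleftrightarrow> mis r i" if "r < ?b" "i < ?b" for r i
    using that b unfolding mismatch_var_def \<alpha>_def by (auto simp: code_eq nonzero)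
  have T: "t < t0 (length w) \<Longrightarrow> t < ?b" "t < t0 (length w) \<Longrightarrow> Suc t < ?b" "t0 (length w) < ?b" "0 < K" for t
    using bnd_gt(1)[of w] K_def by simp_all
  have P: "p \<le> 2 * t0 (length w) \<Longrightarrow> p < ?b" for p using bnd_gt(1)[of w] by simp
  have RK: "r < R \<Longrightarrow> r < ?b" "r \<le> R \<Longrightarrow> r < ?b" "i < K \<Longrightarrow> i < ?b" for r i
    using bnd_gt(2,3)[of w] by simp_all
  have S: "read_sym r i < ?b" "write_sym r i < ?b" if "r < R" "i < K" for r i
    using that G bnd_gt(4)[of w] unfolding symbols_below_def by (meson less_le_trans)+
  have "constraints w (t0 (length w)) ?b (cell_var w \<alpha>) (head_var w \<alpha>) (trans_var w \<alpha>) (mismatch_var w \<alpha>)"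
    using assms unfolding constraints_def
    by (simp add: eqs eqh eqt eqm T P RK S initial_sym_less b cong: conj_cong)
  moreover have "\<alpha> 0" by (simp add: \<alpha>_def)
  ultimately show ?thesis using solves_iff by blast
qed

text \<open>The time bound covers every branch, hence also the accepting one, so a tableau of height
  \<open>t0\<close> has room for it.\<close>

lemma accepts_iff_solvable:
  assumes "\<And>w n c. (step M ^^ n) (initial_config M w) c \<Longrightarrow> n \<le> t0 (length w)"
  shows "accepts M w \<longleftrightarrow> (\<exists>\<alpha>. \<alpha> 0 \<and> solves w \<alpha>)"
proof
  assume "accepts M w"
  then obtain c n where c: "(step M ^^ n) (initial_config M w) c" "halted M c" "fst c = accept_state M"
    unfolding accepts_def by (auto simp: rtranclp_is_Sup_relpowp)
  from accepts_imp_constraints[OF assms[OF c(1)] c] show "\<exists>\<alpha>. \<alpha> 0 \<and> solves w \<alpha>"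
    using constraints_realized by blast
next
  assume "\<exists>\<alpha>. \<alpha> 0 \<and> solves w \<alpha>"
  moreover have "symbols_below (bnd w)"
    using G bnd_gt(4)[of w] unfolding symbols_below_def by (meson less_le_trans)
  ultimately show "accepts M w" using constraints_imp_accepts solves_iff by blast
qed

end

lemma (in tableau) symbols_below_exists: "\<exists>G. symbols_below G"
proof -
  let ?G = "start_state M + 3 + (\<Sum>r<R. \<Sum>i<K. read_sym r i + write_sym r i)"
  have "read_sym r i + write_sym r i < ?G" if "r < R" "i < K" for r i
  proof -
    have "read_sym r i + write_sym r i \<le> (\<Sum>i<K. read_sym r i + write_sym r i)"
      using that by (intro member_le_sum) auto
    also have "\<dots> \<le> (\<Sum>r<R. \<Sum>i<K. read_sym r i + write_sym r i)"
      using that by (intro member_le_sum[of r _ "\<lambda>r. \<Sum>i<K. read_sym r i + write_sym r i"]) auto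
    finally show ?thesis by simp
  qed
  then have "symbols_below ?G" unfolding symbols_below_def by fastforce
  then show ?thesis by blast
qed

theorem NP_hard:
  assumes "L \<in> NP"
  shows "\<exists>f. polynomial_time_computable f \<and> (\<forall>w. f w \<in> encode_graph ` instances \<and>
     (w \<in> L \<longleftrightarrow> f w \<in> encode_graph ` yes_instances))"
proof -
  obtain M where M: "turing_machine M" "polynomial_time M" "L = {w. accepts M w}"
    using assms unfolding NP_def by blast
  obtain trs where trs: "set trs = transitions M"
    using M(1) finite_list[of "transitions M"] unfolding turing_machine_def by metis
  obtain p where p: "\<And>w n c. (step M ^^ n) (initial_config M w) c \<Longrightarrow> n \<le> poly p (length w)"
    using M(2) unfolding polynomial_time_def by blast
  obtain TT where TT: "var_bound TT \<le> 1" "\<And>I \<sigma>. eval I TT \<sigma> = poly p (\<sigma> 0)"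
    using poly_expression by blast
  interpret tableau M trs using M(1) trs by unfold_locales
  obtain G where G: "symbols_below G" using symbols_below_exists by blast
  interpret tableau_expressions M trs TT "poly p" G
    using TT G by unfold_locales
  from cnf_reduction[unfolded satisfiable_iff] obtain f where f: "polynomial_time_computable f"
    "\<forall>w. f w \<in> encode_graph ` instances \<and>
      (f w \<in> encode_graph ` yes_instances \<longleftrightarrow> (\<exists>\<alpha>. \<alpha> 0 \<and> solves w \<alpha>))"
    by (elim exE conjE) (rule that)
  have "accepts M w \<longleftrightarrow> (\<exists>\<alpha>. \<alpha> 0 \<and> solves w \<alpha>)" for w by (rule accepts_iff_solvable) (rule p)
  then have "w \<in> L \<longleftrightarrow> f w \<in> encode_graph ` yes_instances" for w
    using f(2) unfolding M(3) by simp
  with f show ?thesis by (intro exI[of _ f] conjI allI) simp_all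
qed

theorem theorem4p6:
  "NP_complete encode_graph
     {G. standard_graph G \<and> odd_graph G \<and> max_degree G = 3}
     (\<lambda>G. \<exists>f. locally_balanced_closed G f)"
  unfolding NP_complete_def
proof (intro conjI ballI)
  show "inj_on encode_graph instances"
    by (rule inj_on_subset[OF encode_graph_inj]) blast
  show "encode_graph ` yes_instances \<in> NP"
    by (rule balanced_in_NP)
qed (rule NP_hard)

end
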